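(* Let $m\ge10^3$ be an integer and $\alpha\in(0,\pi/6]$. Let $i,j,k$ be integers such that $i\ge-2$, $k\ge-1$ and $0\le j\le i+2$. Then for any axially symmetric $f\in H^1(D_m)$ with $$\int_{D_m}f(\rho,\phi)\,\rho^i\sin^k\phi\,dx=0,$$ we have $$\int_{D_m}\Big(\frac f\rho\Big)^2\rho^j\sin^k\phi\,dx\le\frac{4}{(j+1)^2}\int_{D_m}|\partial_\rho f|^2\rho^j\sin^k\phi\,dx+\frac{2}{19+k}\int_{D_m}\Big|\frac{\partial_\phi f}{\rho}\Big|^2\rho^j\sin^k\phi\,dx.$$
   Context: Spherical coordinates $(\rho,\phi,\theta)$ on $\mathbb{R}^3$: $\rho=|x|$, $\phi$ the angle from the positive $x_3$-axis, $\theta$ the azimuthal angle. $D_m=\{\frac1m<\rho<1,\ \frac\pi2-\alpha<\phi<\frac\pi2+\alpha,\ \theta\in[0,2\pi)\}$. Axially symmetric means $f=f(\rho,\phi)$ does not depend on $\theta$; $dx=\rho^2\sin\phi\,d\rho\,d\phi\,d\theta$. *)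

theory Defs
  imports "HOL-Analysis.Analysis"
begin

section \<open>Sobolev space \<open>H\<^sup>1\<close>\<close>

text \<open>\<open>Ck n u\<close>: \<open>u\<close> is of class \<open>C\<^sup>n\<close> on the whole space; in finite dimension the derivative is
  \<open>C\<^sup>n\<close> iff all directional derivatives are.\<close>

primrec Ck :: "nat \<Rightarrow> ('a::euclidean_space \<Rightarrow> real) \<Rightarrow> bool" where
  "Ck 0 u \<longleftrightarrow> continuous_on UNIV u"
| "Ck (Suc n) u \<longleftrightarrow>
     (\<forall>x. u differentiable (at x)) \<and> (\<forall>v. Ck n (\<lambda>x. frechet_derivative u (at x) v))"

definition test_functions :: "'a::euclidean_space set \<Rightarrow> ('a \<Rightarrow> real) set" where
  "test_functions D =
     {u. (\<forall>n. Ck n u) \<and> compact (closure {x. u x \<noteq> 0}) \<and> closure {x. u x \<noteq> 0} \<subseteq> D}"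

definition L2 :: "'a::euclidean_space set \<Rightarrow> ('a \<Rightarrow> 'b::euclidean_space) set" where
  "L2 D = {f \<in> borel_measurable (lebesgue_on D). integrable (lebesgue_on D) (\<lambda>x. (norm (f x))\<^sup>2)}"

definition is_weak_gradient ::
  "'a::euclidean_space set \<Rightarrow> ('a \<Rightarrow> real) \<Rightarrow> ('a \<Rightarrow> 'a) \<Rightarrow> bool" where
  "is_weak_gradient D f G \<longleftrightarrow>
     (\<forall>u \<in> test_functions D. \<forall>b \<in> Basis.
        (\<integral>x. f x * frechet_derivative u (at x) b \<partial>lebesgue_on D) =
        - (\<integral>x. (G x \<bullet> b) * u x \<partial>lebesgue_on D))"

definition H1 :: "'a::euclidean_space set \<Rightarrow> ('a \<Rightarrow> real) set" where
  "H1 D = {f \<in> L2 D. \<exists>G \<in> L2 D. is_weak_gradient D f G}"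

text \<open>The weak gradient of an \<open>H\<^sup>1\<close> function on an open set is unique up to a null set;
  \<open>weak_grad\<close> picks a representative.\<close>

definition weak_grad :: "'a::euclidean_space set \<Rightarrow> ('a \<Rightarrow> real) \<Rightarrow> 'a \<Rightarrow> 'a" where
  "weak_grad D f = (SOME G. G \<in> L2 D \<and> is_weak_gradient D f G)"


section \<open>Spherical coordinates\<close>

definition sph :: "real \<Rightarrow> real \<Rightarrow> real \<Rightarrow> real ^ 3" where
  "sph \<rho> \<phi> \<theta> = vector [\<rho> * sin \<phi> * cos \<theta>, \<rho> * sin \<phi> * sin \<theta>, \<rho> * cos \<phi>]"

definition rho :: "real ^ 3 \<Rightarrow> real" where
  "rho x = norm x"

definition phi :: "real ^ 3 \<Rightarrow> real" where
  "phi x = arccos (x $ 3 / norm x)"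

definition theta :: "real ^ 3 \<Rightarrow> real" where
  "theta x = Arg2pi (Complex (x $ 1) (x $ 2))"

lemma vector_3_axis:
  "(vector [a, b, c] :: real ^ 3) = a *\<^sub>R axis 1 1 + b *\<^sub>R axis 2 1 + c *\<^sub>R axis 3 1"
  by (simp add: vec_eq_iff forall_3 axis_def)

lemma sph_coords:
  assumes "x \<noteq> 0"
  shows "sph (rho x) (phi x) (theta x) = x"
proof -
  let ?z = "Complex (x $ 1) (x $ 2)"
  have n: "(norm x)\<^sup>2 = (x $ 1)\<^sup>2 + (x $ 2)\<^sup>2 + (x $ 3)\<^sup>2"
    by (simp add: norm_vec_def L2_set_def sum_3)
  have pos: "norm x > 0"
    using assms by simp
  have le: "\<bar>x $ 3 / norm x\<bar> \<le> 1"
    using component_le_norm_cart[of x 3] pos by (simp add: divide_simps)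
  have "norm x * sin (phi x) = norm x * sqrt (1 - (x $ 3 / norm x)\<^sup>2)"
    using le by (simp add: phi_def sin_arccos_abs)
  also have "\<dots> = sqrt ((norm x)\<^sup>2 * (1 - (x $ 3 / norm x)\<^sup>2))"
    by (simp add: real_sqrt_mult)
  also have "(norm x)\<^sup>2 * (1 - (x $ 3 / norm x)\<^sup>2) = (x $ 1)\<^sup>2 + (x $ 2)\<^sup>2"
    by (simp add: power_divide right_diff_distrib assms flip: n) (simp add: n)
  also have "sqrt \<dots> = cmod ?z"
    by (simp add: cmod_def)
  finally have s: "norm x * sin (phi x) = cmod ?z" .
  have c: "norm x * cos (phi x) = x $ 3"
    using le pos by (simp add: phi_def cos_arccos_abs)
  have z: "?z = cmod ?z * exp (\<i> * theta x)"
    unfolding theta_def by (rule Arg2pi_eq)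
  have "x $ 1 = cmod ?z * cos (theta x)"
    using arg_cong[OF z, of Re] by (simp add: Re_exp)
  moreover have "x $ 2 = cmod ?z * sin (theta x)"
    using arg_cong[OF z, of Im] by (simp add: Im_exp)
  ultimately show ?thesis
    using s c by (simp add: vec_eq_iff forall_3 sph_def rho_def)
qed

text \<open>The vectors \<open>\<partial>x/\<partial>\<rho>\<close> and \<open>\<partial>x/\<partial>\<phi>\<close> at the point \<open>x\<close>.\<close>

definition sph_rho :: "real ^ 3 \<Rightarrow> real ^ 3" where
  "sph_rho x = vector_derivative (\<lambda>\<rho>. sph \<rho> (phi x) (theta x)) (at (rho x))"

definition sph_phi :: "real ^ 3 \<Rightarrow> real ^ 3" where
  "sph_phi x = vector_derivative (\<lambda>\<phi>. sph (rho x) \<phi> (theta x)) (at (phi x))"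

lemma sph_rho_eq:
  "sph_rho x =
     vector [sin (phi x) * cos (theta x), sin (phi x) * sin (theta x), cos (phi x)]"
proof -
  have "((\<lambda>\<rho>. sph \<rho> (phi x) (theta x)) has_vector_derivative
          vector [sin (phi x) * cos (theta x), sin (phi x) * sin (theta x), cos (phi x)])
        (at (rho x))"
    unfolding sph_def vector_3_axis
    by (rule derivative_eq_intros refl | simp add: algebra_simps)+
  then show ?thesis
    unfolding sph_rho_def by (rule vector_derivative_at)
qed

lemma sph_phi_eq:
  "sph_phi x =
     rho x *\<^sub>R vector [cos (phi x) * cos (theta x), cos (phi x) * sin (theta x), - sin (phi x)]"
proof -
  have "((\<lambda>\<phi>. sph (rho x) \<phi> (theta x)) has_vector_derivative
          rho x *\<^sub>R vector [cos (phi x) * cos (theta x), cos (phi x) * sin (theta x), - sin (phi x)])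
        (at (phi x))"
    unfolding sph_def vector_3_axis
    by (rule derivative_eq_intros refl | simp add: algebra_simps)+
  then show ?thesis
    unfolding sph_phi_def by (rule vector_derivative_at)
qed

text \<open>For \<open>f \<in> H\<^sup>1\<close>, the partial derivatives in spherical coordinates come from the weak gradient
  by the chain rule: \<open>\<partial>\<^sub>\<rho> f = \<nabla>f \<bullet> \<partial>x/\<partial>\<rho>\<close> and \<open>\<partial>\<^sub>\<phi> f = \<nabla>f \<bullet> \<partial>x/\<partial>\<phi>\<close>.\<close>

definition d_rho :: "(real ^ 3) set \<Rightarrow> (real ^ 3 \<Rightarrow> real) \<Rightarrow> real ^ 3 \<Rightarrow> real" where
  "d_rho D f x = weak_grad D f x \<bullet> sph_rho x"

definition d_phi :: "(real ^ 3) set \<Rightarrow> (real ^ 3 \<Rightarrow> real) \<Rightarrow> real ^ 3 \<Rightarrow> real" where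
  "d_phi D f x = weak_grad D f x \<bullet> sph_phi x"

text \<open>Elements of \<open>H\<^sup>1\<close> are classes of functions modulo null sets, so independence of \<open>\<theta>\<close> is
  required almost everywhere only.\<close>

definition axially_symmetric_on :: "(real ^ 3) set \<Rightarrow> (real ^ 3 \<Rightarrow> real) \<Rightarrow> bool" where
  "axially_symmetric_on D f \<longleftrightarrow> (\<exists>g. AE x in lebesgue_on D. f x = g (rho x) (phi x))"

definition Dom :: "int \<Rightarrow> real \<Rightarrow> (real ^ 3) set" where
  "Dom m \<alpha> = {x. 1 / m < rho x \<and> rho x < 1 \<and> pi / 2 - \<alpha> < phi x \<and> phi x < pi / 2 + \<alpha>}"

end

theory Submission
  imports Defs
begin

text \<open>By axial symmetry everything happens on the rectangle of \<open>(\<rho>, c)\<close>, \<open>c = cos \<phi>\<close>, where the volume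
  element is \<open>\<rho>\<^sup>2 d\<rho> dc d\<theta>\<close> and \<open>\<partial>\<^sub>\<phi>f = - sin \<phi> \<partial>\<^sub>cf\<close>. Split \<open>f\<close> into its weighted mean \<open>F(\<rho>)\<close> over \<open>c\<close> and
  the remainder. The remainder is controlled by a weighted Poincare inequality in \<open>c\<close>: by duality its
  constant is that of a Dirichlet problem, for which the explicit supersolution
  \<open>sin\<^sup>l\<^sup>/\<^sup>2 \<phi> cos 3(\<phi> - \<pi>/2)\<close>, \<open>l = k + 1\<close>, gives the eigenvalue bound \<open>9 + l/2 = (19 + k)/2\<close>. The mean satisfies a
  Hardy inequality; the constraint \<open>\<integral>F \<rho>\<^sup>i\<^sup>+\<^sup>2 d\<rho> = 0\<close> turns the boundary term at \<open>\<rho> = 1\<close>, which has the wrong sign, into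
  an integral bounded by Cauchy-Schwarz.

  Testing the weak gradient with the fields \<open>\<eta>(\<rho>) h(c) V\<close>, with \<open>V\<close> divergence-free and radial or polar,
  gives the weak derivatives of \<open>f\<close> in \<open>\<rho>\<close> and \<open>c\<close>; by the du Bois-Reymond lemma \<open>f\<close> is then
  absolutely continuous along almost every coordinate line.\<close>

section \<open>Functions of class \<open>C\<^sup>n\<close> on open sets\<close>

text \<open>The symmetry is assumed of \<open>f\<close> alone and up to a null set, while
  \<open>weak_grad\<close> is an arbitrary representative of which no symmetry is known. Every test
  field used below is symmetric about the axis, so it sees only the \<theta>-averages of the
  derivatives. Since \<open>f\<close> equals its own average, the left-hand side is unchanged, and
  by Jensen averaging can only lower the right-hand side; symmetry of the gradient itself is never
  shown. Origin of 9 + l/2: put x = arcsin c. The Poincare constant belongs to a Neumann quotient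
  with weight cos^l x, whose dual is a Dirichlet quotient with the reciprocal weight. Writing U =
  cos^(l/2) x v turns the Dirichlet operator into -v'' + (l/2 + (l/2 + l^2/4) tan^2 x) v. On |x| <
  pi/6, the widest angle allowed, cos 3x is the ground state of -v'' with eigenvalue 9, and the
  potential adds at least l/2. Hence an explicit supersolution does the work of the unknown weighted
  eigenfunction.\<close>

primrec Ck_on :: "nat \<Rightarrow> 'a::euclidean_space set \<Rightarrow> ('a \<Rightarrow> real) \<Rightarrow> bool" where
  "Ck_on 0 S u \<longleftrightarrow> continuous_on S u"
| "Ck_on (Suc n) S u \<longleftrightarrow>
     (\<forall>x\<in>S. u differentiable (at x)) \<and> (\<forall>v. Ck_on n S (\<lambda>x. frechet_derivative u (at x) v))"

lemma Ck_on_UNIV: "Ck_on n UNIV u \<longleftrightarrow> Ck n u"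
  by (induction n arbitrary: u) simp_all

lemma Ck_on_cong:
  assumes "open S" "\<And>x. x \<in> S \<Longrightarrow> u x = v x"
  shows "Ck_on n S u \<longleftrightarrow> Ck_on n S v"
  using assms(2)
proof (induction n arbitrary: u v)
  case 0
  then show ?case by (simp cong: continuous_on_cong)
next
  case (Suc n)
  have has: "(u has_derivative D) (at x) \<longleftrightarrow> (v has_derivative D) (at x)" if "x \<in> S" for x D
    using has_derivative_transform_within_open[OF _ assms(1) that, of u D UNIV v]
      has_derivative_transform_within_open[OF _ assms(1) that, of v D UNIV u] Suc.prems by metis
  then have "frechet_derivative u (at x) = frechet_derivative v (at x)" if "x \<in> S" for x
    using that by (simp add: frechet_derivative_def)
  then have "Ck_on n S (\<lambda>x. frechet_derivative u (at x) w)
      \<longleftrightarrow> Ck_on n S (\<lambda>x. frechet_derivative v (at x) w)" for w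
    by (intro Suc.IH) simp
  with has show ?case by (simp add: differentiable_def)
qed

text \<open>Openness makes the derivative unique at points of S, so an explicit formula D can stand
  in for \<open>frechet_derivative\<close> there; elsewhere D may be anything.\<close>

lemma Ck_on_SucI:
  assumes "open S" "\<And>x. x \<in> S \<Longrightarrow> (u has_derivative D x) (at x)"
    and "\<And>v. Ck_on n S (\<lambda>x. D x v)"
  shows "Ck_on (Suc n) S u"
proof -
  have "Ck_on n S (\<lambda>x. frechet_derivative u (at x) v)" for v
    using assms(3)[of v] Ck_on_cong[OF assms(1), of "\<lambda>x. frechet_derivative u (at x) v" "\<lambda>x. D x v" n]
      frechet_derivative_at[OF assms(2)] by simp
  then show ?thesis using assms(2) by (auto simp: differentiable_def)
qed

lemma Ck_on_SucD: "Ck_on (Suc n) S u \<Longrightarrow> Ck_on n S u"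
proof (induction n arbitrary: u)
  case 0
  then show ?case
    by (auto simp: differentiable_imp_continuous_within continuous_at_imp_continuous_on)
next
  case (Suc n)
  show ?case
    unfolding Ck_on.simps(2)[of n]
    using Suc.IH Suc.prems unfolding Ck_on.simps(2)[of "Suc n"] by blast
qed

lemma Ck_on_subset: "Ck_on n S u \<Longrightarrow> T \<subseteq> S \<Longrightarrow> Ck_on n T u"
  by (induction n arbitrary: u) (auto intro: continuous_on_subset)

lemma Ck_on_Un:
  assumes "open S" "open T" "Ck_on n S u" "Ck_on n T u"
  shows "Ck_on n (S \<union> T) u"
  using assms(3,4)
  by (induction n arbitrary: u) (auto intro: continuous_on_open_Un[OF assms(1,2)])

lemma Ck_on_const: "Ck_on n S (\<lambda>x. c)"
  by (induction n arbitrary: c) simp_all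

lemma Ck_on_linear: "bounded_linear u \<Longrightarrow> open S \<Longrightarrow> Ck_on n S u"
  by (cases n)
     (auto simp: linear_continuous_on
       intro: Ck_on_SucI[where D="\<lambda>_. u"] bounded_linear_imp_has_derivative Ck_on_const
       simp del: Ck_on.simps(2))

lemma Ck_on_add:
  assumes "open S" "Ck_on n S u" "Ck_on n S v"
  shows "Ck_on n S (\<lambda>x. u x + v x)"
  using assms(2,3)
proof (induction n arbitrary: u v)
  case 0
  then show ?case by (simp add: continuous_on_add)
next
  case (Suc n)
  show ?case
    by (rule Ck_on_SucI[OF assms(1), where
          D="\<lambda>x w. frechet_derivative u (at x) w + frechet_derivative v (at x) w"])
       (use Suc in \<open>auto intro!: has_derivative_add simp: frechet_derivative_works\<close>)
qed

lemma Ck_on_mult: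
  assumes "open S" "Ck_on n S u" "Ck_on n S v"
  shows "Ck_on n S (\<lambda>x. u x * v x)"
  using assms(2,3)
proof (induction n arbitrary: u v)
  case 0
  then show ?case by (simp add: continuous_on_mult)
next
  case (Suc n)
  show ?case
  proof (rule Ck_on_SucI[OF assms(1), where
        D="\<lambda>x w. u x * frechet_derivative v (at x) w + frechet_derivative u (at x) w * v x"])
    show "((\<lambda>x. u x * v x) has_derivative
       (\<lambda>w. u x * frechet_derivative v (at x) w + frechet_derivative u (at x) w * v x)) (at x)"
      if "x \<in> S" for x
      using Suc.prems that by (auto intro!: has_derivative_mult simp: frechet_derivative_works)
    show "Ck_on n S (\<lambda>x. u x * frechet_derivative v (at x) w + frechet_derivative u (at x) w * v x)"
      for w
      using Suc.prems Suc.IH Ck_on_SucD[of n S u] Ck_on_SucD[of n S v]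
      by (intro Ck_on_add[OF assms(1)]) auto
  qed
qed

text \<open>The outer function is real, so its derivative is multiplication by the number
  \<open>frechet_derivative g (at (u x)) 1\<close>. This number is again a composition with the same
  u, which is why the induction varies g only.\<close>

lemma Ck_on_compose:
  fixes g :: "real \<Rightarrow> real"
  assumes "open S" "Ck_on n T g" "Ck_on n S u" "u ` S \<subseteq> T"
  shows "Ck_on n S (\<lambda>x. g (u x))"
  using assms(2,3)
proof (induction n arbitrary: g)
  case 0
  then show ?case
    using continuous_on_compose2[of T g S u] assms(4) by simp
next
  case (Suc n)
  show ?case
  proof (rule Ck_on_SucI[OF assms(1), where
        D="\<lambda>x w. frechet_derivative g (at (u x)) 1 * frechet_derivative u (at x) w"])
    fix x assume x: "x \<in> S"
    have "(u has_derivative frechet_derivative u (at x)) (at x)"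
      using Suc.prems x by (simp add: frechet_derivative_works)
    moreover have g: "(g has_derivative frechet_derivative g (at (u x))) (at (u x))"
      using Suc.prems x assms(4) by (auto simp flip: frechet_derivative_works)
    ultimately have "((\<lambda>x. g (u x)) has_derivative
        (\<lambda>w. frechet_derivative g (at (u x)) (frechet_derivative u (at x) w))) (at x)"
      by (rule has_derivative_compose)
    moreover define d where "d = frechet_derivative g (at (u x)) 1"
    have "frechet_derivative g (at (u x)) r = d * r" for r
      using linear_cmul[OF has_derivative_linear[OF g], of r 1] by (simp add: d_def)
    ultimately show "((\<lambda>x. g (u x)) has_derivative
        (\<lambda>w. frechet_derivative g (at (u x)) 1 * frechet_derivative u (at x) w)) (at x)"
      by (simp flip: d_def)
  next
    fix w
    have "Ck_on n S (\<lambda>x. frechet_derivative g (at (u x)) 1)"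
      using Suc.prems(1) Ck_on_SucD[OF Suc.prems(2)] by (auto intro!: Suc.IH)
    then show "Ck_on n S (\<lambda>x. frechet_derivative g (at (u x)) 1 * frechet_derivative u (at x) w)"
      using Suc.prems by (intro Ck_on_mult[OF assms(1)]) auto
  qed
qed

lemma Ck_on_real_SucI:
  fixes u :: "real \<Rightarrow> real"
  assumes "open S" "\<And>x. x \<in> S \<Longrightarrow> (u has_real_derivative d x) (at x)" "Ck_on n S d"
  shows "Ck_on (Suc n) S u"
  using assms
  by (intro Ck_on_SucI[where D="\<lambda>x w. d x * w"] Ck_on_mult Ck_on_const)
     (auto simp: has_field_derivative_def)

text \<open>The functions c * t powr r form a family closed under differentiation; the constant c is
  carried so that the induction closes.\<close>

lemma Ck_on_powr: "Ck_on n {0<..} (\<lambda>t::real. c * t powr r)"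
proof (induction n arbitrary: c r)
  case 0
  then show ?case by (auto intro!: continuous_intros)
next
  case (Suc n)
  show ?case
    by (rule Ck_on_real_SucI[where d="\<lambda>t. (c * r) * t powr (r - 1)"])
       (auto intro!: derivative_eq_intros Suc)
qed

lemma Ck_on_inner_self: "open S \<Longrightarrow> Ck_on n S (\<lambda>x. x \<bullet> x)"
proof (cases n)
  case (Suc n')
  assume "open S"
  then show ?thesis unfolding Suc
    by (intro Ck_on_SucI[where D="\<lambda>x v. x \<bullet> (2 *\<^sub>R v)"] Ck_on_linear bounded_linear_inner_left)
       (auto intro!: derivative_eq_intros simp: inner_commute)
qed (auto intro!: continuous_intros)

text \<open>The norm is treated as a real power of the polynomial x \<bullet> x, which is positive
  off the origin; negative powers need no separate argument.\<close>

lemma Ck_on_norm_powr: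
  assumes "open S" "0 \<notin> S"
  shows "Ck_on n S (\<lambda>x. norm x powr r)"
proof -
  have "Ck_on n S (\<lambda>x. 1 * (x \<bullet> x) powr (r / 2))"
    by (rule Ck_on_compose[OF assms(1) Ck_on_powr Ck_on_inner_self[OF assms(1)]])
       (use assms in fastforce)
  then show ?thesis
  proof (rule iffD1[OF Ck_on_cong[OF assms(1)], rotated])
    fix x assume "x \<in> S"
    then have "norm x > 0" using assms by auto
    then have e: "x \<bullet> x = norm x powr 2"
      by (simp only: dot_square_norm powr_numeral)
    show "1 * (x \<bullet> x) powr (r / 2) = norm x powr r" by (simp only: e mult_1 powr_powr) simp
  qed
qed

text \<open>\<open>test_functions\<close> asks for smoothness on the whole space, but the test
  fields contain quotients that are smooth only near the domain. The sets S and -K form an open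
  cover, and the function is smooth on S and zero on -K.\<close>

lemma Ck_zero_outside:
  assumes "open S" "closed K" "K \<subseteq> S" "Ck_on n S u" "\<And>x. x \<notin> K \<Longrightarrow> u x = 0"
  shows "Ck n u"
proof -
  have "Ck_on n (- K) u"
    using Ck_on_cong[of "- K" u "\<lambda>_. 0" n] assms(2,5) by (simp add: Ck_on_const open_Compl)
  then have "Ck_on n (S \<union> - K) u"
    using assms(1,2,4) by (intro Ck_on_Un) auto
  moreover have "S \<union> - K = UNIV" using assms(3) by blast
  ultimately show ?thesis by (simp only: Ck_on_UNIV)
qed

section \<open>Smooth bump functions\<close>

definition flat :: "real poly \<Rightarrow> real \<Rightarrow> real" where
  "flat p t = (if t > 0 then poly p (1 / t) * exp (- (1 / t)) else 0)"

lemma poly_times_exp_tendsto_0: "((\<lambda>y::real. poly p y * exp (- y)) \<longlongrightarrow> 0) at_top"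
proof -
  have "((\<lambda>y. \<Sum>i\<le>degree p. coeff p i * (y ^ i / exp y)) \<longlongrightarrow> (\<Sum>i\<le>degree p. coeff p i * 0)) at_top"
    by (intro tendsto_intros tendsto_power_div_exp_0)
  then show ?thesis
    by (simp add: poly_altdef sum_distrib_right exp_minus divide_inverse mult.assoc)
qed

text \<open>Products p(1/t) exp(-1/t) are closed under differentiation: with y = 1/t the new
  polynomial is y^2 (p - p'), and y^2 is \<open>[:0, 0, 1:]\<close>. Smoothness of every order then
  follows by induction over all p at once.\<close>

lemma flat_has_derivative:
  "(flat p has_real_derivative flat ([:0, 0, 1:] * (p - pderiv p)) t) (at t)"
proof -
  consider "t > 0" | "t < 0" | "t = 0" by linarith
  then show ?thesis
  proof cases
    case 1
    have "((\<lambda>t. poly p (1 / t) * exp (- (1 / t))) has_real_derivative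
        flat ([:0, 0, 1:] * (p - pderiv p)) t) (at t)"
      using 1 by (auto intro!: derivative_eq_intros simp: flat_def field_simps power2_eq_square)
    then show ?thesis
      by (rule has_field_derivative_transform_within_open[where S="{0<..}"])
         (use 1 in \<open>auto simp: flat_def\<close>)
  next
    case 2
    have "((\<lambda>t. 0) has_real_derivative 0) (at t)" by simp
    then have "(flat p has_real_derivative 0) (at t)"
      by (rule has_field_derivative_transform_within_open[where S="{..<0}"])
         (use 2 in \<open>auto simp: flat_def\<close>)
    then show ?thesis using 2 by (simp add: flat_def)
  next
    case 3
    \<comment> \<open>The difference quotient at 0 from the right is of the same shape, with y p(y)
      in place of p(y).\<close>
    have "((\<lambda>t. poly ([:0, 1:] * p) (inverse t) * exp (- (inverse t))) \<longlongrightarrow> 0) (at_right 0)"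
      by (rule filterlim_compose[OF poly_times_exp_tendsto_0 filterlim_inverse_at_top_right])
    then have "((\<lambda>h. flat p h / h) \<longlongrightarrow> 0) (at_right 0)"
      by (rule Lim_transform_eventually)
         (auto simp: eventually_at_right_field flat_def divide_inverse ac_simps intro!: exI[of _ 1])
    moreover have "((\<lambda>h. flat p h / h) \<longlongrightarrow> 0) (at_left 0)"
      by (rule Lim_transform_eventually[OF tendsto_const])
         (auto simp: eventually_at_left_field flat_def intro!: exI[of _ "-1"])
    ultimately have "((\<lambda>h. flat p h / h) \<longlongrightarrow> 0) (at 0)"
      by (simp add: filterlim_split_at)
    then show ?thesis using 3 by (simp add: has_field_derivative_iff flat_def)
  qed
qed

lemma Ck_flat: "Ck n (flat p)"
  unfolding Ck_on_UNIV[symmetric]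
proof (induction n arbitrary: p)
  case 0
  then show ?case
    using flat_has_derivative[THEN DERIV_isCont] by (simp add: continuous_on_eq_continuous_at)
next
  case (Suc n)
  then show ?case
    by (intro Ck_on_real_SucI[OF open_UNIV flat_has_derivative]) 
qed

text \<open>The shift by 1 keeps the support in the compact interval from a + 1/n to b - 1/n. The
  factor n drives both arguments to infinity inside (a, b), where \<open>flat 1\<close> tends to 1,
  so the bumps converge to the indicator of (a, b).\<close>

definition bump :: "real \<Rightarrow> real \<Rightarrow> nat \<Rightarrow> real \<Rightarrow> real" where
  "bump a b n t = flat 1 (real n * (t - a) - 1) * flat 1 (real n * (b - t) - 1)"

lemma flat_1_bounds: "0 \<le> flat 1 t" "flat 1 t \<le> 1"
  by (auto simp: flat_def)

lemma bump_bounds: "0 \<le> bump a b n t" "bump a b n t \<le> 1"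
  by (auto simp: bump_def flat_1_bounds mult_le_one)

lemma bump_eq_0:
  assumes "t \<notin> {a + 1 / real n..b - 1 / real n}"
  shows "bump a b n t = 0"
\<comment> \<open>For n = 0 the interval reads {a..b}, since 1/0 = 0, but then both factors are
  \<open>flat 1 (-1)\<close>, which is 0.\<close>
proof (cases "n = 0")
  case False
  then show ?thesis using assms by (auto simp: bump_def flat_def field_simps)
qed (simp add: bump_def flat_def)

lemma Ck_bump: "Ck k (bump a b n)"
proof -
  have l: "Ck_on k UNIV (\<lambda>t::real. c * t + d)" for c d
    by (intro Ck_on_add Ck_on_mult Ck_on_const Ck_on_linear bounded_linear_ident) auto
  have "Ck_on k UNIV (\<lambda>t. flat 1 (c * t + d))" for c d
    by (rule Ck_on_compose[OF _ _ l, where T=UNIV]) (auto simp: Ck_on_UNIV Ck_flat)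
  from Ck_on_mult[OF open_UNIV this[of "real n" "- real n * a - 1"] this[of "- real n" "real n * b - 1"]]
  have "Ck_on k UNIV (bump a b n)"
    unfolding bump_def by (simp add: algebra_simps)
  then show ?thesis by (simp add: Ck_on_UNIV)
qed

lemma test_functionsI:
  assumes "compact K" "K \<subseteq> D" "\<And>n. Ck n u" "\<And>x. x \<notin> K \<Longrightarrow> u x = 0"
  shows "u \<in> test_functions D"
proof -
  have "{x. u x \<noteq> 0} \<subseteq> K"
    using assms(4) by blast
  then have c: "closure {x. u x \<noteq> 0} \<subseteq> K"
    by (rule closure_minimal[OF _ compact_imp_closed[OF assms(1)]])
  then have "compact (closure {x. u x \<noteq> 0})"
    using compact_Int_closed[OF assms(1) closed_closure, of "{x. u x \<noteq> 0}"]
    by (simp add: Int_absorb1)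
  with c show ?thesis
    unfolding test_functions_def using assms(2,3) by blast
qed

lemma bump_tendsto: "(\<lambda>n. bump a b n t) \<longlonglongrightarrow> indicator {a<..<b} t"
proof (cases "a < t \<and> t < b")
  case True
  have "(\<lambda>n. flat 1 (real n * d - 1)) \<longlonglongrightarrow> 1" if "d > 0" for d :: real
  proof -
    have "(\<lambda>n. exp (- (1 / (real n * d - 1)))) \<longlonglongrightarrow> 1"
      using that by real_asymp
    moreover have "\<forall>\<^sub>F n in sequentially. real n * d - 1 > 0"
      using that by real_asymp
    ultimately show ?thesis
      by (rule Lim_transform_eventually[OF _ eventually_mono]) (auto simp: flat_def)
  qed
  then have "(\<lambda>n. bump a b n t) \<longlonglongrightarrow> 1 * 1"
    unfolding bump_def using True by (intro tendsto_mult) auto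
  then show ?thesis using True by simp
next
  case False
  have "bump a b n t = 0" for n
  proof (cases "n = 0")
    case n: False
    then have "1 / real n > 0" by simp
    then show ?thesis
      using False by (intro bump_eq_0) (unfold atLeastAtMost_iff, linarith)
  qed (simp add: bump_def flat_def)
  then show ?thesis using False by (auto simp: indicator_def)
qed

section \<open>Absolutely continuous functions on an interval\<close>

lemma integrable_bounded_mult:
  fixes f g :: "'a \<Rightarrow> real"
  assumes "integrable M f" "g \<in> borel_measurable M" "\<And>x. x \<in> space M \<Longrightarrow> \<bar>g x\<bar> \<le> C"
  shows "integrable M (\<lambda>x. f x * g x)"
proof (rule Bochner_Integration.integrable_bound)
  show "integrable M (\<lambda>x. C * f x)" using assms by simp
  show "AE x in M. norm (f x * g x) \<le> norm (C * f x)"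
  proof (rule AE_I2)
    fix x assume "x \<in> space M"
    then have "\<bar>g x\<bar> \<le> \<bar>C\<bar>" using assms(3)[of x] by linarith
    then show "norm (f x * g x) \<le> norm (C * f x)"
      using mult_right_mono[of "\<bar>g x\<bar>" "\<bar>C\<bar>" "\<bar>f x\<bar>"] by (simp add: abs_mult mult.commute)
  qed
qed (use assms in measurable)

lemma integrable_mult_squares:
  fixes f g :: "'a \<Rightarrow> real"
  assumes "f \<in> borel_measurable M" "g \<in> borel_measurable M"
    and "integrable M (\<lambda>x. (f x)\<^sup>2)" "integrable M (\<lambda>x. (g x)\<^sup>2)"
  shows "integrable M (\<lambda>x. f x * g x)"
proof (rule Bochner_Integration.integrable_bound)
  show "integrable M (\<lambda>x. (f x)\<^sup>2 + (g x)\<^sup>2)" using assms by simp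
  have "\<bar>a * b\<bar> \<le> \<bar>a\<^sup>2 + b\<^sup>2\<bar>" for a b :: real
  proof -
    have "2 * (\<bar>a\<bar> * \<bar>b\<bar>) \<le> a\<^sup>2 + b\<^sup>2"
      using sum_squares_bound[of "\<bar>a\<bar>" "\<bar>b\<bar>"] by simp
    moreover have "0 \<le> \<bar>a\<bar> * \<bar>b\<bar>" by simp
    ultimately show ?thesis unfolding abs_mult by linarith
  qed
  then show "AE x in M. norm (f x * g x) \<le> norm ((f x)\<^sup>2 + (g x)\<^sup>2)" by simp
qed (use assms in measurable)

lemma (in finite_measure) integrable_of_square:
  fixes f :: "'a \<Rightarrow> real"
  assumes "f \<in> borel_measurable M" "integrable M (\<lambda>x. (f x)\<^sup>2)"
  shows "integrable M f"
  using integrable_mult_squares[OF assms(1) _ assms(2), of "\<lambda>_. 1"] by simp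

text \<open>Built on \<open>lborel\<close> rather than on the completed measure, so that pair
  measures, joint measurability and Fubini stay within Borel sets. With an open interval, endpoint
  values never enter an integral.\<close>

definition lebI :: "real \<Rightarrow> real \<Rightarrow> real measure" where
  "lebI a b = restrict_space lborel {a<..<b}"

lemma space_lebI [simp]: "space (lebI a b) = {a<..<b}"
  by (simp add: lebI_def space_restrict_space)

lemma sets_lebI: "sets (lebI a b) = sets (restrict_space borel {a<..<b})"
  by (simp add: lebI_def sets_restrict_space)

lemma finite_measure_lebI [simp, intro]: "finite_measure (lebI a b)"
proof (rule finite_measureI)
  have "emeasure lborel {a<..<b} \<noteq> \<infinity>"
    by (cases "a \<le> b") auto
  then show "emeasure (lebI a b) (space (lebI a b)) \<noteq> \<infinity>"
    by (simp add: emeasure_restrict_space lebI_def space_restrict_space)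
qed

interpretation lebI: finite_measure "lebI a b" for a b
  by simp

interpretation lebI_pair: pair_sigma_finite "lebI a b" "lebI c d" for a b c d
  by (simp add: pair_sigma_finite_def lebI.sigma_finite_measure_axioms)

lemma measurable_lebI: "f \<in> borel_measurable borel \<Longrightarrow> f \<in> borel_measurable (lebI a b)"
  unfolding lebI_def by (intro measurable_restrict_space1) simp

lemma measurable_lebI_ident [measurable]: "(\<lambda>x. x) \<in> borel_measurable (lebI a b)"
  by (rule measurable_lebI) simp

lemma measurable_lebI_fst [measurable]: "fst \<in> borel_measurable (lebI a b \<Otimes>\<^sub>M N)"
  using measurable_compose[OF measurable_fst measurable_lebI_ident] by simp

lemma measurable_lebI_snd [measurable]: "snd \<in> borel_measurable (N \<Otimes>\<^sub>M lebI a b)"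
  using measurable_compose[OF measurable_snd measurable_lebI_ident] by simp

lemma continuous_measurable_lebI:
  "continuous_on {a..b} f \<Longrightarrow> f \<in> borel_measurable (lebI a b)"
  using borel_measurable_continuous_on_restrict[OF continuous_on_subset, of "{a..b}" f "{a<..<b}"]
  by (simp cong: measurable_cong_sets[OF sets_lebI refl] add: greaterThanLessThan_subseteq_atLeastAtMost_iff)

lemma continuous_bounded_Icc:
  fixes f :: "real \<Rightarrow> real"
  assumes "continuous_on {a..b} f"
  obtains C where "\<forall>x\<in>{a..b}. \<bar>f x\<bar> \<le> C"
  using compact_imp_bounded[OF compact_continuous_image[OF assms compact_Icc]]
  unfolding bounded_iff by (metis image_eqI real_norm_def)

lemma continuous_integrable_lebI:
  fixes f :: "real \<Rightarrow> real"
  assumes "continuous_on {a..b} f"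
  shows "integrable (lebI a b) f"
proof -
  obtain C where "\<forall>x\<in>{a..b}. \<bar>f x\<bar> \<le> C"
    using continuous_bounded_Icc[OF assms] .
  then show ?thesis
    using continuous_measurable_lebI[OF assms]
    by (intro lebI.integrable_const_bound[where B=C]) auto
qed

lemma integrable_mult_continuous:
  fixes f g :: "real \<Rightarrow> real"
  assumes "integrable (lebI a b) f" "continuous_on {a..b} g"
  shows "integrable (lebI a b) (\<lambda>x. f x * g x)"
proof -
  obtain C where "\<forall>x\<in>{a..b}. \<bar>g x\<bar> \<le> C"
    using continuous_bounded_Icc[OF assms(2)] .
  then show ?thesis
    using continuous_measurable_lebI[OF assms(2)]
    by (intro integrable_bounded_mult[where C=C] assms) auto
qed

lemma AE_lebI_neq: "AE x in lebI a b. x \<noteq> c"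
proof -
  have "AE x in lborel. x \<noteq> c"
    by (rule AE_I[where N="{c}"]) auto
  then show ?thesis unfolding lebI_def by (subst AE_restrict_space_iff) auto
qed

text \<open>The cut sits in the integrand while the measure stays fixed. This makes measurability in
  x, and jointly in further parameters, automatic, and lets Fubini be applied to primitives.\<close>

definition prim :: "real \<Rightarrow> real \<Rightarrow> (real \<Rightarrow> real) \<Rightarrow> real \<Rightarrow> real" where
  "prim a b V x = (\<integral>s. (if s < x then V s else 0) \<partial>lebI a b)"

lemma prim_measurable [measurable]:
  assumes [measurable]: "V \<in> borel_measurable (lebI a b)"
  shows "prim a b V \<in> borel_measurable borel"
proof -
  have "(\<lambda>x. \<integral>s. (if s < x then V s else 0) \<partial>lebI a b) \<in> borel_measurable borel"
    by measurable
  then show ?thesis by (simp add: prim_def[abs_def])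
qed

lemma integrable_cut:
  fixes V :: "real \<Rightarrow> real"
  assumes "integrable (lebI a b) V"
  shows "integrable (lebI a b) (\<lambda>s. if s < x then V s else 0)"
  by (rule Bochner_Integration.integrable_bound[OF assms])
     (use assms in \<open>auto\<close>)

lemma prim_bound:
  assumes "integrable (lebI a b) V"
  shows "\<bar>prim a b V x\<bar> \<le> (\<integral>s. \<bar>V s\<bar> \<partial>lebI a b)"
proof -
  have "\<bar>prim a b V x\<bar> \<le> (\<integral>s. \<bar>if s < x then V s else 0\<bar> \<partial>lebI a b)"
    unfolding prim_def by (rule integral_abs_bound)
  also have "\<dots> \<le> (\<integral>s. \<bar>V s\<bar> \<partial>lebI a b)"
    using assms by (intro integral_mono integrable_abs integrable_cut) auto
  finally show ?thesis .
qed

lemma prim_left: "prim a b V a = 0"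
proof -
  have "prim a b V a = (\<integral>s. 0 \<partial>lebI a b)"
    unfolding prim_def by (rule Bochner_Integration.integral_cong) auto
  then show ?thesis by simp
qed

lemma prim_right: "b \<le> x \<Longrightarrow> prim a b V x = (\<integral>s. V s \<partial>lebI a b)"
  unfolding prim_def by (rule Bochner_Integration.integral_cong) auto

lemma prim_cut:
  "t \<le> x \<Longrightarrow> prim a b (\<lambda>s. if s < x then V s else 0) t = prim a b V t"
  unfolding prim_def by (rule Bochner_Integration.integral_cong) auto

lemma integrable_lebI_prod:
  fixes V Z :: "real \<Rightarrow> real"
  assumes V: "integrable (lebI a b) V" and Z: "integrable (lebI c d) Z"
  shows "integrable (lebI a b \<Otimes>\<^sub>M lebI c d) (\<lambda>(s, t). V s * Z t)"
proof -
  have [measurable]: "V \<in> borel_measurable (lebI a b)" "Z \<in> borel_measurable (lebI c d)"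
    using V Z by auto
  show ?thesis
    by (rule lebI_pair.Fubini_integrable) (use V Z in \<open>auto simp: abs_mult\<close>)
qed

text \<open>Integration by parts without pointwise derivatives: the two terms are the integrals of
  V(s) Z(t) over the triangles s < t and t < s, which fill the square up to the null
  diagonal.\<close>

lemma integral_prim_mult:
  assumes V: "integrable (lebI a b) V" and Z: "integrable (lebI a b) Z"
  shows "(\<integral>t. prim a b V t * Z t \<partial>lebI a b) + (\<integral>t. V t * prim a b Z t \<partial>lebI a b)
    = (\<integral>t. V t \<partial>lebI a b) * (\<integral>t. Z t \<partial>lebI a b)"
proof -
  let ?M = "lebI a b"
  have [measurable]: "V \<in> borel_measurable ?M" "Z \<in> borel_measurable ?M" using V Z by auto
  have int: "integrable (?M \<Otimes>\<^sub>M ?M) (\<lambda>(s, t). V s * Z t)"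
    by (rule integrable_lebI_prod[OF V Z])
  have int1: "integrable (?M \<Otimes>\<^sub>M ?M) (\<lambda>(s, t). if s < t then V s * Z t else 0)"
    by (rule Bochner_Integration.integrable_bound[OF int]) auto
  have int2: "integrable (?M \<Otimes>\<^sub>M ?M) (\<lambda>(s, t). if t < s then V s * Z t else 0)"
    by (rule Bochner_Integration.integrable_bound[OF int]) auto
  have i1: "integrable ?M (\<lambda>s. \<integral>t. (if s < t then V s * Z t else 0) \<partial>?M)"
    using lebI_pair.integrable_fst'[OF int1] by simp
  have i2: "integrable ?M (\<lambda>s. \<integral>t. (if t < s then V s * Z t else 0) \<partial>?M)"
    using lebI_pair.integrable_fst'[OF int2] by simp
  have "(\<integral>t. prim a b V t * Z t \<partial>?M) = (\<integral>t. (\<integral>s. (if s < t then V s * Z t else 0) \<partial>?M) \<partial>?M)"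
    unfolding prim_def
    by (simp add: if_distrib[where f="\<lambda>u. u * _"] flip: integral_mult_left_zero cong: if_cong)
  also have "\<dots> = (\<integral>s. (\<integral>t. (if s < t then V s * Z t else 0) \<partial>?M) \<partial>?M)"
    by (rule lebI_pair.Fubini_integral) (rule int1)
  finally have 1: "(\<integral>t. prim a b V t * Z t \<partial>?M)
      = (\<integral>s. (\<integral>t. (if s < t then V s * Z t else 0) \<partial>?M) \<partial>?M)" .
  have 2: "(\<integral>s. V s * prim a b Z s \<partial>?M) = (\<integral>s. (\<integral>t. (if t < s then V s * Z t else 0) \<partial>?M) \<partial>?M)"
    unfolding prim_def
    by (simp add: if_distrib[where f="\<lambda>u. _ * u"] flip: integral_mult_right_zero cong: if_cong)
  have "(\<integral>t. (if s < t then V s * Z t else 0) \<partial>?M) + (\<integral>t. (if t < s then V s * Z t else 0) \<partial>?M)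
      = V s * (\<integral>t. Z t \<partial>?M)" if "s \<in> space ?M" for s
  proof -
    have c: "integrable ?M (\<lambda>t. if s < t then V s * Z t else 0)"
      "integrable ?M (\<lambda>t. if t < s then V s * Z t else 0)"
      by (rule Bochner_Integration.integrable_bound[OF integrable_mult_right[OF Z, of "V s"]]; auto)+
    have "(\<integral>t. (if s < t then V s * Z t else 0) \<partial>?M) + (\<integral>t. (if t < s then V s * Z t else 0) \<partial>?M)
        = (\<integral>t. (if s < t then V s * Z t else 0) + (if t < s then V s * Z t else 0) \<partial>?M)"
      using c by simp
    also have "\<dots> = (\<integral>t. V s * Z t \<partial>?M)"
      by (rule integral_cong_AE) (use AE_lebI_neq[of s a b] in auto)
    finally show ?thesis by simp
  qed
  then have "(\<integral>s. (\<integral>t. (if s < t then V s * Z t else 0) \<partial>?M)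
      + (\<integral>t. (if t < s then V s * Z t else 0) \<partial>?M) \<partial>?M) = (\<integral>s. V s * (\<integral>t. Z t \<partial>?M) \<partial>?M)"
    by (intro Bochner_Integration.integral_cong) auto
  then show ?thesis
    unfolding 1 2 using i1 i2 by simp
qed

text \<open>Absolute continuity of U on the closed interval with derivative V, encoded by the
  fundamental theorem of calculus. V is an argument because it is determined only almost
  everywhere.\<close>

definition AC :: "real \<Rightarrow> real \<Rightarrow> (real \<Rightarrow> real) \<Rightarrow> (real \<Rightarrow> real) \<Rightarrow> bool" where
  "AC a b U V \<longleftrightarrow> integrable (lebI a b) V \<and> (\<forall>x\<in>{a..b}. U x = U a + prim a b V x)"

lemma AC_D:
  assumes "AC a b U V"
  shows "integrable (lebI a b) V" "x \<in> {a..b} \<Longrightarrow> U x = U a + prim a b V x"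
  using assms unfolding AC_def by blast+

lemma AC_prim: "integrable (lebI a b) V \<Longrightarrow> AC a b (\<lambda>x. c + prim a b V x) V"
  by (simp add: AC_def prim_left)

lemma AC_integral: "AC a b U V \<Longrightarrow> a \<le> b \<Longrightarrow> (\<integral>x. V x \<partial>lebI a b) = U b - U a"
  using AC_D(2)[of a b U V b] by (simp add: prim_right)

lemma AC_measurable:
  assumes "AC a b U V"
  shows "U \<in> borel_measurable (lebI a b)"
proof -
  have [measurable]: "V \<in> borel_measurable (lebI a b)" using AC_D(1)[OF assms] by auto
  have "(\<lambda>x. U a + prim a b V x) \<in> borel_measurable (lebI a b)"
    by (intro measurable_lebI) measurable
  then show ?thesis
  proof (rule measurable_cong[THEN iffD1, rotated])
    fix x assume "x \<in> space (lebI a b)"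
    then show "U a + prim a b V x = U x" by (subst AC_D(2)[OF assms]) auto
  qed
qed

lemma AC_bounded:
  assumes "AC a b U V" "x \<in> {a..b}"
  shows "\<bar>U x\<bar> \<le> \<bar>U a\<bar> + (\<integral>s. \<bar>V s\<bar> \<partial>lebI a b)"
  using AC_D(2)[OF assms] prim_bound[OF AC_D(1)[OF assms(1)], of x] by linarith

lemma AC_mult_integrable:
  assumes "AC a b U V" "integrable (lebI a b) f"
  shows "integrable (lebI a b) (\<lambda>x. f x * U x)"
  by (rule integrable_bounded_mult[OF assms(2) AC_measurable[OF assms(1)] AC_bounded[OF assms(1)]])
     auto

text \<open>The product rule at x is \<open>integral_prim_mult\<close> for V and Z both cut off at
  x, that is, integration by parts on (a, x).\<close>

lemma AC_mult:
  assumes U: "AC a b U V" and W: "AC a b W Z"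
  shows "AC a b (\<lambda>x. U x * W x) (\<lambda>x. U x * Z x + V x * W x)"
proof -
  let ?M = "lebI a b"
  have V: "integrable ?M V" and Z: "integrable ?M Z" using AC_D(1)[OF U] AC_D(1)[OF W] by auto
  have UZ: "integrable ?M (\<lambda>x. U x * Z x)" and VW: "integrable ?M (\<lambda>x. V x * W x)"
    using AC_mult_integrable[OF U Z] AC_mult_integrable[OF W V] by (simp_all add: mult.commute)
  have "U x * W x = U a * W a + prim a b (\<lambda>x. U x * Z x + V x * W x) x" if x: "x \<in> {a..b}" for x
  proof -
    let ?V = "\<lambda>s. if s < x then V s else 0" and ?Z = "\<lambda>s. if s < x then Z s else 0"
    have Ux: "U x = U a + prim a b V x" and Wx: "W x = W a + prim a b Z x"
      using AC_D(2)[OF U x] AC_D(2)[OF W x] .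
    have iV: "integrable ?M ?V" and iZ: "integrable ?M ?Z"
      using V Z by (auto intro: integrable_cut)
    have dU: "prim a b V t = U t - U a" and dW: "prim a b Z t = W t - W a"
      if "a < t" "t < b" for t
    proof -
      have "t \<in> {a..b}" using that by simp
      from AC_D(2)[OF U this] AC_D(2)[OF W this]
      show "prim a b V t = U t - U a" "prim a b Z t = W t - W a" by linarith+
    qed
    have e1: "(\<integral>t. prim a b ?V t * ?Z t \<partial>?M) = (\<integral>t. (if t < x then (U t - U a) * Z t else 0) \<partial>?M)"
      by (intro Bochner_Integration.integral_cong refl) (use dU in \<open>simp add: prim_cut\<close>)
    have e2: "(\<integral>t. ?V t * prim a b ?Z t \<partial>?M) = (\<integral>t. (if t < x then V t * (W t - W a) else 0) \<partial>?M)"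
      by (intro Bochner_Integration.integral_cong refl) (use dW in \<open>simp add: prim_cut\<close>)
    have i1: "integrable ?M (\<lambda>t. if t < x then (U t - U a) * Z t else 0)"
      by (intro integrable_cut) (use UZ Z in \<open>simp add: left_diff_distrib\<close>)
    have i2: "integrable ?M (\<lambda>t. if t < x then V t * (W t - W a) else 0)"
      by (intro integrable_cut) (use VW V in \<open>simp add: right_diff_distrib\<close>)
    have "prim a b (\<lambda>x. U x * Z x + V x * W x) x
      = (\<integral>t. (if t < x then (U t - U a) * Z t else 0) + (if t < x then V t * (W t - W a) else 0)
           + (U a * ?Z t + W a * ?V t) \<partial>?M)"
      unfolding prim_def by (rule Bochner_Integration.integral_cong) (auto simp: algebra_simps)
    also have "\<dots> = prim a b V x * prim a b Z x + (U a * prim a b Z x + W a * prim a b V x)"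
      using i1 i2 iV iZ integral_prim_mult[OF iV iZ] unfolding e1 e2
      by (simp add: prim_def)
    finally have *: "prim a b (\<lambda>x. U x * Z x + V x * W x) x
      = prim a b V x * prim a b Z x + (U a * prim a b Z x + W a * prim a b V x)" .
    show ?thesis unfolding * by (subst Ux, subst Wx) (simp add: algebra_simps)
  qed
  then show ?thesis
    using UZ VW unfolding AC_def by (intro conjI ballI Bochner_Integration.integrable_add)
qed

lemma AC_C1:
  assumes "\<And>x. x \<in> {a..b} \<Longrightarrow> (W has_real_derivative Z x) (at x)" "continuous_on {a..b} Z"
  shows "AC a b W Z"
proof -
  have "W x = W a + prim a b Z x" if x: "x \<in> {a..b}" for x
  proof -
    have "prim a b Z x = (\<integral>s. indicator {a<..<b} s *\<^sub>R (if s < x then Z s else 0) \<partial>lborel)"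
      unfolding prim_def lebI_def by (subst integral_restrict_space) auto
    also have "\<dots> = (\<integral>s. indicator {a..x} s *\<^sub>R Z s \<partial>lborel)"
    proof (rule integral_cong_AE)
      have "set_integrable lborel {a..b} Z"
        by (rule borel_integrable_atLeastAtMost'[OF assms(2)])
      then have [measurable]: "(\<lambda>s. indicator {a..b} s *\<^sub>R Z s) \<in> borel_measurable lborel"
        unfolding set_integrable_def by (rule borel_measurable_integrable)
      have "(\<lambda>s. indicator {a<..<b} s *\<^sub>R (if s < x then Z s else 0))
         = (\<lambda>s. if a < s \<and> s < b \<and> s < x then indicator {a..b} s *\<^sub>R Z s else 0)"
        by (auto simp: fun_eq_iff indicator_def)
      then show "(\<lambda>s. indicator {a<..<b} s *\<^sub>R (if s < x then Z s else 0)) \<in> borel_measurable lborel"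
        by simp
      have "(\<lambda>s. indicator {a..x} s *\<^sub>R Z s)
         = (\<lambda>s. if a \<le> s \<and> s \<le> x then indicator {a..b} s *\<^sub>R Z s else 0)"
        using x by (auto simp: fun_eq_iff indicator_def)
      then show "(\<lambda>s. indicator {a..x} s *\<^sub>R Z s) \<in> borel_measurable lborel" by simp
      have "AE s in lborel. s \<noteq> a \<and> s \<noteq> x"
        by (rule AE_I[where N="{a, x}"]) (auto intro: emeasure_lborel_countable)
      then show "AE s in lborel. indicator {a<..<b} s *\<^sub>R (if s < x then Z s else 0)
          = indicator {a..x} s *\<^sub>R Z s"
        by eventually_elim (use x in \<open>auto simp: indicator_def\<close>)
    qed
    also have "\<dots> = W x - W a"
    proof (rule integral_FTC_atLeastAtMost)
      show "continuous_on {a..x} Z"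
        using x by (intro continuous_on_subset[OF assms(2)]) simp
      show "(W has_vector_derivative Z s) (at s within {a..x})" if "a \<le> s" "s \<le> x" for s
      proof -
        have "(W has_real_derivative Z s) (at s)" using assms(1)[of s] that x by simp
        then show ?thesis
          by (rule has_real_derivative_iff_has_vector_derivative[THEN iffD1, OF has_field_derivative_at_within])
      qed
      show "a \<le> x" using x by simp
    qed
    finally show ?thesis by simp
  qed
  then show ?thesis
    using continuous_integrable_lebI[OF assms(2)] unfolding AC_def by blast
qed

section \<open>One-dimensional weighted inequalities\<close>

lemma AC_integrable:
  assumes "AC a b U V"
  shows "integrable (lebI a b) U"
  using AC_mult_integrable[OF assms, of "\<lambda>_. 1"] by simp

lemma AC_power: "AC a b (\<lambda>x. x ^ (k + 1)) (\<lambda>x. real (k + 1) * x ^ k)"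
proof (rule AC_C1)
  show "((\<lambda>x. x ^ (k + 1)) has_real_derivative real (k + 1) * x ^ k) (at x)" for x :: real
    using DERIV_pow[of "k + 1" x UNIV] by simp
qed (intro continuous_intros)

text \<open>The Cauchy-Schwarz step is built into the completed square. With a = j + d, the function
  x^d is orthogonal to F for the weight x^j by the mean condition; subtracting t x^d leaves a
  quadratic in t whose linear coefficient X equals F(1) up to a term at e. Its minimum pays for the
  boundary term F(1)^2, so the classical constant 4 / (j + 1)^2 survives.\<close>

lemma hardy_mean_zero:
  fixes e :: real and j a :: nat
  assumes e: "0 < e" "e \<le> 1 / 2" and F: "AC e 1 F P"
    and P2: "integrable (lebI e 1) (\<lambda>x. (P x)\<^sup>2)" and "j \<le> a"
    and mean: "(\<integral>x. F x * x ^ a \<partial>lebI e 1) = 0"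
  shows "(\<integral>x. (F x)\<^sup>2 * x ^ j \<partial>lebI e 1)
    \<le> 4 / (real j + 1)\<^sup>2 * (\<integral>x. (P x)\<^sup>2 * x ^ (j + 2) \<partial>lebI e 1)"
proof -
  let ?M = "lebI e 1"
  obtain d where a: "a = j + d" using \<open>j \<le> a\<close> le_Suc_ex by blast
  define b where "b = real (j + 1)"
  have b: "b \<ge> 1" by (simp add: b_def)
  have P1: "integrable ?M P" by (rule AC_D(1)[OF F])
  have iF: "integrable ?M F" by (rule AC_integrable[OF F])
  have cp: "continuous_on {e..1} (\<lambda>x. x ^ k)" for k by (intro continuous_intros)
  have iFF: "integrable ?M (\<lambda>x. (F x)\<^sup>2 * x ^ k)" for k
    using integrable_mult_continuous[OF AC_mult_integrable[OF F iF] cp]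
    by (simp add: power2_eq_square)
  have iFP: "integrable ?M (\<lambda>x. F x * P x * x ^ k)" for k
    using integrable_mult_continuous[OF AC_mult_integrable[OF F P1] cp] by (simp add: mult.commute)
  have iPP: "integrable ?M (\<lambda>x. (P x)\<^sup>2 * x ^ k)" for k
    by (rule integrable_mult_continuous[OF P2 cp])
  have iP: "integrable ?M (\<lambda>x. P x * x ^ k)" for k
    by (rule integrable_mult_continuous[OF P1 cp])
  have iF': "integrable ?M (\<lambda>x. F x * x ^ k)" for k
    by (rule integrable_mult_continuous[OF iF cp])
  have ip: "integrable ?M (\<lambda>x. x ^ k)" for k
    by (rule continuous_integrable_lebI[OF cp])
  define I1 where "I1 = (\<integral>x. (F x)\<^sup>2 * x ^ j \<partial>?M)"
  define I2 where "I2 = (\<integral>x. F x * P x * x ^ (j + 1) \<partial>?M)"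
  define I3 where "I3 = (\<integral>x. (P x)\<^sup>2 * x ^ (j + 2) \<partial>?M)"
  define X where "X = (\<integral>x. P x * x ^ (a + 1) \<partial>?M)"
  define K where "K = (\<integral>x. x ^ (j + 2 * d) \<partial>?M)"
  \<comment> \<open>The derivative of F^2 x^b is integrated; F(1)^2 is the boundary value with the
    wrong sign.\<close>
  have "(\<integral>x. F x * F x * (real (j + 1) * x ^ j) + (F x * P x + P x * F x) * x ^ (j + 1) \<partial>?M)
      = F 1 * F 1 * 1 ^ (j + 1) - F e * F e * e ^ (j + 1)"
    by (rule AC_integral[OF AC_mult[OF AC_mult[OF F F] AC_power]]) (use e in simp)
  moreover have "(\<integral>x. F x * F x * (real (j + 1) * x ^ j) + (F x * P x + P x * F x) * x ^ (j + 1) \<partial>?M)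
      = (\<integral>x. b * ((F x)\<^sup>2 * x ^ j) + 2 * (F x * P x * x ^ (j + 1)) \<partial>?M)"
    by (rule Bochner_Integration.integral_cong[OF refl])
       (simp only: b_def power2_eq_square, simp only: algebra_simps mult_2)
  moreover have "\<dots> = b * I1 + 2 * I2"
    unfolding I1_def I2_def using iFF[of j] iFP[of "j + 1"] by simp
  ultimately have H1: "b * I1 + 2 * I2 = (F 1)\<^sup>2 - (F e)\<^sup>2 * e ^ (j + 1)"
    by (simp add: power2_eq_square)
  \<comment> \<open>The derivative of F x^(a+1) is integrated; the mean condition removes the term
    with F, which expresses F(1) through X and F(e).\<close>
  have "(\<integral>x. F x * (real (a + 1) * x ^ a) + P x * x ^ (a + 1) \<partial>?M)
      = F 1 * 1 ^ (a + 1) - F e * e ^ (a + 1)"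
    by (rule AC_integral[OF AC_mult[OF F AC_power]]) (use e in simp)
  moreover have "(\<integral>x. F x * (real (a + 1) * x ^ a) + P x * x ^ (a + 1) \<partial>?M)
      = (\<integral>x. real (a + 1) * (F x * x ^ a) + P x * x ^ (a + 1) \<partial>?M)"
    by (rule Bochner_Integration.integral_cong[OF refl]) (simp only: algebra_simps)
  ultimately have H2: "X = F 1 - F e * e ^ (a + 1)"
    unfolding X_def using iF'[of a] iP[of "a + 1"] mean by simp
  \<comment> \<open>Expansion of a nonnegative square; the cross term of F with x^d is a multiple of
    the mean and vanishes.\<close>
  have main: "0 \<le> I3 + b * I2 + b\<^sup>2 / 4 * I1 - 2 * t * X + t\<^sup>2 * K" for t
  proof -
    have "0 \<le> (\<integral>x. (x * P x + b / 2 * F x - t * x ^ d)\<^sup>2 * x ^ j \<partial>?M)"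
      by (rule Bochner_Integration.integral_nonneg) (use e in auto)
    also have "\<dots> = (\<integral>x. ((((P x)\<^sup>2 * x ^ (j + 2) + b * (F x * P x * x ^ (j + 1)))
        + b\<^sup>2 / 4 * ((F x)\<^sup>2 * x ^ j)) - 2 * t * (P x * x ^ (a + 1))) - t * b * (F x * x ^ a)
        + t\<^sup>2 * x ^ (j + 2 * d) \<partial>?M)"
      by (rule Bochner_Integration.integral_cong[OF refl])
         (simp add: a power_add power_mult power2_eq_square algebra_simps)
    also have "\<dots> = I3 + b * I2 + b\<^sup>2 / 4 * I1 - 2 * t * X + t\<^sup>2 * K"
      unfolding I1_def I2_def I3_def X_def K_def
      using iFF[of j] iFP[of "j + 1"] iPP[of "j + 2"] iP[of "a + 1"] iF'[of a] ip[of "j + 2 * d"] mean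
      by simp
    finally show ?thesis .
  qed
  have "K \<ge> 0"
    unfolding K_def by (rule Bochner_Integration.integral_nonneg) (use e in auto)
  have "(\<integral>x. real (j + 2 * d + 1) * x ^ (j + 2 * d) \<partial>?M)
      = 1 ^ (j + 2 * d + 1) - e ^ (j + 2 * d + 1)"
    by (rule AC_integral[OF AC_power]) (use e in simp)
  then have "real (j + 2 * d + 1) * K \<le> 1"
    unfolding K_def using e by simp
  moreover have "b * K \<le> real (j + 2 * d + 1) * K"
    using \<open>K \<ge> 0\<close> by (intro mult_right_mono) (auto simp: b_def)
  ultimately have K: "b * K \<le> 1" by linarith
  \<comment> \<open>The value t = b X minimizes - 2 t X + t^2 K once K is replaced by its upper
    bound 1/b.\<close>
  have "b * X\<^sup>2 * (b * K) \<le> b * X\<^sup>2 * 1"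
    using K b by (intro mult_left_mono) auto
  with main[of "b * X"] have main': "b * X\<^sup>2 \<le> I3 + b * I2 + b\<^sup>2 / 4 * I1"
    by (simp add: power2_eq_square algebra_simps)
  \<comment> \<open>The error at the inner radius. As e^(j + 2d + 1) is at most 1/2, the favourable
    boundary term F(e)^2 e^(j+1) absorbs 2 y^2.\<close>
  define y where "y = F e * e ^ (a + 1)"
  have "e ^ (2 * (a + 1)) = e ^ (j + 1) * e ^ (j + 2 * d + 1)"
    by (simp add: a flip: power_add)
  moreover have "e ^ (j + 2 * d + 1) \<le> 1 / 2"
    using power_decreasing[of 1 "j + 2 * d + 1" e] e unfolding power_one_right by linarith
  ultimately have "e ^ (2 * (a + 1)) \<le> e ^ (j + 1) * (1 / 2)"
    using e by (simp only:) (intro mult_left_mono, auto)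
  then have "(F e)\<^sup>2 * e ^ (2 * (a + 1)) \<le> (F e)\<^sup>2 * (e ^ (j + 1) * (1 / 2))"
    by (intro mult_left_mono) auto
  moreover have "y\<^sup>2 = (F e)\<^sup>2 * e ^ (2 * (a + 1))"
    unfolding y_def by (simp only: power_mult_distrib power_mult[symmetric] mult.commute)
  ultimately have y: "2 * y\<^sup>2 \<le> (F e)\<^sup>2 * e ^ (j + 1)" by simp
  have "(F 1)\<^sup>2 = (X + y)\<^sup>2" using H2 by (simp add: y_def)
  also have "\<dots> \<le> 2 * X\<^sup>2 + 2 * y\<^sup>2"
    using zero_le_power2[of "X - y"] by (simp add: power2_eq_square algebra_simps)
  finally have "(F 1)\<^sup>2 - (F e)\<^sup>2 * e ^ (j + 1) \<le> 2 * X\<^sup>2" using y by simp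
  with H1 have "b * I1 + 2 * I2 \<le> 2 * X\<^sup>2" by simp
  \<comment> \<open>Half of this inequality added to \<open>main'\<close> cancels both I2 and X,
    leaving b^2/4 I1 \<le> I3.\<close>
  then have "b * (b * I1 + 2 * I2) \<le> b * (2 * X\<^sup>2)" using b by (intro mult_left_mono) auto
  with main' have "b\<^sup>2 / 4 * I1 \<le> I3"
    by (simp add: power2_eq_square algebra_simps)
  then have "I1 \<le> 4 / b\<^sup>2 * I3"
    using b by (simp add: field_simps)
  then show ?thesis by (simp add: I1_def I3_def b_def add.commute)
qed

text \<open>At c = cos \<phi> this is sin^(2r) \<phi>; the exponent is real because odd powers of
  the sine occur.\<close>

definition wt :: "real \<Rightarrow> real \<Rightarrow> real" where
  "wt r c = (1 - c\<^sup>2) powr r"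

lemma one_minus_square_pos:
  fixes c s :: real
  assumes "\<bar>c\<bar> \<le> s" "s \<le> 1 / 2"
  shows "0 < 1 - c\<^sup>2"
proof -
  have "c\<^sup>2 < 1" using assms abs_square_less_1[of c] by simp
  then show ?thesis by simp
qed

lemma wt_pos: "\<bar>c\<bar> \<le> s \<Longrightarrow> s \<le> 1 / 2 \<Longrightarrow> 0 < wt r c"
  using one_minus_square_pos[of c s] by (simp add: wt_def)

lemma wt_mult: "wt r c * wt r' c = wt (r + r') c"
  by (simp add: wt_def powr_add)

lemma continuous_wt: "s \<le> 1 / 2 \<Longrightarrow> continuous_on {-s..s} (wt r)"
proof -
  assume s: "s \<le> 1 / 2"
  have "1 - c\<^sup>2 \<noteq> 0" if "c \<in> {-s..s}" for c
    using one_minus_square_pos[OF _ s, of c] that by (auto simp: abs_le_iff)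
  then show ?thesis
    unfolding wt_def by (intro continuous_intros) blast
qed

text \<open>The comparison function of Barta's method is, up to the weight, minus the logarithmic derivative of
  \<open>cos\<^sup>l\<^sup>/\<^sup>2 x cos \<kappa>x\<close>, \<open>x = arcsin c\<close>; for \<open>l = 0\<close>, \<open>\<kappa> = 3\<close> this is the Dirichlet ground state.\<close>

lemma dirichlet_wt_aux:
  fixes s l \<kappa> :: real
  assumes s: "0 < s" "s \<le> 1 / 2" and l: "0 \<le> l" and \<kappa>: "0 \<le> \<kappa>" "\<kappa> < 3"
    and U: "AC (-s) s U (\<lambda>x. h x * wt ((l - 1) / 2) x)" "U (-s) = 0" "U s = 0"
    and h: "integrable (lebI (-s) s) (\<lambda>x. (h x)\<^sup>2 * wt ((l - 1) / 2) x)"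
  shows "(\<kappa>\<^sup>2 + l / 2) * (\<integral>x. (U x)\<^sup>2 * wt (- (l + 1) / 2) x \<partial>lebI (-s) s)
    \<le> (\<integral>x. (h x)\<^sup>2 * wt ((l - 1) / 2) x \<partial>lebI (-s) s)"
proof -
  let ?M = "lebI (-s) s"
  \<comment> \<open>With x = arcsin c: \<open>T\<close> is tan x, \<open>G\<close> is tan(\<kappa>
    x), and \<open>A\<close> is the negative logarithmic derivative in x.\<close>
  define T where "T = (\<lambda>c::real. c / sqrt (1 - c\<^sup>2))"
  define G where "G = (\<lambda>c. tan (\<kappa> * arcsin c))"
  define A where "A = (\<lambda>c. l / 2 * T c + \<kappa> * G c)"
  \<comment> \<open>The factor cos^(-l) x makes - U \<tau> equal to h when U is the comparison
    function itself, so the square (h + U \<tau>)^2 completed below is lossless there.\<close>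
  define \<tau> where "\<tau> = (\<lambda>c. A c * wt (- l / 2) c)"
  define \<tau>' where "\<tau>' = (\<lambda>c. (l / 2 * (1 + (T c)\<^sup>2) + \<kappa>\<^sup>2 * (1 + (G c)\<^sup>2) + l * A c * T c)
      * wt (- (l + 1) / 2) c)"
  have q: "1 - c\<^sup>2 > 0" if "c \<in> {-s..s}" for c
    using one_minus_square_pos[of c s] that s by (auto simp: abs_le_iff)
  have half: "wt (- (l + 1) / 2) c = wt (- l / 2) c / sqrt (1 - c\<^sup>2)" if "c \<in> {-s..s}" for c
    using q[OF that] by (simp add: wt_def add_divide_distrib diff_divide_distrib powr_diff powr_half_sqrt)
  \<comment> \<open>Here s \<le> 1/2 and \<kappa> < 3 meet: |arcsin c| \<le> pi/6 keeps the
    comparison function positive up to and including the endpoints.\<close>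
  have cosp: "cos (\<kappa> * arcsin c) > 0" if c: "c \<in> {-s..s}" for c
  proof -
    have "arcsin c \<le> arcsin (1 / 2)"
      by (rule arcsin_le_arcsin) (use c s in auto)
    moreover have "arcsin (- (1 / 2)) \<le> arcsin c"
      by (rule arcsin_le_arcsin) (use c s in auto)
    moreover have a: "arcsin (1 / 2) = pi / 6"
      using arcsin_sin[of "pi / 6"] pi_gt_zero by (simp add: sin_30)
    moreover have "arcsin (- (1 / 2)) = - (pi / 6)"
      unfolding a[symmetric] by (rule arcsin_minus) auto
    ultimately have "\<bar>arcsin c\<bar> \<le> pi / 6" by linarith
    then have "\<kappa> * \<bar>arcsin c\<bar> \<le> \<kappa> * (pi / 6)"
      using \<kappa>(1) by (rule mult_left_mono)
    then have "\<bar>\<kappa> * arcsin c\<bar> \<le> \<kappa> * (pi / 6)"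
      using \<kappa>(1) by (simp only: abs_mult abs_of_nonneg)
    also have "\<dots> < pi / 2" using \<kappa> pi_gt_zero by simp
    finally show ?thesis by (intro cos_gt_zero_pi) (auto simp: abs_less_iff)
  qed
  have dT: "(T has_real_derivative (1 + (T c)\<^sup>2) / sqrt (1 - c\<^sup>2)) (at c)" if "c \<in> {-s..s}" for c
    unfolding T_def using q[OF that]
    by (auto intro!: derivative_eq_intros simp: field_simps power2_eq_square)
  have dG: "(G has_real_derivative \<kappa> * (1 + (G c)\<^sup>2) / sqrt (1 - c\<^sup>2)) (at c)"
    if c: "c \<in> {-s..s}" for c
  proof -
    have "((\<lambda>c. \<kappa> * arcsin c) has_real_derivative \<kappa> * inverse (sqrt (1 - c\<^sup>2))) (at c)"
      using c s by (intro DERIV_cmult DERIV_arcsin) auto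
    moreover have "(tan has_real_derivative 1 + (G c)\<^sup>2) (at (\<kappa> * arcsin c))"
      using DERIV_tan[of "\<kappa> * arcsin c"] cosp[OF c] tan_sec[of "\<kappa> * arcsin c"]
      by (simp add: G_def power_inverse)
    ultimately have "((\<lambda>c. tan (\<kappa> * arcsin c)) has_real_derivative
        (1 + (G c)\<^sup>2) * (\<kappa> * inverse (sqrt (1 - c\<^sup>2)))) (at c)"
      by (rule DERIV_chain2[rotated])
    then show ?thesis by (simp add: G_def divide_inverse ac_simps)
  qed
  have dw: "(wt (- l / 2) has_real_derivative l * T c * wt (- (l + 1) / 2) c) (at c)"
    if c: "c \<in> {-s..s}" for c
  proof -
    have "((\<lambda>c. 1 - c\<^sup>2) has_real_derivative - (2 * c)) (at c)"
      by (auto intro!: derivative_eq_intros)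
    from DERIV_chain2[OF has_real_derivative_powr[OF q[OF c], of "- l / 2"] this]
    have "(wt (- l / 2) has_real_derivative
        - l / 2 * (1 - c\<^sup>2) powr (- l / 2 - 1) * - (2 * c)) (at c)"
      by (simp add: wt_def[abs_def])
    moreover have "(1 - c\<^sup>2) powr (- l / 2 - 1) = (1 - c\<^sup>2) powr (- l / 2) / (1 - c\<^sup>2)"
      using q[OF c] by (simp add: powr_diff)
    moreover have "sqrt (1 - c\<^sup>2) * sqrt (1 - c\<^sup>2) = 1 - c\<^sup>2" using q[OF c] by simp
    ultimately have "l * T c * wt (- (l + 1) / 2) c
        = - l / 2 * (1 - c\<^sup>2) powr (- l / 2 - 1) * - (2 * c)"
      unfolding half[OF c] T_def using q[OF c] by (simp add: wt_def divide_simps)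
    then show ?thesis
      using \<open>(wt (- l / 2) has_real_derivative _) (at c)\<close> by (simp only:)
  qed
  have d\<tau>: "(\<tau> has_real_derivative \<tau>' c) (at c)" if c: "c \<in> {-s..s}" for c
  proof -
    define D where "D = (l / 2 * ((1 + (T c)\<^sup>2) / sqrt (1 - c\<^sup>2)) + \<kappa> * (\<kappa> * (1 + (G c)\<^sup>2) / sqrt (1 - c\<^sup>2)))
          * wt (- l / 2) c + l * T c * wt (- (l + 1) / 2) c * A c"
    have "(\<tau> has_real_derivative D) (at c)"
      unfolding \<tau>_def A_def D_def
      by (intro DERIV_mult DERIV_add DERIV_cmult dT dG dw c)
    moreover have "D = \<tau>' c"
      unfolding \<tau>'_def D_def half[OF c] by (simp add: power2_eq_square algebra_simps add_divide_distrib)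
    ultimately show ?thesis by (simp only:)
  qed
  have T: "continuous_on {-s..s} T"
    by (rule DERIV_continuous_on) (rule has_field_derivative_at_within[OF dT])
  have G: "continuous_on {-s..s} G"
    by (rule DERIV_continuous_on) (rule has_field_derivative_at_within[OF dG])
  have "continuous_on {-s..s} \<tau>'"
    unfolding \<tau>'_def A_def using s by (intro continuous_intros T G continuous_wt)
  then have "AC (-s) s \<tau> \<tau>'" by (intro AC_C1 d\<tau>)
  note ac = AC_mult[OF AC_mult[OF U(1) U(1)] this]
  let ?w = "wt ((l - 1) / 2)"
  \<comment> \<open>The derivative of U^2 \<tau> integrates to 0 by the Dirichlet
    conditions.\<close>
  have i0: "(\<integral>x. U x * U x * \<tau>' x + (U x * (h x * ?w x) + h x * ?w x * U x) * \<tau> x \<partial>?M) = 0"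
    using AC_integral[OF ac] U s by simp
  have ineq: "(\<kappa>\<^sup>2 + l / 2) * ((U x)\<^sup>2 * wt (- (l + 1) / 2) x)
      \<le> (h x)\<^sup>2 * ?w x + (U x * U x * \<tau>' x + (U x * (h x * ?w x) + h x * ?w x * U x) * \<tau> x)"
    if x: "x \<in> {-s..s}" for x
  proof -
    let ?Q = "wt (- (l + 1) / 2) x"
    have Q: "?Q > 0" and w: "?w x > 0" using q[OF x] by (auto simp: wt_def)
    have "(\<tau> x)\<^sup>2 * ?w x = (A x)\<^sup>2 * (wt (- l / 2) x * wt (- l / 2) x * ?w x)"
      by (simp add: \<tau>_def power2_eq_square)
    also have "wt (- l / 2) x * wt (- l / 2) x * ?w x = ?Q"
      unfolding wt_mult by (simp add: field_simps)
    finally have t2: "(\<tau> x)\<^sup>2 * ?w x = (A x)\<^sup>2 * ?Q" .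
    \<comment> \<open>The eigenvalue equation in Riccati form. The surplus over \<kappa>^2 + l/2 is
      (l/2 + l^2/4) tan^2 x, which is nonnegative: this is the supersolution property.\<close>
    have "\<tau>' x - (\<tau> x)\<^sup>2 * ?w x
        = (\<kappa>\<^sup>2 + l / 2 + (l / 2 * (T x)\<^sup>2 + l\<^sup>2 / 4 * (T x)\<^sup>2)) * ?Q"
      unfolding t2 \<tau>'_def A_def by (simp add: power2_eq_square algebra_simps)
    also have "\<dots> \<ge> (\<kappa>\<^sup>2 + l / 2) * ?Q"
      using Q l by (intro mult_right_mono) auto
    finally have "(U x)\<^sup>2 * ((\<kappa>\<^sup>2 + l / 2) * ?Q) \<le> (U x)\<^sup>2 * (\<tau>' x - (\<tau> x)\<^sup>2 * ?w x)"
      by (intro mult_left_mono) auto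
    moreover have "0 \<le> (h x + U x * \<tau> x)\<^sup>2 * ?w x" using w by simp
    ultimately show ?thesis by (simp add: power2_eq_square algebra_simps)
  qed
  have UU: "integrable ?M (\<lambda>x. (U x)\<^sup>2 * wt (- (l + 1) / 2) x)"
    using integrable_mult_continuous[OF AC_mult_integrable[OF U(1) AC_integrable[OF U(1)]] continuous_wt]
      s by (simp add: power2_eq_square)
  have iAC: "integrable ?M (\<lambda>x. U x * U x * \<tau>' x + (U x * (h x * ?w x) + h x * ?w x * U x) * \<tau> x)"
    by (rule AC_D(1)[OF ac])
  have "(\<kappa>\<^sup>2 + l / 2) * (\<integral>x. (U x)\<^sup>2 * wt (- (l + 1) / 2) x \<partial>?M)
      = (\<integral>x. (\<kappa>\<^sup>2 + l / 2) * ((U x)\<^sup>2 * wt (- (l + 1) / 2) x) \<partial>?M)"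
    by simp
  also have "\<dots> \<le> (\<integral>x. (h x)\<^sup>2 * ?w x
      + (U x * U x * \<tau>' x + (U x * (h x * ?w x) + h x * ?w x * U x) * \<tau> x) \<partial>?M)"
    using UU h iAC ineq by (intro integral_mono) auto
  also have "\<dots> = (\<integral>x. (h x)\<^sup>2 * ?w x \<partial>?M)"
    using Bochner_Integration.integral_add[OF h iAC] i0 by simp
  finally show ?thesis .
qed

text \<open>Obtained as \<kappa> tends to 3 from below. At \<kappa> = 3 and s = 1/2 the comparison
  function vanishes at the endpoints and tan(\<kappa> arcsin c) blows up, so the limit is taken in
  the inequality and not in the comparison function.\<close>

lemma dirichlet_wt:
  fixes s l :: real
  assumes s: "0 < s" "s \<le> 1 / 2" and l: "0 \<le> l"
    and U: "AC (-s) s U (\<lambda>x. h x * wt ((l - 1) / 2) x)" "U (-s) = 0" "U s = 0"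
    and h: "integrable (lebI (-s) s) (\<lambda>x. (h x)\<^sup>2 * wt ((l - 1) / 2) x)"
  shows "(9 + l / 2) * (\<integral>x. (U x)\<^sup>2 * wt (- (l + 1) / 2) x \<partial>lebI (-s) s)
    \<le> (\<integral>x. (h x)\<^sup>2 * wt ((l - 1) / 2) x \<partial>lebI (-s) s)"
proof -
  let ?I = "\<integral>x. (U x)\<^sup>2 * wt (- (l + 1) / 2) x \<partial>lebI (-s) s"
  have "((\<lambda>\<kappa>. (\<kappa>\<^sup>2 + l / 2) * ?I) \<longlongrightarrow> (3\<^sup>2 + l / 2) * ?I) (at_left 3)"
    by (intro tendsto_intros)
  moreover have "\<forall>\<^sub>F \<kappa> in at_left 3. (\<kappa>\<^sup>2 + l / 2) * ?I
      \<le> (\<integral>x. (h x)\<^sup>2 * wt ((l - 1) / 2) x \<partial>lebI (-s) s)"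
    unfolding eventually_at_left_field
    using dirichlet_wt_aux[OF s l _ _ U h] by (intro exI[of _ 0]) auto
  ultimately have "(3\<^sup>2 + l / 2) * ?I \<le> (\<integral>x. (h x)\<^sup>2 * wt ((l - 1) / 2) x \<partial>lebI (-s) s)"
    by (rule tendsto_upperbound) simp
  then show ?thesis by simp
qed

text \<open>By duality: integrating \<open>h\<^sup>2 w\<close> by parts against the primitive \<open>U\<close> of \<open>h w\<close>, which vanishes at
  both ends, reduces the claim to the Dirichlet inequality for \<open>U\<close>.\<close>

lemma poincare_wt:
  fixes s l :: real
  assumes s: "0 < s" "s \<le> 1 / 2" and l: "0 \<le> l"
    and h: "AC (-s) s h v" and v: "integrable (lebI (-s) s) (\<lambda>x. (v x)\<^sup>2)"
    and mean: "(\<integral>x. h x * wt ((l - 1) / 2) x \<partial>lebI (-s) s) = 0"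
  shows "(\<integral>x. (h x)\<^sup>2 * wt ((l - 1) / 2) x \<partial>lebI (-s) s)
    \<le> 2 / (18 + l) * (\<integral>x. (v x)\<^sup>2 * wt ((l + 1) / 2) x \<partial>lebI (-s) s)"
proof -
  let ?M = "lebI (-s) s" and ?w = "wt ((l - 1) / 2)" and ?Q = "wt (- (l + 1) / 2)"
  note cw = continuous_wt[OF s(2)]
  define U where "U = (\<lambda>x. 0 + prim (-s) s (\<lambda>x. h x * ?w x) x)"
  have ihw: "integrable ?M (\<lambda>x. h x * ?w x)"
    by (rule integrable_mult_continuous[OF AC_integrable[OF h] cw])
  have U: "AC (-s) s U (\<lambda>x. h x * ?w x)"
    unfolding U_def by (rule AC_prim[OF ihw])
  have U0: "U (-s) = 0" "U s = 0"
    using mean by (simp_all add: U_def prim_left prim_right)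
  have hh: "integrable ?M (\<lambda>x. (h x)\<^sup>2 * ?w x)"
    using integrable_mult_continuous[OF AC_mult_integrable[OF h AC_integrable[OF h]] cw]
    by (simp add: power2_eq_square)
  have UU: "integrable ?M (\<lambda>x. (U x)\<^sup>2 * ?Q x)"
    using integrable_mult_continuous[OF AC_mult_integrable[OF U AC_integrable[OF U]] cw]
    by (simp add: power2_eq_square)
  have vv: "integrable ?M (\<lambda>x. (v x)\<^sup>2 * wt ((l + 1) / 2) x)"
    by (rule integrable_mult_continuous[OF v cw])
  have vU: "integrable ?M (\<lambda>x. v x * U x)"
    by (rule AC_mult_integrable[OF U AC_D(1)[OF h]])
  \<comment> \<open>Since 1/C = 9 + l/2, the Dirichlet inequality turns the U-term of Young's
    inequality into at most half of the left-hand side, which is then absorbed.\<close>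
  define C where "C = 2 / (18 + l)"
  have C: "C > 0" using l by (simp add: C_def)
  have "(\<integral>x. h x * (h x * ?w x) + v x * U x \<partial>?M) = 0"
    using AC_integral[OF AC_mult[OF h U]] U0 s by simp
  then have "(\<integral>x. (h x)\<^sup>2 * ?w x \<partial>?M) = (\<integral>x. - (v x * U x) \<partial>?M)"
    using Bochner_Integration.integral_add[OF hh vU] by (simp add: power2_eq_square mult.assoc)
  also have "\<dots> \<le> (\<integral>x. C / 2 * ((v x)\<^sup>2 * wt ((l + 1) / 2) x) + 1 / (2 * C) * ((U x)\<^sup>2 * ?Q x) \<partial>?M)"
  proof (rule integral_mono)
    fix x assume "x \<in> space ?M"
    then have x: "\<bar>x\<bar> \<le> s" by (auto simp: abs_le_iff)
    define Y where "Y = wt ((l + 1) / 2) x"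
    have Y: "Y > 0" using wt_pos[OF x s(2)] by (simp add: Y_def)
    \<comment> \<open>The Dirichlet weight is the reciprocal of the weight of v, exactly as Young's
      inequality for v U requires.\<close>
    have "Y * ?Q x = wt 0 x" unfolding Y_def wt_mult by (simp add: field_simps)
    then have Q: "?Q x = 1 / Y"
      using Y one_minus_square_pos[OF x s(2)] by (simp add: wt_def field_simps)
    have "0 \<le> (C * Y * v x + U x)\<^sup>2 / (2 * C * Y)" using C Y by simp
    also have "\<dots> = C / 2 * ((v x)\<^sup>2 * Y) + v x * U x + 1 / (2 * C) * ((U x)\<^sup>2 * (1 / Y))"
      using C Y by (simp add: field_simps power2_eq_square)
    finally show "- (v x * U x) \<le> C / 2 * ((v x)\<^sup>2 * wt ((l + 1) / 2) x) + 1 / (2 * C) * ((U x)\<^sup>2 * ?Q x)"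
      unfolding Q Y_def[symmetric] by simp
  qed (use vU vv UU in auto)
  also have "\<dots> = C / 2 * (\<integral>x. (v x)\<^sup>2 * wt ((l + 1) / 2) x \<partial>?M) + 1 / (2 * C) * (\<integral>x. (U x)\<^sup>2 * ?Q x \<partial>?M)"
    using vv UU by simp
  also have "1 / (2 * C) * (\<integral>x. (U x)\<^sup>2 * ?Q x \<partial>?M) = ((9 + l / 2) * (\<integral>x. (U x)\<^sup>2 * ?Q x \<partial>?M)) / 2"
    by (simp add: C_def field_simps)
  also have "\<dots> \<le> (\<integral>x. (h x)\<^sup>2 * ?w x \<partial>?M) / 2"
    using dirichlet_wt[OF s l U U0 hh] by (intro divide_right_mono) auto
  finally have "(\<integral>x. (h x)\<^sup>2 * ?w x \<partial>?M)
      \<le> C / 2 * (\<integral>x. (v x)\<^sup>2 * wt ((l + 1) / 2) x \<partial>?M) + (\<integral>x. (h x)\<^sup>2 * ?w x \<partial>?M) / 2"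
    by simp
  then have "(\<integral>x. (h x)\<^sup>2 * ?w x \<partial>?M) \<le> C * (\<integral>x. (v x)\<^sup>2 * wt ((l + 1) / 2) x \<partial>?M)"
    by (simp add: field_simps)
  then show ?thesis by (simp add: C_def)
qed

section \<open>The du Bois-Reymond lemma on a rectangle\<close>

text \<open>The pi-lambda argument for the signed measure with density \<Gamma>, pushed forward
  along \<pi>. Complements use the vanishing total integral, disjoint unions dominated
  convergence.\<close>

lemma integral_indicator_eq_0:
  fixes \<Gamma> :: "'a \<Rightarrow> real"
  assumes G: "Int_stable G" "G \<subseteq> Pow \<Omega>" and K: "sets K = sigma_sets \<Omega> G" "space K = \<Omega>"
    and \<pi>[measurable]: "\<pi> \<in> measurable N K" and \<Gamma>: "integrable N \<Gamma>"
    and zero: "\<And>X. X \<in> G \<Longrightarrow> (\<integral>p. \<Gamma> p * indicator X (\<pi> p) \<partial>N) = 0" "(\<integral>p. \<Gamma> p \<partial>N) = 0"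
    and X: "X \<in> sets K"
  shows "(\<integral>p. \<Gamma> p * indicator X (\<pi> p) \<partial>N) = 0"
proof -
  have int: "integrable N (\<lambda>p. \<Gamma> p * indicator A (\<pi> p))" if [measurable]: "A \<in> sets K" for A
    by (rule integrable_bounded_mult[OF \<Gamma>, where C=1]) auto
  have "X \<in> sigma_sets \<Omega> G" using X K by simp
  with G show ?thesis
  proof (induction rule: sigma_sets_induct_disjoint)
    case (basic A)
    then show ?case by (rule zero)
  next
    case empty
    then show ?case by simp
  next
    case (compl A)
    have "(\<integral>p. \<Gamma> p * indicator (\<Omega> - A) (\<pi> p) \<partial>N) = (\<integral>p. \<Gamma> p - \<Gamma> p * indicator A (\<pi> p) \<partial>N)"
      using measurable_space[OF \<pi>] K(2)
      by (intro Bochner_Integration.integral_cong) (auto simp: indicator_def)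
    also have "\<dots> = 0"
      using \<Gamma> int[of A] compl zero(2) K(1) by simp
    finally show ?case .
  next
    case (union A)
    have A: "A i \<in> sets K" for i using union(2) K(1) by auto
    note [measurable] = A
    have "(\<lambda>n. \<integral>p. \<Gamma> p * indicator (\<Union>i<n. A i) (\<pi> p) \<partial>N)
        \<longlonglongrightarrow> (\<integral>p. \<Gamma> p * indicator (\<Union>i. A i) (\<pi> p) \<partial>N)"
    proof (rule integral_dominated_convergence[where w="\<lambda>p. \<bar>\<Gamma> p\<bar>"])
      show "AE p in N. (\<lambda>n. \<Gamma> p * indicator (\<Union>i<n. A i) (\<pi> p))
          \<longlonglongrightarrow> \<Gamma> p * indicator (\<Union>i. A i) (\<pi> p)"
        by (intro AE_I2 tendsto_intros LIMSEQ_indicator_UN)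
    qed (use \<Gamma> in \<open>auto simp: indicator_def\<close>)
    moreover have "(\<integral>p. \<Gamma> p * indicator (\<Union>i<n. A i) (\<pi> p) \<partial>N) = 0" for n
    proof -
      have "(\<integral>p. \<Gamma> p * indicator (\<Union>i<n. A i) (\<pi> p) \<partial>N)
          = (\<integral>p. (\<Sum>i<n. \<Gamma> p * indicator (A i) (\<pi> p)) \<partial>N)"
        using union(1) unfolding sum_distrib_left[symmetric]
        by (subst indicator_UN_disjoint) (auto intro: disjoint_family_on_mono)
      also have "\<dots> = 0"
        by (subst Bochner_Integration.integral_sum) (use int[OF A] union(3) in simp_all)
      finally show ?thesis .
    qed
    ultimately show ?case by (simp add: LIMSEQ_const_iff)
  qed
qed

text \<open>Open intervals are an intersection-stable generator of the Borel sets. The range of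
  \<pi> lies in a bounded interval, so the total integral is itself one of the interval
  integrals.\<close>

lemma integral_indicator_eq_0_real:
  fixes \<Gamma> :: "'a \<Rightarrow> real"
  assumes \<pi>: "\<pi> \<in> borel_measurable N" and \<Gamma>: "integrable N \<Gamma>"
    and zero: "\<And>u v. (\<integral>p. \<Gamma> p * indicator {u<..<v} (\<pi> p) \<partial>N) = 0"
    and ab: "\<And>p. p \<in> space N \<Longrightarrow> \<pi> p \<in> {a<..<b::real}"
    and X: "X \<in> sets borel"
  shows "(\<integral>p. \<Gamma> p * indicator X (\<pi> p) \<partial>N) = 0"
proof (rule integral_indicator_eq_0[OF _ _ _ _ \<pi> \<Gamma> _ _ X])
  show "Int_stable (range (\<lambda>(u, v). {u<..<v::real}))"
  proof (rule Int_stableI)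
    fix A B :: "real set"
    assume "A \<in> range (\<lambda>(u, v). {u<..<v::real})" "B \<in> range (\<lambda>(u, v). {u<..<v::real})"
    then obtain u v u' v' where "A = {u<..<v}" "B = {u'<..<v'}" by auto
    then have "A \<inter> B = (\<lambda>(u, v). {u<..<v}) (max u u', min v v')" by auto
    then show "A \<inter> B \<in> range (\<lambda>(u, v). {u<..<v})" by (rule range_eqI)
  qed
  show "sets (borel :: real measure) = sigma_sets UNIV (range (\<lambda>(u, v). {u<..<v}))"
  proof -
    have e: "(\<lambda>(u, v). {u<..<v::real}) = (\<lambda>(u, v). box u v)" by (auto simp: fun_eq_iff box_real)
    show ?thesis unfolding e by (subst borel_eq_box) simp
  qed
  have "(\<integral>p. \<Gamma> p \<partial>N) = (\<integral>p. \<Gamma> p * indicator {a<..<b} (\<pi> p) \<partial>N)"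
    by (rule Bochner_Integration.integral_cong) (use ab in auto)
  then show "(\<integral>p. \<Gamma> p \<partial>N) = 0" using zero by simp
qed (use zero in auto)

section \<open>Test functions of one variable\<close>

definition test1 :: "real \<Rightarrow> real \<Rightarrow> (real \<Rightarrow> real) \<Rightarrow> bool" where
  "test1 a b u \<longleftrightarrow> (\<forall>n. Ck n u) \<and>
     (\<exists>a' b'. a < a' \<and> a' \<le> b' \<and> b' < b \<and> (\<forall>x. x \<notin> {a'..b'} \<longrightarrow> u x = 0))"

lemma test1_bump:
  assumes "a < b" "a \<le> u" "v \<le> b" "0 < n"
  shows "test1 a b (bump u v n)"
proof (cases "u + 1 / real n \<le> v - 1 / real n")
  case True
  have n: "1 / real n > 0" using assms by simp
  show ?thesis
    unfolding test1_def
    by (intro conjI exI[of _ "u + 1 / real n"] exI[of _ "v - 1 / real n"] allI Ck_bump impI bump_eq_0)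
       (use n assms True in linarith)+
next
  case False
  \<comment> \<open>The interval carrying the bump is empty, so the bump is 0 and any single point
    of (a, b) can serve as its support.\<close>
  then have "bump u v n x = 0" for x by (intro bump_eq_0) (simp del: One_nat_def)
  then show ?thesis
    unfolding test1_def using assms(1) Ck_bump
    by (intro conjI exI[of _ "(a + b) / 2"]) auto
qed

lemma Ck_continuous: "Ck n u \<Longrightarrow> continuous_on A u"
proof -
  assume "Ck n u"
  then have "Ck 0 u"
    using Ck_on_SucD[of _ UNIV u] unfolding Ck_on_UNIV[symmetric] by (induction n) blast+
  then show ?thesis by (auto intro: continuous_on_subset)
qed

lemma test1_deriv:
  assumes "test1 a b u"
  shows "(u has_real_derivative deriv u x) (at x)" "continuous_on A u" "continuous_on A (deriv u)"
    and "u a = 0" "u b = 0"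
proof -
  have C: "Ck n u" for n using assms by (simp add: test1_def)
  have "u differentiable (at x)" for x using C[of 1] by simp
  then have "u field_differentiable (at x)" for x
    using real_differentiable_def field_differentiable_def by metis
  then show d: "(u has_real_derivative deriv u x) (at x)" for x
    by (simp add: DERIV_deriv_iff_field_differentiable)
  show "continuous_on A u" by (rule Ck_continuous[OF C])
  have "continuous_on A (\<lambda>x. frechet_derivative u (at x) 1)"
    by (rule Ck_continuous[of 0]) (use C[of 1] in simp)
  moreover have "frechet_derivative u (at x) 1 = deriv u x" for x
    using fun_cong[OF frechet_derivative_at[OF d[of x, unfolded has_field_derivative_def]], of 1]
    by simp
  ultimately show "continuous_on A (deriv u)" by simp
  show "u a = 0" "u b = 0" using assms by (auto simp: test1_def)
qed

text \<open>An antiderivative is constant on either side of the support of u, and mean zero makes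
  the two constants equal; normalizing them to 0 gives compact support again.\<close>

lemma test1_antiderivative:
  assumes "a < b" "test1 a b u" and zero: "(\<integral>x. u x \<partial>lebI a b) = 0"
  obtains g where "test1 a b g" "\<forall>x. (g has_real_derivative u x) (at x)"
proof -
  have cu: "continuous_on A u" for A by (rule test1_deriv(2)[OF assms(2)])
  obtain a' b' where ab: "a < a'" "a' \<le> b'" "b' < b" and u0: "\<forall>x. x \<notin> {a'..b'} \<longrightarrow> u x = 0"
    using assms by (auto simp: test1_def)
  \<comment> \<open>An open margin around [a, b], so that G has two-sided derivatives at a and b as
    well.\<close>
  define S where "S = {a - 1<..<b + 1}"
  obtain G where G: "\<And>x. x \<in> {a - 1..b + 1} \<Longrightarrow>
      (G has_vector_derivative u x) (at x within {a - 1..b + 1})"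
    using antiderivative_continuous[OF cu] by blast
  have dG: "(G has_real_derivative u x) (at x)" if "x \<in> S" for x
  proof -
    have "(G has_vector_derivative u x) (at x within S)"
      by (rule has_vector_derivative_within_subset[OF G]) (use that in \<open>auto simp: S_def\<close>)
    then show ?thesis
      using that at_within_open[of x S]
      by (simp add: S_def has_real_derivative_iff_has_vector_derivative)
  qed
  define g where "g = (\<lambda>x. if x \<in> S then G x - G a else 0)"
  have "AC a b G u"
    by (rule AC_C1[OF dG cu]) (auto simp: S_def)
  from AC_integral[OF this] have Gab: "G b = G a" using zero ab by simp
  have dg: "(g has_real_derivative u x) (at x)" if "x \<in> S" for x
  proof -
    have "((\<lambda>x. G x - G a) has_real_derivative u x) (at x)"
      using dG[OF that] by (auto intro!: derivative_eq_intros)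
    then show ?thesis
      by (rule has_field_derivative_transform_within_open[where S=S])
         (use that in \<open>auto simp: g_def S_def\<close>)
  qed
  have const: "G y = G x" if "x \<le> y" "x \<in> S" "y \<in> S" "\<And>t. x < t \<Longrightarrow> t < y \<Longrightarrow> u t = 0" for x y
  proof (cases "x < y")
    case True
    show ?thesis
    proof (rule DERIV_isconst_end[OF True])
      show "continuous_on {x..y} G"
        by (rule DERIV_continuous_on[where D=u])
           (use that in \<open>auto intro!: has_field_derivative_at_within dG simp: S_def\<close>)
      show "(G has_real_derivative 0) (at t)" if "x < t" "t < y" for t
        using dG[of t] that \<open>x \<in> S\<close> \<open>y \<in> S\<close> \<open>\<And>t. x < t \<Longrightarrow> t < y \<Longrightarrow> u t = 0\<close> by (auto simp: S_def)
    qed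
  qed (use that in auto)
  have g0: "g x = 0" if x: "x \<notin> {a'..b'}" for x
  proof (cases "x \<in> S")
    case xS: True
    have aS: "a \<in> S" "b \<in> S" using ab by (auto simp: S_def)
    consider "x < a'" | "x > b'" using x by force
    then have "G x = G a"
    proof cases
      case 1
      then show ?thesis
        using const[of a x] const[of x a] xS aS u0 ab by (cases "a \<le> x") auto
    next
      case 2
      then have "G x = G b"
        using const[of b x] const[of x b] xS aS u0 ab by (cases "b \<le> x") auto
      then show ?thesis using Gab by simp
    qed
    then show ?thesis by (simp add: g_def)
  qed (simp add: g_def)
  have "Ck n g" for n
  proof (rule Ck_zero_outside[where S=S and K="{a'..b'}"])
    have "Ck_on n UNIV u" using assms(2) by (simp add: test1_def Ck_on_UNIV)
    then have "Ck_on n S u" by (rule Ck_on_subset) simp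
    then have "Ck_on (Suc n) S g"
      by (intro Ck_on_real_SucI[OF _ dg]) (auto simp: S_def)
    then show "Ck_on n S g" by (rule Ck_on_SucD)
  qed (use ab g0 in \<open>auto simp: S_def\<close>)
  then have "test1 a b g"
    using ab g0 unfolding test1_def by blast
  moreover have "(g has_real_derivative u x) (at x)" for x
  proof (cases "x \<in> S")
    case False
    then have x: "x \<in> - {a'..b'}" using ab by (auto simp: S_def)
    have "(g has_real_derivative 0) (at x)"
      by (rule has_field_derivative_transform_within_open[where S="- {a'..b'}" and f="\<lambda>_. 0"])
         (use x g0 in \<open>auto simp: open_Compl\<close>)
    then show ?thesis using u0 x by auto
  qed (rule dg)
  ultimately show ?thesis using that by blast
qed

section \<open>The fundamental lemma for product test functions\<close>

abbreviation lebI2 :: "real \<Rightarrow> real \<Rightarrow> real \<Rightarrow> real \<Rightarrow> (real \<times> real) measure" where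
  "lebI2 a b c d \<equiv> lebI a b \<Otimes>\<^sub>M lebI c d"

lemma space_lebI2: "space (lebI2 a b c d) = {a<..<b} \<times> {c<..<d}"
  by (simp add: space_pair_measure)

lemma integrable_mult_test1:
  fixes g :: "real \<times> real \<Rightarrow> real"
  assumes "integrable (lebI2 a b c d) g" "continuous_on {a..b} u" "continuous_on {c..d} w"
  shows "integrable (lebI2 a b c d) (\<lambda>p. g p * (u (fst p) * w (snd p)))"
proof -
  obtain C where C: "\<forall>x\<in>{a..b}. \<bar>u x\<bar> \<le> C" using continuous_bounded_Icc[OF assms(2)] .
  obtain D where D: "\<forall>x\<in>{c..d}. \<bar>w x\<bar> \<le> D" using continuous_bounded_Icc[OF assms(3)] .
  note [measurable] = continuous_measurable_lebI[OF assms(2)] continuous_measurable_lebI[OF assms(3)]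
  show ?thesis
  proof (rule integrable_bounded_mult[OF assms(1), where C="C * D"])
    fix p assume p: "p \<in> space (lebI2 a b c d)"
    then have "fst p \<in> {a..b}" "snd p \<in> {c..d}" by (auto simp: space_lebI2)
    then have "\<bar>u (fst p)\<bar> \<le> C" "\<bar>w (snd p)\<bar> \<le> D" using C D by blast+
    then show "\<bar>u (fst p) * w (snd p)\<bar> \<le> C * D"
      unfolding abs_mult by (intro mult_mono) auto
  qed measurable
qed

text \<open>Bumps approximate indicators of open rectangles; Borel rectangles are reached one side
  at a time, and the whole product sigma-algebra by a third pi-lambda argument. A density whose
  integral over every measurable set vanishes is 0 almost everywhere.\<close>

lemma fundamental_lemma:
  fixes g :: "real \<times> real \<Rightarrow> real"
  assumes ab: "a < b" "c < d" and g: "integrable (lebI2 a b c d) g"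
    and zero: "\<And>u w. test1 a b u \<Longrightarrow> test1 c d w \<Longrightarrow>
      (\<integral>p. g p * (u (fst p) * w (snd p)) \<partial>lebI2 a b c d) = 0"
  shows "AE p in lebI2 a b c d. g p = 0"
proof -
  let ?M = "lebI2 a b c d"
  have [measurable]: "g \<in> borel_measurable ?M" using g by auto
  have box: "(\<integral>p. g p * (indicator {u<..<u'} (fst p) * indicator {w<..<w'} (snd p)) \<partial>?M) = 0"
    for u u' w w'
  proof -
    \<comment> \<open>Clipping to (a, b) and (c, d) makes the bumps admissible tests without
      changing the indicators on the space.\<close>
    define \<alpha> where "\<alpha> = (\<lambda>n. bump (max a u) (min b u') (Suc n))"
    define \<beta> where "\<beta> = (\<lambda>n. bump (max c w) (min d w') (Suc n))"
    have t: "test1 a b (\<alpha> n)" "test1 c d (\<beta> n)" for n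
      unfolding \<alpha>_def \<beta>_def using ab by (auto intro!: test1_bump)
    have lim: "(\<lambda>n. \<alpha> n x) \<longlonglongrightarrow> indicator {max a u<..<min b u'} x"
      "(\<lambda>n. \<beta> n x) \<longlonglongrightarrow> indicator {max c w<..<min d w'} x" for x
      unfolding \<alpha>_def \<beta>_def by (rule LIMSEQ_Suc[OF bump_tendsto])+
    have [measurable]: "\<alpha> n \<in> borel_measurable borel" "\<beta> n \<in> borel_measurable borel" for n
      using test1_deriv(2)[OF t(1)] test1_deriv(2)[OF t(2)]
      by (auto intro: borel_measurable_continuous_onI)
    have "(\<lambda>n. \<integral>p. g p * (\<alpha> n (fst p) * \<beta> n (snd p)) \<partial>?M) \<longlonglongrightarrow>
      (\<integral>p. g p * (indicator {max a u<..<min b u'} (fst p) * indicator {max c w<..<min d w'} (snd p)) \<partial>?M)"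
    proof (rule integral_dominated_convergence[where w="\<lambda>p. \<bar>g p\<bar>"])
      show "AE p in ?M. (\<lambda>n. g p * (\<alpha> n (fst p) * \<beta> n (snd p))) \<longlonglongrightarrow>
        g p * (indicator {max a u<..<min b u'} (fst p) * indicator {max c w<..<min d w'} (snd p))"
        by (intro AE_I2 tendsto_mult tendsto_const lim)
      have "\<bar>\<alpha> n x * \<beta> n y\<bar> \<le> 1" for n x y
        unfolding \<alpha>_def \<beta>_def by (simp add: abs_mult bump_bounds mult_le_one)
      then show "AE p in ?M. norm (g p * (\<alpha> n (fst p) * \<beta> n (snd p))) \<le> \<bar>g p\<bar>" for n
        by (simp add: abs_mult[of "g _"] mult_left_le)
    qed (use g in auto)
    then have "(\<integral>p. g p * (indicator {max a u<..<min b u'} (fst p) * indicator {max c w<..<min d w'} (snd p)) \<partial>?M) = 0"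
      using zero[OF t] by (simp add: LIMSEQ_const_iff)
    moreover have "(\<integral>p. g p * (indicator {u<..<u'} (fst p) * indicator {w<..<w'} (snd p)) \<partial>?M)
      = (\<integral>p. g p * (indicator {max a u<..<min b u'} (fst p) * indicator {max c w<..<min d w'} (snd p)) \<partial>?M)"
      by (intro Bochner_Integration.integral_cong) (auto simp: space_lebI2 indicator_def)
    ultimately show ?thesis by simp
  qed
  \<comment> \<open>With the second interval absorbed into the density, the pi-lambda argument runs
    in the first coordinate alone; \<open>s2\<close> then does the same in the second.\<close>
  have s1: "(\<integral>p. g p * indicator {w<..<w'} (snd p) * indicator X (fst p) \<partial>?M) = 0"
    if X: "X \<in> sets borel" for X w w'
  proof (rule integral_indicator_eq_0_real[OF measurable_lebI_fst _ _ _ X])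
    show "integrable ?M (\<lambda>p. g p * indicator {w<..<w'} (snd p))"
      by (rule integrable_bounded_mult[OF g, where C=1]) auto
    show "(\<integral>p. g p * indicator {w<..<w'} (snd p) * indicator {u<..<v} (fst p) \<partial>?M) = 0" for u v
      using box[of u v w w'] by (simp add: ac_simps)
  qed (auto simp: space_lebI2)
  have s2: "(\<integral>p. g p * indicator X (fst p) * indicator Y (snd p) \<partial>?M) = 0"
    if X[measurable]: "X \<in> sets borel" and Y: "Y \<in> sets borel" for X Y
  proof (rule integral_indicator_eq_0_real[OF measurable_lebI_snd _ _ _ Y])
    show "integrable ?M (\<lambda>p. g p * indicator X (fst p))"
      by (rule integrable_bounded_mult[OF g, where C=1]) auto
    show "(\<integral>p. g p * indicator X (fst p) * indicator {u<..<v} (snd p) \<partial>?M) = 0" for u v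
      using s1[OF X, of u v] by (simp add: ac_simps)
  qed (auto simp: space_lebI2)
  have whole: "(\<integral>p. g p \<partial>?M) = 0" using s2[of UNIV UNIV] by simp
  have sub: "A \<subseteq> {u<..<v}" if "A \<in> sets (lebI u v)" for A u v
    using sets.sets_into_space[OF that] by simp
  have s3: "(\<integral>p. g p * indicator E p \<partial>?M) = 0" if E: "E \<in> sets ?M" for E
  proof (rule integral_indicator_eq_0[OF Int_stable_pair_measure_generator[of "lebI a b" "lebI c d"]
        _ _ _ _ g _ whole E, where \<pi>="\<lambda>p. p"])
    fix R assume "R \<in> {A \<times> B |A B. A \<in> sets (lebI a b) \<and> B \<in> sets (lebI c d)}"
    then obtain A B where R: "R = A \<times> B" "A \<in> sets (lebI a b)" "B \<in> sets (lebI c d)" by auto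
    then have AB: "A \<in> sets borel" "B \<in> sets borel"
      by (auto simp: sets_lebI sets_restrict_space)
    show "(\<integral>p. g p * indicator R p \<partial>?M) = 0"
      using s2[OF AB] by (simp add: R(1) indicator_times mult.assoc)
  qed (use sub in \<open>auto simp: sets_pair_measure space_pair_measure dest!: sub subsetD\<close>)
  have "AE p in ?M. g p = (\<lambda>_. 0) p"
  proof (rule density_unique_real[OF g])
    fix E assume "E \<in> sets ?M"
    then show "(\<integral>p\<in>E. g p \<partial>?M) = (\<integral>p\<in>E. 0 \<partial>?M)"
      using s3[of E] by (simp add: set_lebesgue_integral_def mult.commute)
  qed simp
  then show ?thesis by simp
qed


section \<open>Slices of a rectangle and the du Bois-Reymond lemma\<close>

lemma AE_lebI2_snd: "AE y in lebI c d. Q y \<Longrightarrow> AE p in lebI2 a b c d. Q (snd p)"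
proof -
  assume "AE y in lebI c d. Q y"
  then obtain N where N: "{y \<in> space (lebI c d). \<not> Q y} \<subseteq> N" "emeasure (lebI c d) N = 0"
    "N \<in> sets (lebI c d)"
    by (rule AE_E)
  show ?thesis
  proof (rule AE_I)
    show "{p \<in> space (lebI2 a b c d). \<not> Q (snd p)} \<subseteq> space (lebI a b) \<times> N"
      using N by (auto simp: space_lebI2)
    show "emeasure (lebI2 a b c d) (space (lebI a b) \<times> N) = 0"
      using N(2,3) by (subst lebI.emeasure_pair_measure_Times) (auto simp del: space_lebI)
    show "space (lebI a b) \<times> N \<in> sets (lebI2 a b c d)"
      using N(3) by (intro pair_measureI sets.top)
  qed
qed

lemma lebI2_integral_snd:
  fixes f :: "real \<times> real \<Rightarrow> real"
  assumes "integrable (lebI2 a b c d) f"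
  shows "AE y in lebI c d. integrable (lebI a b) (\<lambda>x. f (x, y))"
    and "integrable (lebI c d) (\<lambda>y. \<integral>x. f (x, y) \<partial>lebI a b)"
    and "(\<integral>y. (\<integral>x. f (x, y) \<partial>lebI a b) \<partial>lebI c d) = (\<integral>p. f p \<partial>lebI2 a b c d)"
proof -
  have "integrable (lebI2 a b c d) (case_prod (\<lambda>x y. f (x, y)))" using assms by simp
  from lebI_pair.AE_integrable_snd[OF this] lebI_pair.integrable_snd[OF this] lebI_pair.integral_snd[OF this]
  show "AE y in lebI c d. integrable (lebI a b) (\<lambda>x. f (x, y))"
    "integrable (lebI c d) (\<lambda>y. \<integral>x. f (x, y) \<partial>lebI a b)"
    "(\<integral>y. (\<integral>x. f (x, y) \<partial>lebI a b) \<partial>lebI c d) = (\<integral>p. f p \<partial>lebI2 a b c d)"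
    by simp_all
qed

lemma integrable_lebI2_snd:
  fixes k :: "real \<Rightarrow> real"
  assumes "integrable (lebI c d) k"
  shows "integrable (lebI2 a b c d) (\<lambda>p. k (snd p))"
proof -
  have "integrable (lebI2 a b c d) (\<lambda>(x, y). 1 * k y)"
    by (rule integrable_lebI_prod[OF _ assms]) simp
  moreover have "(\<lambda>(x::real, y). 1 * k y) = (\<lambda>p. k (snd p))" by (simp add: fun_eq_iff)
  ultimately show ?thesis by (simp only:)
qed

lemma integral_prim_test1:
  assumes "a < b" "integrable (lebI a b) V" "test1 a b g"
  shows "(\<integral>x. prim a b V x * deriv g x \<partial>lebI a b) = - (\<integral>x. V x * g x \<partial>lebI a b)"
proof -
  note g = test1_deriv[OF assms(3)]
  have ac: "AC a b g (deriv g)" by (rule AC_C1[OF g(1,3)])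
  have "(\<integral>x. deriv g x \<partial>lebI a b) = 0"
    using AC_integral[OF ac] g(4,5) assms(1) by simp
  moreover have "(\<integral>x. V x * prim a b (deriv g) x \<partial>lebI a b) = (\<integral>x. V x * g x \<partial>lebI a b)"
  proof (rule Bochner_Integration.integral_cong[OF refl])
    fix x assume "x \<in> space (lebI a b)"
    then have "x \<in> {a..b}" by simp
    from AC_D(2)[OF ac this] g(4) show "V x * prim a b (deriv g) x = V x * g x" by simp
  qed
  ultimately show ?thesis
    using integral_prim_mult[OF assms(2) AC_D(1)[OF ac]] by simp
qed

text \<open>On almost every line the primitive is bounded by the L1 norm of its slice, a bound that
  depends on y only and is integrable.\<close>

lemma prim2_integrable:
  fixes v :: "real \<times> real \<Rightarrow> real"
  assumes v: "integrable (lebI2 a b c d) v"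
  shows "integrable (lebI2 a b c d) (\<lambda>p. prim a b (\<lambda>s. v (s, snd p)) (fst p))"
proof -
  let ?M = "lebI2 a b c d"
  have [measurable]: "v \<in> borel_measurable ?M" using v by auto
  have N: "integrable (lebI c d) (\<lambda>y. \<integral>x. \<bar>v (x, y)\<bar> \<partial>lebI a b)"
    by (rule lebI2_integral_snd(2)) (use v in simp)
  have "integrable ?M (\<lambda>p. \<integral>x. \<bar>v (x, snd p)\<bar> \<partial>lebI a b)"
    by (rule integrable_lebI2_snd[OF N])
  then show ?thesis
  proof (rule Bochner_Integration.integrable_bound)
    show "(\<lambda>p. prim a b (\<lambda>s. v (s, snd p)) (fst p)) \<in> borel_measurable ?M"
      unfolding prim_def by measurable
    have "AE p in ?M. integrable (lebI a b) (\<lambda>x. v (x, snd p))"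
      by (rule AE_lebI2_snd[OF lebI2_integral_snd(1)[OF v]])
    then show "AE p in ?M. norm (prim a b (\<lambda>s. v (s, snd p)) (fst p))
        \<le> norm (\<integral>x. \<bar>v (x, snd p)\<bar> \<partial>lebI a b)"
    proof eventually_elim
      case (elim p)
      from prim_bound[OF elim, of "fst p"] show ?case by simp
    qed
  qed
qed

text \<open>Subtracting the primitive of v leaves a function P whose weak derivative in x is 0. Such
  a P is orthogonal to u(x) h(y) whenever u has mean zero, because u is then the derivative of a
  test function. Reducing a general u to this case with a fixed \<xi> of integral 1 identifies P
  with a function of y.\<close>

lemma du_bois_reymond:
  fixes f v :: "real \<times> real \<Rightarrow> real"
  assumes ab: "a < b" "c < d" and f: "integrable (lebI2 a b c d) f" and v: "integrable (lebI2 a b c d) v"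
    and weak: "\<And>g h. test1 a b g \<Longrightarrow> test1 c d h \<Longrightarrow>
      (\<integral>p. f p * (deriv g (fst p) * h (snd p)) \<partial>lebI2 a b c d)
      = - (\<integral>p. v p * (g (fst p) * h (snd p)) \<partial>lebI2 a b c d)"
  obtains k where "integrable (lebI c d) k"
    "AE p in lebI2 a b c d. f p = k (snd p) + prim a b (\<lambda>s. v (s, snd p)) (fst p)"
proof -
  let ?M = "lebI2 a b c d"
  define V where "V = (\<lambda>p. prim a b (\<lambda>s. v (s, snd p)) (fst p))"
  have V: "integrable ?M V" unfolding V_def by (rule prim2_integrable[OF v])
  have weakV: "(\<integral>p. V p * (deriv g (fst p) * h (snd p)) \<partial>?M) = - (\<integral>p. v p * (g (fst p) * h (snd p)) \<partial>?M)"
    if g: "test1 a b g" and h: "test1 c d h" for g h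
  proof -
    note dg = test1_deriv[OF g] and dh = test1_deriv[OF h]
    have i1: "integrable ?M (\<lambda>p. V p * (deriv g (fst p) * h (snd p)))"
      by (rule integrable_mult_test1[OF V dg(3) dh(2)])
    have i2: "integrable ?M (\<lambda>p. v p * (g (fst p) * h (snd p)))"
      by (rule integrable_mult_test1[OF v dg(2) dh(2)])
    have "(\<integral>p. V p * (deriv g (fst p) * h (snd p)) \<partial>?M)
        = (\<integral>y. (\<integral>x. V (x, y) * (deriv g x * h y) \<partial>lebI a b) \<partial>lebI c d)"
      using lebI2_integral_snd(3)[OF i1] by simp
    also have "\<dots> = (\<integral>y. - (\<integral>x. v (x, y) * (g x * h y) \<partial>lebI a b) \<partial>lebI c d)"
    proof (rule integral_cong_AE)
      show "(\<lambda>y. \<integral>x. V (x, y) * (deriv g x * h y) \<partial>lebI a b) \<in> borel_measurable (lebI c d)"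
        using lebI2_integral_snd(2)[OF i1] by auto
      show "(\<lambda>y. - (\<integral>x. v (x, y) * (g x * h y) \<partial>lebI a b)) \<in> borel_measurable (lebI c d)"
        using lebI2_integral_snd(2)[OF i2] by auto
      show "AE y in lebI c d. (\<integral>x. V (x, y) * (deriv g x * h y) \<partial>lebI a b)
          = - (\<integral>x. v (x, y) * (g x * h y) \<partial>lebI a b)"
        using lebI2_integral_snd(1)[OF v]
      proof eventually_elim
        case (elim y)
        from integral_prim_test1[OF ab(1) elim g] show ?case
          by (simp add: V_def mult.assoc[symmetric])
      qed
    qed
    also have "\<dots> = - (\<integral>p. v p * (g (fst p) * h (snd p)) \<partial>?M)"
      using lebI2_integral_snd(3)[OF i2] by simp
    finally show ?thesis .
  qed
  define P where "P = (\<lambda>p. f p - V p)"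
  have P: "integrable ?M P" unfolding P_def using f V by simp
  have weakP: "(\<integral>p. P p * (u (fst p) * h (snd p)) \<partial>?M) = 0"
    if u: "test1 a b u" "(\<integral>x. u x \<partial>lebI a b) = 0" and h: "test1 c d h" for u h
  proof -
    obtain g where g: "test1 a b g" "\<forall>x. (g has_real_derivative u x) (at x)"
      using test1_antiderivative[OF ab(1) u] .
    then have "deriv g = u" by (auto intro: DERIV_imp_deriv)
    note dh = test1_deriv[OF h]
    have "(\<integral>p. P p * (u (fst p) * h (snd p)) \<partial>?M)
      = (\<integral>p. f p * (u (fst p) * h (snd p)) - V p * (u (fst p) * h (snd p)) \<partial>?M)"
      by (simp add: P_def left_diff_distrib)
    also have "\<dots> = 0"
      using weak[OF g(1) h] weakV[OF g(1) h]
        integrable_mult_test1[OF f test1_deriv(2)[OF u(1)] dh(2)]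
        integrable_mult_test1[OF V test1_deriv(2)[OF u(1)] dh(2)]
      by (simp add: \<open>deriv g = u\<close>)
    finally show ?thesis .
  qed
  \<comment> \<open>The integrals of the bumps tend to b - a > 0, so one of them is positive and can
    be normalized.\<close>
  obtain \<xi> where \<xi>: "test1 a b \<xi>" "(\<integral>x. \<xi> x \<partial>lebI a b) = 1"
  proof -
    define \<beta> where "\<beta> = (\<lambda>n. bump a b (Suc n))"
    have \<beta>: "test1 a b (\<beta> n)" for n unfolding \<beta>_def using ab by (intro test1_bump) auto
    have "(\<lambda>n. \<integral>x. \<beta> n x \<partial>lebI a b) \<longlonglongrightarrow> (\<integral>x. 1 \<partial>lebI a b)"
    proof (rule integral_dominated_convergence[where w="\<lambda>_. 1"])
      show "\<beta> n \<in> borel_measurable (lebI a b)" for n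
        by (rule continuous_measurable_lebI[OF test1_deriv(2)[OF \<beta>]])
      show "AE x in lebI a b. (\<lambda>n. \<beta> n x) \<longlonglongrightarrow> 1"
      proof (rule AE_I2)
        fix x assume "x \<in> space (lebI a b)"
        then show "(\<lambda>n. \<beta> n x) \<longlonglongrightarrow> 1"
          using LIMSEQ_Suc[OF bump_tendsto[of a b x]] by (simp add: \<beta>_def)
      qed
    qed (auto simp: \<beta>_def bump_bounds)
    moreover have "(\<integral>x. 1 \<partial>lebI a b) = b - a"
      using AC_integral[OF AC_C1[of a b "\<lambda>x. x" "\<lambda>_. 1"]] ab by simp
    ultimately have "\<forall>\<^sub>F n in sequentially. (\<integral>x. \<beta> n x \<partial>lebI a b) > 0"
      using ab by (intro order_tendstoD(1)[where y="b - a"]) auto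
    then obtain n where n: "(\<integral>x. \<beta> n x \<partial>lebI a b) > 0"
      by (auto simp: eventually_sequentially)
    define r where "r = 1 / (\<integral>x. \<beta> n x \<partial>lebI a b)"
    have "Ck k (\<lambda>x. r * \<beta> n x)" for k
      using \<beta>[of n] unfolding test1_def Ck_on_UNIV[symmetric] by (intro Ck_on_mult Ck_on_const) auto
    then have "test1 a b (\<lambda>x. r * \<beta> n x)"
      using \<beta>[of n] by (fastforce simp: test1_def)
    moreover have "(\<integral>x. r * \<beta> n x \<partial>lebI a b) = 1"
      using n by (simp add: r_def)
    ultimately show ?thesis by (rule that)
  qed
  note d\<xi> = test1_deriv[OF \<xi>(1)]
  \<comment> \<open>If P depends on y alone, its average against \<xi> must be that function; so
    there is no other candidate.\<close>
  define k where "k = (\<lambda>y. \<integral>x. P (x, y) * (\<xi> x * 1) \<partial>lebI a b)"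
  have P\<xi>: "integrable ?M (\<lambda>p. P p * (\<xi> (fst p) * 1))"
    by (rule integrable_mult_test1[OF P d\<xi>(2), of "\<lambda>_. 1"]) simp
  have k: "integrable (lebI c d) k"
    using lebI2_integral_snd(2)[OF P\<xi>] by (simp add: k_def)
  have k2: "integrable ?M (\<lambda>p. k (snd p))"
    by (rule integrable_lebI2_snd[OF k])
  have "AE p in ?M. P p - k (snd p) = 0"
  proof (rule fundamental_lemma[OF ab])
    show "integrable ?M (\<lambda>p. P p - k (snd p))" using P k2 by simp
    fix u h assume u: "test1 a b u" and h: "test1 c d h"
    note du = test1_deriv[OF u] and dh = test1_deriv[OF h]
    define r where "r = (\<integral>x. u x \<partial>lebI a b)"
    have iu: "integrable (lebI a b) u" and i\<xi>: "integrable (lebI a b) \<xi>"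
      by (rule continuous_integrable_lebI, rule du d\<xi>)+
    have "test1 a b (\<lambda>x. u x + (- r) * \<xi> x)"
    proof -
      obtain a1 b1 where 1: "a < a1" "a1 \<le> b1" "b1 < b" "\<forall>x. x \<notin> {a1..b1} \<longrightarrow> u x = 0"
        using u by (auto simp: test1_def)
      obtain a2 b2 where 2: "a < a2" "a2 \<le> b2" "b2 < b" "\<forall>x. x \<notin> {a2..b2} \<longrightarrow> \<xi> x = 0"
        using \<xi> by (auto simp: test1_def)
      have "Ck n (\<lambda>x. u x + (- r) * \<xi> x)" for n
        using u \<xi>(1) unfolding test1_def Ck_on_UNIV[symmetric]
        by (intro Ck_on_add Ck_on_mult Ck_on_const) auto
      moreover have "a < min a1 a2 \<and> min a1 a2 \<le> max b1 b2 \<and> max b1 b2 < b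
          \<and> (\<forall>x. x \<notin> {min a1 a2..max b1 b2} \<longrightarrow> u x + (- r) * \<xi> x = 0)"
      proof (intro conjI allI impI)
        fix x assume "x \<notin> {min a1 a2..max b1 b2}"
        then have "x \<notin> {a1..b1}" "x \<notin> {a2..b2}" by auto
        with 1(4) 2(4) show "u x + (- r) * \<xi> x = 0" by simp
      qed (use 1 2 in auto)
      ultimately show ?thesis unfolding test1_def by blast
    qed
    moreover have "(\<integral>x. u x + (- r) * \<xi> x \<partial>lebI a b) = 0"
      using iu i\<xi> \<xi>(2) by (simp add: r_def)
    ultimately have "0 = (\<integral>p. P p * ((u (fst p) + (- r) * \<xi> (fst p)) * h (snd p)) \<partial>?M)"
      using weakP[OF _ _ h] by simp
    also have "\<dots> = (\<integral>p. P p * (u (fst p) * h (snd p)) - r * (P p * (\<xi> (fst p) * h (snd p))) \<partial>?M)"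
      by (rule Bochner_Integration.integral_cong[OF refl]) (simp add: algebra_simps)
    also have "\<dots> = (\<integral>p. P p * (u (fst p) * h (snd p)) \<partial>?M)
        - r * (\<integral>p. P p * (\<xi> (fst p) * h (snd p)) \<partial>?M)"
      using integrable_mult_test1[OF P du(2) dh(2)] integrable_mult_test1[OF P d\<xi>(2) dh(2)] by simp
    also have "(\<integral>p. P p * (\<xi> (fst p) * h (snd p)) \<partial>?M) = (\<integral>y. k y * h y \<partial>lebI c d)"
      using lebI2_integral_snd(3)[OF integrable_mult_test1[OF P d\<xi>(2) dh(2)]]
      by (simp add: k_def mult.assoc[symmetric])
    also have "r * (\<integral>y. k y * h y \<partial>lebI c d) = (\<integral>y. (\<integral>x. k y * (u x * h y) \<partial>lebI a b) \<partial>lebI c d)"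
    proof -
      have inner: "(\<integral>x. k y * (u x * h y) \<partial>lebI a b) = r * (k y * h y)" for y
      proof -
        have "(\<integral>x. k y * (u x * h y) \<partial>lebI a b) = (\<integral>x. u x * (k y * h y) \<partial>lebI a b)"
          by (simp only: ac_simps)
        then show ?thesis by (simp add: r_def)
      qed
      show ?thesis by (simp only: inner) simp
    qed
    also have "\<dots> = (\<integral>p. k (snd p) * (u (fst p) * h (snd p)) \<partial>?M)"
      using lebI2_integral_snd(3)[OF integrable_mult_test1[OF k2 du(2) dh(2)]] by simp
    finally have "0 = (\<integral>p. P p * (u (fst p) * h (snd p)) \<partial>?M)
        - (\<integral>p. k (snd p) * (u (fst p) * h (snd p)) \<partial>?M)" .
    then show "(\<integral>p. (P p - k (snd p)) * (u (fst p) * h (snd p)) \<partial>?M) = 0"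
      using integrable_mult_test1[OF P du(2) dh(2)] integrable_mult_test1[OF k2 du(2) dh(2)]
      by (simp add: left_diff_distrib)
  qed
  then have "AE p in ?M. f p = k (snd p) + prim a b (\<lambda>s. v (s, snd p)) (fst p)"
    by eventually_elim (simp add: P_def V_def)
  with k show ?thesis by (rule that)
qed

section \<open>Spherical coordinates\<close>

text \<open>The map \<open>sph\<close> after the substitution c = cos \<phi>; the square root is sin
  \<phi>, which is nonnegative for \<phi> in [0, pi].\<close>

definition sphc :: "real \<Rightarrow> real \<Rightarrow> real \<Rightarrow> real ^ 3" where
  "sphc r c t = vector [r * sqrt (1 - c\<^sup>2) * cos t, r * sqrt (1 - c\<^sup>2) * sin t, r * c]"

lemma sphc_eq_sph: "\<bar>c\<bar> \<le> 1 \<Longrightarrow> sphc r c t = sph r (arccos c) t"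
  by (simp add: sphc_def sph_def sin_arccos_abs cos_arccos_abs)

lemma norm_vec3: "(norm (x :: real ^ 3))\<^sup>2 = (x $ 1)\<^sup>2 + (x $ 2)\<^sup>2 + (x $ 3)\<^sup>2"
  by (simp add: norm_vec_def L2_set_def sum_3)

lemma sphc_coordinates:
  assumes "0 < r" "\<bar>c\<bar> < 1" "0 \<le> t" "t < 2 * pi"
  shows "rho (sphc r c t) = r" "phi (sphc r c t) = arccos c" "theta (sphc r c t) = t"
proof -
  have c: "c\<^sup>2 < 1" using assms by (simp add: abs_square_less_1)
  then have q: "(sqrt (1 - c\<^sup>2))\<^sup>2 = 1 - c\<^sup>2" "sqrt (1 - c\<^sup>2) > 0" by simp_all
  have "(norm (sphc r c t))\<^sup>2 = r\<^sup>2 * (sqrt (1 - c\<^sup>2))\<^sup>2 * ((cos t)\<^sup>2 + (sin t)\<^sup>2) + r\<^sup>2 * c\<^sup>2"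
    unfolding norm_vec3 sphc_def vector_3 by algebra
  also have "\<dots> = r\<^sup>2" unfolding q by (simp add: algebra_simps)
  finally show n: "rho (sphc r c t) = r"
    using assms(1) by (simp add: rho_def)
  show "phi (sphc r c t) = arccos c"
    using assms(1) n by (simp add: phi_def rho_def) (simp add: sphc_def)
  have "of_real (r * sqrt (1 - c\<^sup>2)) * exp (\<i> * of_real t)
      = Complex (sphc r c t $ 1) (sphc r c t $ 2)"
    by (simp add: sphc_def complex_eq_iff Re_exp Im_exp)
  then show "theta (sphc r c t) = t"
    unfolding theta_def using assms q by (intro Arg2pi_unique[of "r * sqrt (1 - c\<^sup>2)"]) auto
qed

lemma measurable_vector3:
  assumes [measurable]: "f \<in> borel_measurable M" "g \<in> borel_measurable M" "h \<in> borel_measurable M"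
  shows "(\<lambda>x. vector [f x, g x, h x] :: real ^ 3) \<in> borel_measurable M"
  unfolding vector_3_axis by measurable

lemma sphc_measurable [measurable]:
  assumes [measurable]: "f \<in> borel_measurable M" "g \<in> borel_measurable M" "h \<in> borel_measurable M"
  shows "(\<lambda>x. sphc (f x) (g x) (h x)) \<in> borel_measurable M"
  unfolding sphc_def by (intro measurable_vector3) measurable

section \<open>Lebesgue measure on R^3 as an iterated integral, and the Jacobian\<close>

lemma Basis_real3: "(Basis :: (real ^ 3) set) = {axis 1 1, axis 2 1, axis 3 1}"
  by (auto simp: Basis_vec_def) (metis exhaust_3)

text \<open>A bridge between \<open>real ^ 3\<close>, where the change of variables theorem lives,
  and pair measures, where Fubini is used. Agreement on boxes characterizes Lebesgue
  measure.\<close>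

lemma lborel_vec3:
  "(lborel :: (real ^ 3) measure)
    = distr (lborel \<Otimes>\<^sub>M (lborel \<Otimes>\<^sub>M lborel)) borel (\<lambda>(r, c, t). vector [r, c, t])"
proof (rule lborel_eqI)
  fix l u :: "real ^ 3" assume le: "\<And>b. b \<in> Basis \<Longrightarrow> l \<bullet> b \<le> u \<bullet> b"
  have le': "l $ 1 \<le> u $ 1" "l $ 2 \<le> u $ 2" "l $ 3 \<le> u $ 3"
    using le[of "axis 1 1"] le[of "axis 2 1"] le[of "axis 3 1"] by (simp_all add: Basis_real3 inner_axis)
  have m: "(\<lambda>(r, c, t). vector [r, c, t] :: real ^ 3)
      \<in> borel_measurable (lborel \<Otimes>\<^sub>M (lborel \<Otimes>\<^sub>M lborel))"
    unfolding case_prod_beta by (intro measurable_vector3) measurable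
  have "(\<lambda>(r, c, t). vector [r, c, t] :: real ^ 3) -` box l u
        \<inter> space (lborel \<Otimes>\<^sub>M (lborel \<Otimes>\<^sub>M lborel))
      = {l $ 1<..<u $ 1} \<times> ({l $ 2<..<u $ 2} \<times> {l $ 3<..<u $ 3})"
    by (auto simp: space_pair_measure mem_box_cart forall_3)
  then have "emeasure (distr (lborel \<Otimes>\<^sub>M (lborel \<Otimes>\<^sub>M lborel)) borel
        (\<lambda>(r, c, t). vector [r, c, t] :: real ^ 3)) (box l u)
      = emeasure lborel {l $ 1<..<u $ 1}
        * (emeasure lborel {l $ 2<..<u $ 2} * emeasure lborel {l $ 3<..<u $ 3})"
    by (subst emeasure_distr[OF m])
       (simp_all add: lborel.emeasure_pair_measure_Times lborel_pair.sigma_finite_measure_axioms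
          sigma_finite_measure.emeasure_pair_measure_Times)
  also have "\<dots> = ennreal ((u $ 1 - l $ 1) * ((u $ 2 - l $ 2) * (u $ 3 - l $ 3)))"
    using le' by (simp add: ennreal_mult)
  also have "(u $ 1 - l $ 1) * ((u $ 2 - l $ 2) * (u $ 3 - l $ 3)) = (\<Prod>b\<in>Basis. (u - l) \<bullet> b)"
    unfolding Basis_real3 by (simp add: axis_eq_axis inner_axis)
  finally show "emeasure (distr (lborel \<Otimes>\<^sub>M (lborel \<Otimes>\<^sub>M lborel)) borel
        (\<lambda>(r, c, t). vector [r, c, t] :: real ^ 3)) (box l u) = (\<Prod>b\<in>Basis. (u - l) \<bullet> b)" .
qed simp

lemma nn_integral_lborel_vec3:
  fixes F :: "real ^ 3 \<Rightarrow> ennreal"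
  assumes [measurable]: "F \<in> borel_measurable borel"
  shows "(\<integral>\<^sup>+v. F v \<partial>lborel) = (\<integral>\<^sup>+r. \<integral>\<^sup>+c. \<integral>\<^sup>+t. F (vector [r, c, t]) \<partial>lborel \<partial>lborel \<partial>lborel)"
proof -
  have m: "(\<lambda>(r, c, t). vector [r, c, t] :: real ^ 3)
      \<in> borel_measurable (lborel \<Otimes>\<^sub>M (lborel \<Otimes>\<^sub>M lborel))"
    unfolding case_prod_beta by (intro measurable_vector3) measurable
  have m2: "(\<lambda>p. F (vector [r, fst p, snd p])) \<in> borel_measurable (lborel \<Otimes>\<^sub>M lborel)" for r
    by (rule measurable_compose[OF measurable_vector3 assms]) measurable
  have "(\<integral>\<^sup>+v. F v \<partial>lborel) = (\<integral>\<^sup>+p. F (case p of (r, c, t) \<Rightarrow> vector [r, c, t])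
      \<partial>(lborel \<Otimes>\<^sub>M (lborel \<Otimes>\<^sub>M lborel)))"
    by (subst lborel_vec3) (simp add: nn_integral_distr[OF m])
  also have "\<dots> = (\<integral>\<^sup>+r. \<integral>\<^sup>+p. F (case p of (c, t) \<Rightarrow> vector [r, c, t]) \<partial>(lborel \<Otimes>\<^sub>M lborel) \<partial>lborel)"
    using sigma_finite_measure.nn_integral_fst[OF lborel_pair.sigma_finite_measure_axioms
        measurable_compose[OF m assms]] by simp
  also have "\<dots> = (\<integral>\<^sup>+r. \<integral>\<^sup>+c. \<integral>\<^sup>+t. F (vector [r, c, t]) \<partial>lborel \<partial>lborel \<partial>lborel)"
    using lborel.nn_integral_fst[OF m2] by (simp add: case_prod_beta)
  finally show ?thesis .
qed

text \<open>The sign is negative because c decreases as \<phi> grows. The sine in the usual Jacobian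
  is cancelled by dc = - sin \<phi> d\<phi>.\<close>

lemma sphc_jacobian:
  fixes v :: "real ^ 3"
  assumes "\<bar>v $ 2\<bar> < 1"
  obtains J :: "real ^ 3 ^ 3" where
    "((\<lambda>v. sphc (v $ 1) (v $ 2) (v $ 3)) has_derivative (\<lambda>h. J *v h)) (at v within S)"
    "det J = - ((v $ 1)\<^sup>2)"
proof -
  define r c t where "r = v $ 1" and "c = v $ 2" and "t = v $ 3"
  define q where "q = sqrt (1 - c\<^sup>2)"
  have c1: "1 - c\<^sup>2 > 0" using assms by (simp add: c_def abs_square_less_1)
  have q: "q > 0" "q\<^sup>2 = 1 - c\<^sup>2" using c1 by (simp_all add: q_def)
  define J :: "real ^ 3 ^ 3" where
    "J = vector [vector [q * cos t, - (r * c / q * cos t), - (r * q * sin t)],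
                 vector [q * sin t, - (r * c / q * sin t), r * q * cos t], vector [c, r, 0]]"
  have nth: "((\<lambda>v. v $ i) has_derivative (\<lambda>h. h $ i)) (at v within S)" for i :: 3
    by (rule bounded_linear_imp_has_derivative[OF bounded_linear_vec_nth])
  have sq: "((\<lambda>v. sqrt (1 - (v $ 2)\<^sup>2)) has_derivative (\<lambda>h. - (c / q) * h $ 2)) (at v within S)"
    using c1 by (auto intro!: derivative_eq_intros nth simp: q_def c_def field_simps)
  have cs: "((\<lambda>v. cos (v $ 3)) has_derivative (\<lambda>h. - (sin t) * h $ 3)) (at v within S)"
    by (auto intro!: derivative_eq_intros nth simp: t_def)
  have sn: "((\<lambda>v. sin (v $ 3)) has_derivative (\<lambda>h. cos t * h $ 3)) (at v within S)"
    by (auto intro!: derivative_eq_intros nth simp: t_def)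
  note d = has_derivative_add[OF has_derivative_add[OF
      has_derivative_scaleR_left[OF has_derivative_mult[OF has_derivative_mult[OF nth[of 1] sq] cs], of "axis 1 1 :: real ^ 3"]
      has_derivative_scaleR_left[OF has_derivative_mult[OF has_derivative_mult[OF nth[of 1] sq] sn], of "axis 2 1 :: real ^ 3"]]
      has_derivative_scaleR_left[OF has_derivative_mult[OF nth[of 1] nth[of 2]], of "axis 3 1 :: real ^ 3"]]
  have "((\<lambda>v. sphc (v $ 1) (v $ 2) (v $ 3)) has_derivative (\<lambda>h. J *v h)) (at v within S)"
    unfolding sphc_def vector_3_axis
    by (rule has_derivative_eq_rhs[OF d])
       (simp add: fun_eq_iff vec_eq_iff forall_3 J_def matrix_vector_mult_def sum_3 axis_def
          q_def r_def c_def t_def algebra_simps)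
  moreover have "det J = - (r\<^sup>2)"
  proof -
    define C D where "C = cos t" and "D = sin t"
    have CD: "D\<^sup>2 + C\<^sup>2 = 1" by (simp add: C_def D_def)
    have "det J = - (r\<^sup>2 * c\<^sup>2 * (D\<^sup>2 + C\<^sup>2)) - r\<^sup>2 * q\<^sup>2 * (D\<^sup>2 + C\<^sup>2)"
      unfolding det_3 J_def C_def[symmetric] D_def[symmetric] using q(1)
      by (simp add: field_simps power2_eq_square)
    also have "\<dots> = - (r\<^sup>2)" unfolding CD q(2) by (simp add: algebra_simps)
    finally show ?thesis .
  qed
  ultimately show ?thesis using that by (simp add: r_def)
qed


section \<open>The domain and its volume element\<close>

locale spherical_domain =
  fixes m :: int and \<alpha> :: real
  assumes m: "1 \<le> m" and \<alpha>: "0 < \<alpha>" "\<alpha> \<le> pi / 6"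
begin

abbreviation Dm :: "(real ^ 3) set" where
  "Dm \<equiv> Dom m \<alpha>"

text \<open>The cosine reverses both angular inequalities, and they merge into |cos \<phi>| < sin
  \<alpha>. In this form, free of \<open>arccos\<close>, openness of the domain is
  immediate.\<close>

lemma Dom_eq: "Dm = {x. 1 / m < norm x \<and> norm x < 1 \<and> \<bar>x $ 3\<bar> < sin \<alpha> * norm x}"
proof -
  have "pi / 2 - \<alpha> < phi x \<and> phi x < pi / 2 + \<alpha> \<longleftrightarrow> \<bar>x $ 3\<bar> < sin \<alpha> * norm x"
    if x: "1 / m < norm x" for x :: "real ^ 3"
  proof -
    have "0 \<le> 1 / real_of_int m" using m by simp
    then have n: "norm x > 0" using x by linarith
    define c where "c = x $ 3 / norm x"
    have c: "-1 \<le> c" "c \<le> 1"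
      using component_le_norm_cart[of x 3] n by (auto simp: c_def abs_le_iff field_simps)
    note ac = arccos_lbound[OF c] arccos_ubound[OF c] cos_arccos[OF c]
    have "pi / 2 - \<alpha> < arccos c \<longleftrightarrow> cos (arccos c) < cos (pi / 2 - \<alpha>)"
      using ac \<alpha> pi_gt_zero by (intro cos_mono_less_eq[symmetric]) auto
    moreover have "arccos c < pi / 2 + \<alpha> \<longleftrightarrow> cos (pi / 2 + \<alpha>) < cos (arccos c)"
      using ac \<alpha> pi_gt_zero by (intro cos_mono_less_eq[symmetric]) auto
    moreover have "cos (pi / 2 - \<alpha>) = sin \<alpha>" "cos (pi / 2 + \<alpha>) = - sin \<alpha>"
      by (simp_all add: cos_diff cos_add)
    ultimately have "pi / 2 - \<alpha> < phi x \<and> phi x < pi / 2 + \<alpha> \<longleftrightarrow> \<bar>c\<bar> < sin \<alpha>"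
      using ac(3) by (auto simp: phi_def c_def[symmetric] abs_less_iff)
    also have "\<dots> \<longleftrightarrow> \<bar>x $ 3\<bar> < sin \<alpha> * norm x"
      using n by (simp add: c_def abs_divide divide_less_eq)
    finally show ?thesis .
  qed
  then show ?thesis by (auto simp: Dom_def rho_def)
qed

lemma sin_alpha_bounds: "0 < sin \<alpha>" "sin \<alpha> \<le> 1 / 2"
proof -
  show "0 < sin \<alpha>" using \<alpha> pi_gt_zero by (intro sin_gt_zero) auto
  have "sin \<alpha> \<le> sin (pi / 6)" using \<alpha> pi_gt_zero by (subst sin_mono_le_eq) auto
  then show "sin \<alpha> \<le> 1 / 2" by (simp add: sin_30)
qed

lemma open_Dom: "open Dm"
  unfolding Dom_eq by (intro open_Collect_conj open_Collect_less continuous_intros)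

text \<open>The azimuth runs over the half-open interval, so that the parametrization is a bijection
  onto the domain and reaches the half-plane \<theta> = 0.\<close>

definition sbox :: "(real ^ 3) set" where
  "sbox = {v. 1 / m < v $ 1 \<and> v $ 1 < 1 \<and> - sin \<alpha> < v $ 2 \<and> v $ 2 < sin \<alpha> \<and> 0 \<le> v $ 3 \<and> v $ 3 < 2 * pi}"

lemma sbox_D:
  assumes "v \<in> sbox"
  shows "0 < v $ 1" "\<bar>v $ 2\<bar> < 1" "0 \<le> v $ 3" "v $ 3 < 2 * pi"
proof -
  have "0 \<le> 1 / real_of_int m" using m by simp
  moreover have "1 / m < v $ 1" using assms unfolding sbox_def by blast
  ultimately show "0 < v $ 1" by linarith
  show "\<bar>v $ 2\<bar> < 1" using assms sin_alpha_bounds unfolding sbox_def by auto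
qed (use assms in \<open>auto simp: sbox_def\<close>)

lemma sphc_Dom:
  assumes "1 / m < r" "r < 1" "\<bar>c\<bar> < sin \<alpha>"
  shows "sphc r c t \<in> Dm"
proof -
  have "0 \<le> 1 / real_of_int m" using m by simp
  then have r: "r > 0" using assms by linarith
  have c: "\<bar>c\<bar> < 1" using assms(3) sin_alpha_bounds by linarith
  then have q: "(sqrt (1 - c\<^sup>2))\<^sup>2 = 1 - c\<^sup>2" by (simp add: abs_square_less_1 less_imp_le)
  have "(norm (sphc r c t))\<^sup>2 = r\<^sup>2 * (sqrt (1 - c\<^sup>2))\<^sup>2 * ((cos t)\<^sup>2 + (sin t)\<^sup>2) + r\<^sup>2 * c\<^sup>2"
    unfolding norm_vec3 sphc_def vector_3 by algebra
  also have "\<dots> = r\<^sup>2" unfolding q by (simp add: algebra_simps)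
  finally have n: "norm (sphc r c t) = r" using r by simp
  have "sphc r c t $ 3 = r * c" by (simp add: sphc_def)
  then show ?thesis
    unfolding Dom_eq using n r assms by (simp add: abs_mult mult.commute)
qed

lemma sphc_image: "(\<lambda>v. sphc (v $ 1) (v $ 2) (v $ 3)) ` sbox = Dm"
proof (intro equalityI subsetI)
  fix x assume "x \<in> (\<lambda>v. sphc (v $ 1) (v $ 2) (v $ 3)) ` sbox"
  then show "x \<in> Dm" by (auto simp: sbox_def intro!: sphc_Dom)
next
  fix x assume x: "x \<in> Dm"
  have "0 \<le> 1 / real_of_int m" using m by simp
  moreover have "1 / m < norm x" using x unfolding Dom_eq by blast
  ultimately have n: "norm x > 0" by linarith
  then have x0: "x \<noteq> 0" by auto
  have c: "\<bar>x $ 3 / norm x\<bar> < sin \<alpha>"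
    using x n unfolding Dom_eq by (simp add: abs_divide divide_less_eq)
  then have c1: "\<bar>x $ 3 / norm x\<bar> \<le> 1" using sin_alpha_bounds by linarith
  define v :: "real ^ 3" where "v = vector [rho x, x $ 3 / norm x, theta x]"
  have "sphc (v $ 1) (v $ 2) (v $ 3) = sph (rho x) (phi x) (theta x)"
    using sphc_eq_sph[OF c1, of "rho x" "theta x"] by (simp add: v_def phi_def)
  also have "\<dots> = x" by (rule sph_coords[OF x0])
  finally have "x = sphc (v $ 1) (v $ 2) (v $ 3)" by simp
  moreover have "- sin \<alpha> < x $ 3 / norm x" "x $ 3 / norm x < sin \<alpha>"
    using c by linarith+
  then have "v \<in> sbox"
    using x Arg2pi_ge_0 Arg2pi_lt_2pi unfolding Dom_eq
    by (simp add: v_def sbox_def rho_def theta_def)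
  ultimately show "x \<in> (\<lambda>v. sphc (v $ 1) (v $ 2) (v $ 3)) ` sbox" by blast
qed

lemma sphc_inj: "inj_on (\<lambda>v. sphc (v $ 1) (v $ 2) (v $ 3)) sbox"
proof (rule inj_onI)
  fix v w assume v: "v \<in> sbox" and w: "w \<in> sbox"
    and e: "sphc (v $ 1) (v $ 2) (v $ 3) = sphc (w $ 1) (w $ 2) (w $ 3)"
  note cv = sphc_coordinates[OF sbox_D[OF v]] and cw = sphc_coordinates[OF sbox_D[OF w]]
  have "cos (arccos (v $ 2)) = cos (arccos (w $ 2))" using cv(2) cw(2) e by simp
  then have "v $ 2 = w $ 2" using sbox_D(2)[OF v] sbox_D(2)[OF w] by (simp add: cos_arccos_abs)
  moreover have "v $ 1 = w $ 1" "v $ 3 = w $ 3" using cv cw e by simp_all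
  ultimately show "v = w" by (simp add: vec_eq_iff forall_3)
qed

text \<open>The change of variables theorem is used only for the measure of an injective image,
  where boundedness settles all integrability. Integrals of functions follow later from an equality
  of measures.\<close>

lemma emeasure_Dom:
  assumes X[measurable]: "X \<in> sets borel"
  shows "emeasure lborel (Dm \<inter> X)
    = (\<integral>\<^sup>+v. ennreal ((v $ 1)\<^sup>2) * indicator {v\<in>sbox. sphc (v $ 1) (v $ 2) (v $ 3) \<in> X} v \<partial>lborel)"
proof -
  define F where "F = (\<lambda>v::real ^ 3. sphc (v $ 1) (v $ 2) (v $ 3))"
  define S where "S = {v\<in>sbox. F v \<in> X}"
  have nth[measurable]: "(\<lambda>v::real ^ 3. v $ i) \<in> borel_measurable borel" for i
    by (intro borel_measurable_continuous_onI continuous_intros)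
  have F[measurable]: "F \<in> borel_measurable borel" unfolding F_def by measurable
  have sb: "sbox \<in> sets borel" unfolding sbox_def by measurable
  have S[measurable]: "S \<in> sets borel"
  proof -
    have "S = sbox \<inter> (F -` X \<inter> space borel)" by (auto simp: S_def)
    also have "\<dots> \<in> sets borel" using sb measurable_sets[OF F X] by blast
    finally show ?thesis .
  qed
  have "S \<subseteq> cbox (vector [0, -1, 0]) (vector [1, 1, 2 * pi])"
  proof
    fix v assume "v \<in> S"
    then have v: "v \<in> sbox" by (simp add: S_def)
    have "v $ 1 < 1" using v by (simp add: sbox_def)
    with sbox_D[OF v] show "v \<in> cbox (vector [0, -1, 0]) (vector [1, 1, 2 * pi])"
      by (simp add: mem_box_cart forall_3 abs_less_iff)
  qed
  then have "bounded S" by (rule bounded_subset[OF bounded_cbox])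
  then have Sfin: "emeasure lborel S < \<infinity>" by (rule emeasure_bounded_finite)
  have int: "integrable lborel (\<lambda>v. indicator S v *\<^sub>R (v $ 1)\<^sup>2)"
  proof (rule integrableI_bounded_set_indicator[where B=1])
    show "AE v in lborel. v \<in> S \<longrightarrow> norm ((v $ 1)\<^sup>2) \<le> 1"
    proof (intro AE_I2 impI)
      fix v assume "v \<in> S"
      then have v: "v \<in> sbox" by (simp add: S_def)
      have "v $ 1 < 1" using v by (simp add: sbox_def)
      with sbox_D(1)[OF v] show "norm ((v $ 1)\<^sup>2) \<le> 1" by (simp add: power_le_one)
    qed
  qed (use S Sfin in auto)
  have "\<forall>v\<in>S. \<exists>J :: real ^ 3 ^ 3. (F has_derivative (\<lambda>h. J *v h)) (at v within S) \<and> det J = - ((v $ 1)\<^sup>2)"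
  proof
    fix v assume "v \<in> S"
    then have "\<bar>v $ 2\<bar> < 1" using sbox_D(2) by (auto simp: S_def)
    then obtain J :: "real ^ 3 ^ 3" where
      "((\<lambda>v. sphc (v $ 1) (v $ 2) (v $ 3)) has_derivative (\<lambda>h. J *v h)) (at v within S)"
      "det J = - ((v $ 1)\<^sup>2)"
      by (rule sphc_jacobian)
    then show "\<exists>J :: real ^ 3 ^ 3. (F has_derivative (\<lambda>h. J *v h)) (at v within S) \<and> det J = - ((v $ 1)\<^sup>2)"
      unfolding F_def by blast
  qed
  then obtain J :: "real ^ 3 \<Rightarrow> real ^ 3 ^ 3" where
    J: "\<forall>v\<in>S. (F has_derivative (\<lambda>h. J v *v h)) (at v within S) \<and> det (J v) = - ((v $ 1)\<^sup>2)"
    using bchoice by meson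
  have det: "\<bar>det (matrix (\<lambda>h. J v *v h))\<bar> = (v $ 1)\<^sup>2" if "v \<in> S" for v
    using J that by (simp add: matrix_of_matrix_vector_mul)
  have hi: "((\<lambda>v. (v $ 1)\<^sup>2) has_integral (\<integral>v. indicator S v *\<^sub>R (v $ 1)\<^sup>2 \<partial>lborel)) S"
  proof -
    have "(\<lambda>v. indicator S v *\<^sub>R (v $ 1)\<^sup>2) = (\<lambda>v. if v \<in> S then (v $ 1)\<^sup>2 else 0)"
      by (auto simp: fun_eq_iff)
    with has_integral_integral_lborel[OF int] show ?thesis
      by (simp only: has_integral_restrict_UNIV)
  qed
  then have hi': "((\<lambda>v. \<bar>det (matrix (\<lambda>h. J v *v h))\<bar>) has_integral (\<integral>v. indicator S v *\<^sub>R (v $ 1)\<^sup>2 \<partial>lborel)) S"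
    by (rule has_integral_eq[rotated]) (rule det[symmetric])
  have "measure lebesgue (F ` S) = integral S (\<lambda>v. \<bar>det (matrix (\<lambda>h. J v *v h))\<bar>)"
  proof (rule measure_differentiable_image_eq)
    show "inj_on F S"
      using sphc_inj unfolding F_def by (rule inj_on_subset) (auto simp: S_def)
  qed (use J hi' S in \<open>auto simp: integrable_on_def\<close>)
  also have "\<dots> = (\<integral>v. indicator S v *\<^sub>R (v $ 1)\<^sup>2 \<partial>lborel)"
    using hi' by (rule integral_unique)
  also have "F ` S = Dm \<inter> X"
    using sphc_image unfolding F_def S_def by auto
  finally have me: "measure lebesgue (Dm \<inter> X) = (\<integral>v. indicator S v *\<^sub>R (v $ 1)\<^sup>2 \<partial>lborel)" .
  have DX: "Dm \<inter> X \<in> sets borel" using open_Dom by auto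
  have "bounded (Dm \<inter> X)"
    by (rule bounded_subset[of "ball 0 1"]) (auto simp: Dom_eq)
  then have "emeasure lborel (Dm \<inter> X) < \<infinity>" by (rule emeasure_bounded_finite)
  then have "emeasure lborel (Dm \<inter> X) = ennreal (measure lborel (Dm \<inter> X))"
    by (intro emeasure_eq_ennreal_measure) auto
  also have "measure lborel (Dm \<inter> X) = measure lebesgue (Dm \<inter> X)"
    using DX by (simp add: measure_completion)
  also have "ennreal \<dots> = (\<integral>\<^sup>+v. ennreal (indicator S v *\<^sub>R (v $ 1)\<^sup>2) \<partial>lborel)"
    unfolding me by (rule nn_integral_eq_integral[symmetric, OF int]) (auto simp: indicator_def)
  also have "\<dots> = (\<integral>\<^sup>+v. ennreal ((v $ 1)\<^sup>2) * indicator S v \<partial>lborel)"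
    by (intro nn_integral_cong) (auto simp: indicator_def)
  finally show ?thesis unfolding S_def F_def .
qed

lemma spherical_measure:
  "density lborel (indicator Dm)
    = distr (density ((lebI (1 / m) 1 \<Otimes>\<^sub>M lebI (- sin \<alpha>) (sin \<alpha>)) \<Otimes>\<^sub>M lebI 0 (2 * pi))
        (\<lambda>p. ennreal ((fst (fst p))\<^sup>2))) borel (\<lambda>p. sphc (fst (fst p)) (snd (fst p)) (snd p))"
proof (rule measure_eqI)
  fix X assume "X \<in> sets (density lborel (indicator Dm))"
  then have X[measurable]: "X \<in> sets borel" by simp
  let ?A = "{1 / m<..<1} :: real set" and ?B = "{- sin \<alpha><..<sin \<alpha>}" and ?T = "{0<..<2 * pi}"
  let ?L2 = "lebI (1 / m) 1 \<Otimes>\<^sub>M lebI (- sin \<alpha>) (sin \<alpha>)"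
  let ?L3 = "?L2 \<Otimes>\<^sub>M lebI 0 (2 * pi)"
  have [measurable]: "(\<lambda>p. fst (fst p)) \<in> borel_measurable ?L3" "(\<lambda>p. snd (fst p)) \<in> borel_measurable ?L3"
    using measurable_compose[OF measurable_fst measurable_lebI_fst]
      measurable_compose[OF measurable_fst measurable_lebI_snd] by blast+
  have S[measurable]: "(\<lambda>p. sphc (fst (fst p)) (snd (fst p)) (snd p)) \<in> borel_measurable ?L3"
    by measurable
  have dm[measurable]: "Dm \<in> sets borel" using open_Dom by auto
  have nth[measurable]: "(\<lambda>v::real ^ 3. v $ i) \<in> borel_measurable borel" for i
    by (intro borel_measurable_continuous_onI continuous_intros)
  have sb[measurable]: "{v\<in>sbox. sphc (v $ 1) (v $ 2) (v $ 3) \<in> X} \<in> sets borel"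
    unfolding sbox_def by measurable
  let ?h = "\<lambda>r c t. ennreal (r\<^sup>2) * indicator X (sphc r c t)"
  have "emeasure (density lborel (indicator Dm)) X = emeasure lborel (Dm \<inter> X)"
    by (subst emeasure_density) (auto simp flip: indicator_inter_arith)
  also have "\<dots> = (\<integral>\<^sup>+r. \<integral>\<^sup>+c. \<integral>\<^sup>+t. ennreal (r\<^sup>2) * indicator {v\<in>sbox. sphc (v $ 1) (v $ 2) (v $ 3) \<in> X}
      (vector [r, c, t]) \<partial>lborel \<partial>lborel \<partial>lborel)"
    unfolding emeasure_Dom[OF X] by (subst nn_integral_lborel_vec3) simp_all
  also have "\<dots> = (\<integral>\<^sup>+r. \<integral>\<^sup>+c. \<integral>\<^sup>+t. ?h r c t * indicator ?T t * indicator ?B c * indicator ?A r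
      \<partial>lborel \<partial>lborel \<partial>lborel)"
  proof (rule nn_integral_cong, rule nn_integral_cong, rule nn_integral_cong_AE)
    fix r c :: real
    \<comment> \<open>The slice t = 0 belongs to \<open>sbox\<close> but not to the open interval of
      \<open>lebI\<close>; it is null.\<close>
    have "AE t in lborel. t \<noteq> (0::real)" by (rule AE_I[where N="{0}"]) auto
    then show "AE t in lborel. ennreal (r\<^sup>2) * indicator {v\<in>sbox. sphc (v $ 1) (v $ 2) (v $ 3) \<in> X}
        (vector [r, c, t]) = ?h r c t * indicator ?T t * indicator ?B c * indicator ?A r"
      by eventually_elim (auto simp: sbox_def indicator_def)
  qed
  also have "\<dots> = (\<integral>\<^sup>+r. (\<integral>\<^sup>+c. (\<integral>\<^sup>+t. ?h r c t * indicator ?T t \<partial>lborel) * indicator ?B c \<partial>lborel)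
      * indicator ?A r \<partial>lborel)"
    by (simp add: nn_integral_multc)
  also have "\<dots> = (\<integral>\<^sup>+r. \<integral>\<^sup>+c. \<integral>\<^sup>+t. ?h r c t \<partial>lebI 0 (2 * pi) \<partial>lebI (- sin \<alpha>) (sin \<alpha>) \<partial>lebI (1 / m) 1)"
    by (simp add: lebI_def nn_integral_restrict_space)
  also have "\<dots> = (\<integral>\<^sup>+p. \<integral>\<^sup>+t. ?h (fst p) (snd p) t \<partial>lebI 0 (2 * pi) \<partial>?L2)"
  proof -
    have "(\<lambda>p. \<integral>\<^sup>+t. ?h (fst p) (snd p) t \<partial>lebI 0 (2 * pi)) \<in> borel_measurable ?L2"
      by measurable
    from lebI.nn_integral_fst[OF this] show ?thesis by simp
  qed
  also have "\<dots> = (\<integral>\<^sup>+p. ?h (fst (fst p)) (snd (fst p)) (snd p) \<partial>?L3)"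
  proof -
    have "(\<lambda>p. ?h (fst (fst p)) (snd (fst p)) (snd p)) \<in> borel_measurable ?L3"
      by measurable
    from lebI.nn_integral_fst[OF this] show ?thesis by simp
  qed
  also have "\<dots> = emeasure (distr (density ?L3 (\<lambda>p. ennreal ((fst (fst p))\<^sup>2))) borel
      (\<lambda>p. sphc (fst (fst p)) (snd (fst p)) (snd p))) X"
  proof -
    let ?D = "density ?L3 (\<lambda>p. ennreal ((fst (fst p))\<^sup>2))"
    let ?S = "\<lambda>p. sphc (fst (fst p)) (snd (fst p)) (snd p)"
    have "?S \<in> borel_measurable ?D" using S by simp
    from emeasure_distr[OF this X]
    have "emeasure (distr ?D borel ?S) X = emeasure ?D (?S -` X \<inter> space ?L3)" by simp
    also have "\<dots> = (\<integral>\<^sup>+p. ennreal ((fst (fst p))\<^sup>2) * indicator (?S -` X \<inter> space ?L3) p \<partial>?L3)"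
      using measurable_sets[OF S X] by (intro emeasure_density) measurable
    also have "\<dots> = (\<integral>\<^sup>+p. ?h (fst (fst p)) (snd (fst p)) (snd p) \<partial>?L3)"
      by (intro nn_integral_cong) (auto simp: indicator_def)
    finally show ?thesis by simp
  qed
  finally show "emeasure (density lborel (indicator Dm)) X
    = emeasure (distr (density ?L3 (\<lambda>p. ennreal ((fst (fst p))\<^sup>2))) borel
      (\<lambda>p. sphc (fst (fst p)) (snd (fst p)) (snd p))) X" .
qed simp

end

section \<open>The inequality on a rectangle\<close>

text \<open>The du Bois-Reymond lemma differentiates in the first coordinate; exchanging coordinates
  makes it available for the second.\<close>

lemma AE_lebI2_swap:
  assumes "AE p in lebI2 a b c d. Q p"
  shows "AE p in lebI2 c d a b. Q (snd p, fst p)"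
proof -
  have m: "(\<lambda>(x, y). (y, x)) \<in> measurable (lebI2 c d a b) (lebI2 a b c d)"
    by (rule measurable_pair_swap')
  have "AE p in distr (lebI2 c d a b) (lebI2 a b c d) (\<lambda>(x, y). (y, x)). Q p"
    using assms by (subst lebI_pair.distr_pair_swap[symmetric])
  from AE_distrD[OF m this] show ?thesis by (simp add: case_prod_beta)
qed

lemma lebI2_swap:
  fixes f :: "real \<times> real \<Rightarrow> real"
  assumes f: "integrable (lebI2 a b c d) f"
  shows "integrable (lebI2 c d a b) (\<lambda>p. f (snd p, fst p))"
    and "(\<integral>p. f (snd p, fst p) \<partial>lebI2 c d a b) = (\<integral>p. f p \<partial>lebI2 a b c d)"
proof -
  have "(\<lambda>(x, y). f (y, x)) = (\<lambda>p. f (snd p, fst p))" by (simp add: fun_eq_iff)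
  with lebI_pair.integrable_product_swap[OF f]
    lebI_pair.integral_product_swap[OF borel_measurable_integrable[OF f]]
  show "integrable (lebI2 c d a b) (\<lambda>p. f (snd p, fst p))"
    "(\<integral>p. f (snd p, fst p) \<partial>lebI2 c d a b) = (\<integral>p. f p \<partial>lebI2 a b c d)"
    by simp_all
qed

lemma finite_measure_lebI2: "finite_measure (lebI2 a b c d)"
  by (rule finite_measure_pair_measure) simp_all

text \<open>On almost every slice f = F(r) + h(c) with h of weighted mean zero, so F and h are
  orthogonal and their squares add. Hardy bounds F by its derivative P, the weighted mean of p, and
  Jensen bounds P by p; Poincare bounds h by q. Each part uses only one of the two derivatives,
  which is why the two constants appear separately and unspoiled.\<close>

lemma weighted_poincare_rectangle:
  fixes e s l :: real and j a :: nat and f p q :: "real \<times> real \<Rightarrow> real"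
  assumes e: "0 < e" "e \<le> 1 / 2" and s: "0 < s" "s \<le> 1 / 2" and l: "0 \<le> l" and ja: "j \<le> a"
  defines "M \<equiv> lebI2 e 1 (- s) s"
  assumes meas: "f \<in> borel_measurable M" "p \<in> borel_measurable M" "q \<in> borel_measurable M"
    and f2: "integrable M (\<lambda>x. (f x)\<^sup>2)" and p2: "integrable M (\<lambda>x. (p x)\<^sup>2)"
    and q2: "integrable M (\<lambda>x. (q x)\<^sup>2)"
    and weak1: "\<And>g h. test1 e 1 g \<Longrightarrow> test1 (- s) s h \<Longrightarrow>
      (\<integral>x. f x * (deriv g (fst x) * h (snd x)) \<partial>M) = - (\<integral>x. p x * (g (fst x) * h (snd x)) \<partial>M)"
    and weak2: "\<And>g h. test1 e 1 g \<Longrightarrow> test1 (- s) s h \<Longrightarrow>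
      (\<integral>x. f x * (g (fst x) * deriv h (snd x)) \<partial>M) = - (\<integral>x. q x * (g (fst x) * h (snd x)) \<partial>M)"
    and mean: "(\<integral>x. f x * (fst x ^ a * wt ((l - 1) / 2) (snd x)) \<partial>M) = 0"
  shows "(\<integral>x. (f x)\<^sup>2 * (fst x ^ j * wt ((l - 1) / 2) (snd x)) \<partial>M)
    \<le> 4 / (real j + 1)\<^sup>2 * (\<integral>x. (p x)\<^sup>2 * (fst x ^ (j + 2) * wt ((l - 1) / 2) (snd x)) \<partial>M)
      + 2 / (18 + l) * (\<integral>x. (q x)\<^sup>2 * (fst x ^ j * wt ((l + 1) / 2) (snd x)) \<partial>M)"
proof -
  let ?A = "lebI e 1" and ?B = "lebI (- s) s" and ?w = "wt ((l - 1) / 2)" and ?w' = "wt ((l + 1) / 2)"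
  interpret M: finite_measure M unfolding M_def by (rule finite_measure_lebI2)
  have ss: "- s < s" and e1: "e < 1" using s e by auto
  note cw = continuous_wt[OF s(2)]
  have cp: "continuous_on {e..1} (\<lambda>x. x ^ n)" for n by (intro continuous_intros)
  have fi: "integrable M f" and pi: "integrable M p" and qi: "integrable M q"
    using M.integrable_of_square meas f2 p2 q2 by blast+
  have test: "integrable M (\<lambda>x. g x * (fst x ^ n * wt r (snd x)))" if "integrable M g" for g n r
    using integrable_mult_test1[OF that[unfolded M_def] cp cw] unfolding M_def .
  note fst_int = lebI_pair.AE_integrable_fst'[of e 1 "- s" s, folded M_def]
    lebI_pair.integrable_fst'[of e 1 "- s" s, folded M_def]
    lebI_pair.integral_fst'[of e 1 "- s" s, folded M_def]

  \<comment> \<open>The weighted mean over c\<close>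
  define W where "W = (\<integral>c. ?w c \<partial>?B)"
  have iw: "integrable ?B ?w" by (rule continuous_integrable_lebI[OF cw])
  have W: "W > 0"
  proof -
    have "W \<noteq> 0"
    proof
      assume "W = 0"
      have "AE c in ?B. 0 \<le> ?w c" by (simp add: wt_def)
      from iffD1[OF integral_nonneg_eq_0_iff_AE[OF iw this]] \<open>W = 0\<close>
      have "AE c in ?B. ?w c = 0" by (simp only: W_def)
      moreover have "AE c in ?B. ?w c > 0"
        by (rule AE_I2) (use wt_pos[OF _ s(2)] in \<open>auto simp: abs_le_iff\<close>)
      ultimately have "AE c in ?B. False" by eventually_elim simp
      then have "emeasure ?B (space ?B) = 0"
        unfolding ae_filter_eq_bot_iff[symmetric] trivial_limit_def .
      then show False
        using ss by (simp add: lebI_def space_restrict_space emeasure_restrict_space)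
    qed
    moreover have "W \<ge> 0" unfolding W_def by (rule Bochner_Integration.integral_nonneg) (simp add: wt_def)
    ultimately show ?thesis by simp
  qed
  define F where "F = (\<lambda>r. (\<integral>c. f (r, c) * ?w c \<partial>?B) / W)"
  define P where "P = (\<lambda>r. (\<integral>c. p (r, c) * ?w c \<partial>?B) / W)"
  have fw: "integrable M (\<lambda>x. f x * ?w (snd x))" and pw: "integrable M (\<lambda>x. p x * ?w (snd x))"
    using test[OF fi, of 0] test[OF pi, of 0] by simp_all
  have Fint: "integrable ?A F" and Pint: "integrable ?A P"
    using fst_int(2)[OF fw] fst_int(2)[OF pw] by (simp_all add: F_def P_def)

  \<comment> \<open>Absolute continuity along almost every line of either direction\<close>
  obtain k1 where k1: "AE x in lebI2 (- s) s e 1.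
      f (snd x, fst x) = k1 (snd x) + prim (- s) s (\<lambda>c. q (snd (c, snd x), fst (c, snd x))) (fst x)"
  proof (rule du_bois_reymond[OF ss e1, of "\<lambda>x. f (snd x, fst x)" "\<lambda>x. q (snd x, fst x)"])
    show "integrable (lebI2 (- s) s e 1) (\<lambda>x. f (snd x, fst x))"
      "integrable (lebI2 (- s) s e 1) (\<lambda>x. q (snd x, fst x))"
      using lebI2_swap(1)[OF fi[unfolded M_def]] lebI2_swap(1)[OF qi[unfolded M_def]] .
    fix h g assume h: "test1 (- s) s h" and g: "test1 e 1 g"
    note dg = test1_deriv[OF g] and dh = test1_deriv[OF h]
    have "integrable M (\<lambda>x. f x * (g (fst x) * deriv h (snd x)))"
      "integrable M (\<lambda>x. q x * (g (fst x) * h (snd x)))"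
      using integrable_mult_test1[OF fi[unfolded M_def] dg(2) dh(3)]
        integrable_mult_test1[OF qi[unfolded M_def] dg(2) dh(2)] unfolding M_def .
    from lebI2_swap(2)[OF this(1)[unfolded M_def]] lebI2_swap(2)[OF this(2)[unfolded M_def]] weak2[OF g h]
    show "(\<integral>x. f (snd x, fst x) * (deriv h (fst x) * g (snd x)) \<partial>lebI2 (- s) s e 1)
      = - (\<integral>x. q (snd x, fst x) * (h (fst x) * g (snd x)) \<partial>lebI2 (- s) s e 1)"
      unfolding M_def by (simp add: mult.commute)
  qed
  have slice1: "AE r in ?A. AE c in ?B. f (r, c) = k1 r + prim (- s) s (\<lambda>c. q (r, c)) c"
    using lebI_pair.AE_pair[OF AE_lebI2_swap[OF k1]] by simp
  obtain k2 where k2i: "integrable ?B k2"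
    and k2: "AE x in M. f x = k2 (snd x) + prim e 1 (\<lambda>t. p (t, snd x)) (fst x)"
    using du_bois_reymond[OF e1 ss fi[unfolded M_def] pi[unfolded M_def] weak1[unfolded M_def]]
    unfolding M_def by blast
  have slice2: "AE r in ?A. AE c in ?B. f (r, c) = k2 c + prim e 1 (\<lambda>t. p (t, c)) r"
    using lebI_pair.AE_pair[OF k2[unfolded M_def]] by simp

  \<comment> \<open>An absolutely continuous representative of the mean\<close>
  define K where "K = (\<integral>c. k2 c * ?w c \<partial>?B) / W"
  \<comment> \<open>Not a derivative: \<open>F'\<close> is the representative of \<open>F\<close>
    found by averaging f = k2(c) + (primitive of p), and its derivative is \<open>P\<close>.\<close>
  define F' where "F' = (\<lambda>r. K + prim e 1 P r)"
  have ac: "AC e 1 F' P" unfolding F'_def by (rule AC_prim[OF Pint])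
  \<comment> \<open>Averaging in c commutes with taking primitives in r, by Fubini for p times the
    weight, cut off at r.\<close>
  have primP: "(\<integral>c. prim e 1 (\<lambda>t. p (t, c)) r * ?w c \<partial>?B) = W * prim e 1 P r" for r
  proof -
    have cut: "integrable M (\<lambda>x. if fst x < r then p x * ?w (snd x) else 0)"
      by (rule Bochner_Integration.integrable_bound[OF pw])
         (use pw in \<open>auto simp: M_def\<close>)
    have "(\<integral>c. prim e 1 (\<lambda>t. p (t, c)) r * ?w c \<partial>?B)
        = (\<integral>c. (\<integral>t. (if t < r then p (t, c) * ?w c else 0) \<partial>?A) \<partial>?B)"
    proof (rule Bochner_Integration.integral_cong[OF refl])
      fix c
      have "prim e 1 (\<lambda>t. p (t, c)) r * ?w c = (\<integral>t. (if t < r then p (t, c) else 0) * ?w c \<partial>?A)"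
        unfolding prim_def by simp
      also have "\<dots> = (\<integral>t. (if t < r then p (t, c) * ?w c else 0) \<partial>?A)"
        by (rule Bochner_Integration.integral_cong) auto
      finally show "prim e 1 (\<lambda>t. p (t, c)) r * ?w c = (\<integral>t. (if t < r then p (t, c) * ?w c else 0) \<partial>?A)" .
    qed
    also have "\<dots> = (\<integral>x. (if fst x < r then p x * ?w (snd x) else 0) \<partial>M)"
      using lebI2_integral_snd(3)[OF cut[unfolded M_def]] by (simp only: M_def fst_conv snd_conv)
    also have "\<dots> = (\<integral>t. (\<integral>c. (if t < r then p (t, c) * ?w c else 0) \<partial>?B) \<partial>?A)"
      using fst_int(3)[OF cut] by (simp only: fst_conv snd_conv)
    also have "\<dots> = (\<integral>t. W * (if t < r then P t else 0) \<partial>?A)"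
      using W by (intro Bochner_Integration.integral_cong) (auto simp: P_def)
    also have "\<dots> = W * prim e 1 P r" unfolding prim_def by simp
    finally show ?thesis .
  qed
  have k2w: "integrable ?B (\<lambda>c. k2 c * ?w c)" by (rule integrable_mult_continuous[OF k2i cw])
  have FF': "AE r in ?A. F r = F' r"
    using slice2 fst_int(1)[OF fw]
  proof eventually_elim
    case (elim r)
    have [measurable]: "?w \<in> borel_measurable ?B" using iw by auto
    have i: "integrable ?B (\<lambda>c. f (r, c) * ?w c)" using elim(2) by simp
    have "W * F r - (\<integral>c. k2 c * ?w c \<partial>?B) = (\<integral>c. f (r, c) * ?w c - k2 c * ?w c \<partial>?B)"
      using i k2w W by (simp add: F_def)
    also have "\<dots> = (\<integral>c. prim e 1 (\<lambda>t. p (t, c)) r * ?w c \<partial>?B)"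
    proof (rule integral_cong_AE)
      show "(\<lambda>c. f (r, c) * ?w c - k2 c * ?w c) \<in> borel_measurable ?B" using i k2w by auto
      have [measurable]: "p \<in> borel_measurable (lebI2 e 1 (- s) s)" using meas(2) by (simp add: M_def)
      show "(\<lambda>c. prim e 1 (\<lambda>t. p (t, c)) r * ?w c) \<in> borel_measurable ?B"
        unfolding prim_def by measurable
      show "AE c in ?B. f (r, c) * ?w c - k2 c * ?w c = prim e 1 (\<lambda>t. p (t, c)) r * ?w c"
        using elim(1) by eventually_elim (simp add: algebra_simps)
    qed
    also have "\<dots> = W * prim e 1 P r" by (rule primP)
    finally have "W * F r = W * F' r"
      using W by (simp add: F'_def K_def distrib_left)
    then show "F r = F' r" using W by simp
  qed

  have meanF: "(\<integral>r. F' r * r ^ a \<partial>?A) = 0"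
  proof -
    have i: "integrable M (\<lambda>x. f x * (fst x ^ a * ?w (snd x)))" by (rule test[OF fi])
    have "0 = (\<integral>r. (\<integral>c. f (r, c) * (r ^ a * ?w c) \<partial>?B) \<partial>?A)"
      using fst_int(3)[OF i] mean by simp
    also have "\<dots> = (\<integral>r. W * (F r * r ^ a) \<partial>?A)"
    proof (rule Bochner_Integration.integral_cong[OF refl])
      fix r
      have "(\<integral>c. f (r, c) * (r ^ a * ?w c) \<partial>?B) = (\<integral>c. (f (r, c) * ?w c) * r ^ a \<partial>?B)"
        by (simp only: ac_simps)
      then show "(\<integral>c. f (r, c) * (r ^ a * ?w c) \<partial>?B) = W * (F r * r ^ a)"
        using W by (simp add: F_def)
    qed
    also have "\<dots> = W * (\<integral>r. F r * r ^ a \<partial>?A)" by simp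
    finally have "(\<integral>r. F r * r ^ a \<partial>?A) = 0" using W by simp
    moreover have "(\<integral>r. F r * r ^ a \<partial>?A) = (\<integral>r. F' r * r ^ a \<partial>?A)"
    proof (rule integral_cong_AE)
      show "AE r in ?A. F r * r ^ a = F' r * r ^ a" using FF' by eventually_elim simp
    qed (use integrable_mult_continuous[OF Fint cp[of a]]
        integrable_mult_continuous[OF AC_integrable[OF ac] cp[of a]] in auto)
    ultimately show ?thesis by simp
  qed

  \<comment> \<open>Hardy's inequality for the mean\<close>
  define N where "N = (\<lambda>r. \<integral>c. (p (r, c))\<^sup>2 * ?w c \<partial>?B)"
  have p2w: "integrable M (\<lambda>x. (p x)\<^sup>2 * ?w (snd x))" using test[OF p2, of 0] by simp
  have Nint: "integrable ?A N" using fst_int(2)[OF p2w] by (simp add: N_def)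
  \<comment> \<open>The weighted variance of p on a slice is nonnegative. This also supplies the
    square integrability of P that Hardy's inequality asks for.\<close>
  have jensen: "AE r in ?A. W * (P r)\<^sup>2 \<le> N r"
    using fst_int(1)[OF p2w] fst_int(1)[OF pw]
  proof eventually_elim
    case (elim r)
    then have i: "integrable ?B (\<lambda>c. (p (r, c))\<^sup>2 * ?w c)" "integrable ?B (\<lambda>c. p (r, c) * ?w c)" by simp_all
    have "0 \<le> (\<integral>c. (p (r, c) - P r)\<^sup>2 * ?w c \<partial>?B)"
      by (rule Bochner_Integration.integral_nonneg) (simp add: wt_def)
    also have "\<dots> = (\<integral>c. ((p (r, c))\<^sup>2 * ?w c - 2 * P r * (p (r, c) * ?w c)) + (P r)\<^sup>2 * ?w c \<partial>?B)"
      by (rule Bochner_Integration.integral_cong) (simp_all add: power2_eq_square algebra_simps)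
    also have "\<dots> = N r - 2 * P r * (\<integral>c. p (r, c) * ?w c \<partial>?B) + (P r)\<^sup>2 * W"
      using i iw by (simp add: N_def W_def)
    also have "(\<integral>c. p (r, c) * ?w c \<partial>?B) = W * P r" using W by (simp add: P_def)
    finally show ?case by (simp add: power2_eq_square algebra_simps)
  qed
  have P2: "integrable ?A (\<lambda>r. (P r)\<^sup>2)"
  proof (rule Bochner_Integration.integrable_bound)
    show "integrable ?A (\<lambda>r. N r / W)" using Nint by simp
    show "AE r in ?A. norm ((P r)\<^sup>2) \<le> norm (N r / W)"
      using jensen
    proof eventually_elim
      case (elim r)
      then have "(P r)\<^sup>2 \<le> N r / W" using W by (simp add: field_simps)
      also have "\<dots> \<le> norm (N r / W)" unfolding real_norm_def by (rule abs_ge_self)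
      finally show ?case by simp
    qed
  qed (use Pint in auto)
  have hardy: "(\<integral>r. (F' r)\<^sup>2 * r ^ j \<partial>?A) \<le> 4 / (real j + 1)\<^sup>2 * (\<integral>r. (P r)\<^sup>2 * r ^ (j + 2) \<partial>?A)"
    by (rule hardy_mean_zero[OF e ac P2 ja meanF])

  \<comment> \<open>Poincare's inequality for the remainder, slice by slice\<close>
  define C where "C = 2 / (18 + l)"
  have f2w: "integrable M (\<lambda>x. (f x)\<^sup>2 * ?w (snd x))" using test[OF f2, of 0] by simp
  have q2w: "integrable M (\<lambda>x. (q x)\<^sup>2 * ?w' (snd x))" using test[OF q2, of 0] by simp
  have slice: "AE r in ?A. (\<integral>c. (f (r, c))\<^sup>2 * ?w c \<partial>?B)
      \<le> C * (\<integral>c. (q (r, c))\<^sup>2 * ?w' c \<partial>?B) + W * (F' r)\<^sup>2"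
    using slice1 FF' fst_int(1)[OF fw] fst_int(1)[OF f2w] fst_int(1)[OF qi] fst_int(1)[OF q2]
  proof eventually_elim
    case (elim r)
    have fw': "integrable ?B (\<lambda>c. f (r, c) * ?w c)" and f2w': "integrable ?B (\<lambda>c. (f (r, c))\<^sup>2 * ?w c)"
      using elim(3,4) by simp_all
    \<comment> \<open>The absolutely continuous version of f - F on the slice: the slice constant
      k1(r) is corrected by the mean.\<close>
    define h where "h = (\<lambda>c. (k1 r - F r) + prim (- s) s (\<lambda>c. q (r, c)) c)"
    have ach: "AC (- s) s h (\<lambda>c. q (r, c))" unfolding h_def by (rule AC_prim[OF elim(5)])
    have fh: "AE c in ?B. f (r, c) = F r + h c"
      using elim(1) by eventually_elim (simp add: h_def)
    have hw: "integrable ?B (\<lambda>c. h c * ?w c)"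
      by (rule integrable_mult_continuous[OF AC_integrable[OF ach] cw])
    have h2w: "integrable ?B (\<lambda>c. (h c)\<^sup>2 * ?w c)"
      using integrable_mult_continuous[OF AC_mult_integrable[OF ach AC_integrable[OF ach]] cw]
      by (simp add: power2_eq_square)
    have "W * F r = (\<integral>c. f (r, c) * ?w c \<partial>?B)" using W by (simp add: F_def)
    also have "\<dots> = (\<integral>c. F r * ?w c + h c * ?w c \<partial>?B)"
    proof (rule integral_cong_AE)
      show "AE c in ?B. f (r, c) * ?w c = F r * ?w c + h c * ?w c"
        using fh by eventually_elim (simp add: distrib_right)
    qed (use fw' hw iw in auto)
    also have "\<dots> = W * F r + (\<integral>c. h c * ?w c \<partial>?B)" using hw iw by (simp add: W_def)
    finally have hmean: "(\<integral>c. h c * ?w c \<partial>?B) = 0" by simp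
    \<comment> \<open>Pythagoras: the cross term is a multiple of the mean of h and
      vanishes.\<close>
    have "(\<integral>c. (f (r, c))\<^sup>2 * ?w c \<partial>?B)
        = (\<integral>c. (h c)\<^sup>2 * ?w c + 2 * F r * (h c * ?w c) + (F r)\<^sup>2 * ?w c \<partial>?B)"
    proof (rule integral_cong_AE)
      show "AE c in ?B. (f (r, c))\<^sup>2 * ?w c = (h c)\<^sup>2 * ?w c + 2 * F r * (h c * ?w c) + (F r)\<^sup>2 * ?w c"
        using fh by eventually_elim (simp add: power2_eq_square algebra_simps)
    qed (use f2w' hw h2w iw in auto)
    also have "\<dots> = (\<integral>c. (h c)\<^sup>2 * ?w c \<partial>?B) + (F r)\<^sup>2 * W"
      using hw h2w iw hmean by (simp add: W_def)
    also have "\<dots> \<le> C * (\<integral>c. (q (r, c))\<^sup>2 * ?w' c \<partial>?B) + (F r)\<^sup>2 * W"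
      unfolding C_def using poincare_wt[OF s l ach elim(6) hmean] by simp
    finally show ?case using elim(2) by (simp add: mult.commute)
  qed

  \<comment> \<open>Integration over the radius\<close>
  have pull: "(\<integral>x. g x * (fst x ^ n * wt r (snd x)) \<partial>M) = (\<integral>t. (\<integral>c. g (t, c) * wt r c \<partial>?B) * t ^ n \<partial>?A)"
    if "integrable M g" for g n r
  proof -
    have "(\<integral>x. g x * (fst x ^ n * wt r (snd x)) \<partial>M) = (\<integral>t. (\<integral>c. g (t, c) * (t ^ n * wt r c) \<partial>?B) \<partial>?A)"
      using fst_int(3)[OF test[OF that]] by simp
    also have "\<dots> = (\<integral>t. (\<integral>c. (g (t, c) * wt r c) * t ^ n \<partial>?B) \<partial>?A)"
      by (simp only: ac_simps)
    finally show ?thesis by simp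
  qed
  have wint: "integrable ?A (\<lambda>t. (\<integral>c. g (t, c) * wt r c \<partial>?B) * t ^ n)" if "integrable M g" for g n r
    using fst_int(2)[OF test[OF that, of 0]] by (intro integrable_mult_continuous[OF _ cp]) simp
  have F2: "integrable ?A (\<lambda>r. (F' r)\<^sup>2 * r ^ j)"
    using integrable_mult_continuous[OF AC_mult_integrable[OF ac AC_integrable[OF ac]] cp]
    by (simp add: power2_eq_square)
  have "(\<integral>x. (f x)\<^sup>2 * (fst x ^ j * ?w (snd x)) \<partial>M)
      = (\<integral>t. (\<integral>c. (f (t, c))\<^sup>2 * ?w c \<partial>?B) * t ^ j \<partial>?A)"
    by (rule pull[OF f2])
  also have "\<dots> \<le> (\<integral>t. C * ((\<integral>c. (q (t, c))\<^sup>2 * ?w' c \<partial>?B) * t ^ j) + W * ((F' t)\<^sup>2 * t ^ j) \<partial>?A)"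
  proof (rule integral_mono_AE)
    show "AE t in ?A. (\<integral>c. (f (t, c))\<^sup>2 * ?w c \<partial>?B) * t ^ j
        \<le> C * ((\<integral>c. (q (t, c))\<^sup>2 * ?w' c \<partial>?B) * t ^ j) + W * ((F' t)\<^sup>2 * t ^ j)"
      using slice AE_space
    proof eventually_elim
      case (elim t)
      then have "0 \<le> t ^ j" using e by simp
      from mult_right_mono[OF elim(1) this] show ?case by (simp add: algebra_simps)
    qed
  qed (use wint[OF f2] wint[OF q2] F2 in auto)
  also have "\<dots> = C * (\<integral>x. (q x)\<^sup>2 * (fst x ^ j * ?w' (snd x)) \<partial>M) + W * (\<integral>t. (F' t)\<^sup>2 * t ^ j \<partial>?A)"
    unfolding pull[OF q2] using wint[OF q2] F2 by simp
  finally have main: "(\<integral>x. (f x)\<^sup>2 * (fst x ^ j * ?w (snd x)) \<partial>M)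
      \<le> C * (\<integral>x. (q x)\<^sup>2 * (fst x ^ j * ?w' (snd x)) \<partial>M) + W * (\<integral>t. (F' t)\<^sup>2 * t ^ j \<partial>?A)" .
  have "(\<integral>r. W * ((P r)\<^sup>2 * r ^ (j + 2)) \<partial>?A) \<le> (\<integral>t. N t * t ^ (j + 2) \<partial>?A)"
  proof (rule integral_mono_AE)
    show "AE t in ?A. W * ((P t)\<^sup>2 * t ^ (j + 2)) \<le> N t * t ^ (j + 2)"
      using jensen AE_space
    proof eventually_elim
      case (elim t)
      then have "0 \<le> t ^ (j + 2)" using e by simp
      from mult_right_mono[OF elim(1) this] show ?case by (simp add: algebra_simps)
    qed
  qed (use integrable_mult_continuous[OF P2 cp, of "j + 2"] integrable_mult_continuous[OF Nint cp, of "j + 2"] in auto)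
  also have "(\<integral>t. N t * t ^ (j + 2) \<partial>?A) = (\<integral>x. (p x)\<^sup>2 * (fst x ^ (j + 2) * ?w (snd x)) \<partial>M)"
    unfolding pull[OF p2] N_def ..
  finally have "4 / (real j + 1)\<^sup>2 * (\<integral>r. W * ((P r)\<^sup>2 * r ^ (j + 2)) \<partial>?A)
      \<le> 4 / (real j + 1)\<^sup>2 * (\<integral>x. (p x)\<^sup>2 * (fst x ^ (j + 2) * ?w (snd x)) \<partial>M)"
    by (intro mult_left_mono) auto
  moreover have "W * (\<integral>t. (F' t)\<^sup>2 * t ^ j \<partial>?A) \<le> W * (4 / (real j + 1)\<^sup>2 * (\<integral>r. (P r)\<^sup>2 * r ^ (j + 2) \<partial>?A))"
    using hardy W by (intro mult_left_mono) auto
  moreover have "W * (4 / (real j + 1)\<^sup>2 * (\<integral>r. (P r)\<^sup>2 * r ^ (j + 2) \<partial>?A))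
      = 4 / (real j + 1)\<^sup>2 * (\<integral>r. W * ((P r)\<^sup>2 * r ^ (j + 2)) \<partial>?A)" by simp
  ultimately show ?thesis
    using main unfolding C_def by linarith
qed

section \<open>Test vector fields\<close>

lemma Ck_on_divide_norm:
  assumes "open S" "0 \<notin> S" "Ck_on n S u"
  shows "Ck_on n S (\<lambda>x::'a::euclidean_space. u x * inverse (norm x))"
proof -
  have "Ck_on n S (\<lambda>x. u x * norm x powr (-1))"
    by (intro Ck_on_mult Ck_on_norm_powr assms)
  then show ?thesis by (simp add: powr_minus)
qed

context spherical_domain
begin

lemma Dom_facts:
  assumes "x \<in> Dm"
  shows "x \<noteq> 0" "0 < norm x" "1 / m < norm x" "norm x < 1" "\<bar>x $ 3 / norm x\<bar> < sin \<alpha>"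
    "\<bar>x $ 3 / norm x\<bar> \<le> 1 / 2" "0 < (norm x)\<^sup>2 - (x $ 3)\<^sup>2"
proof -
  have x: "1 / m < norm x" "norm x < 1" "\<bar>x $ 3\<bar> < sin \<alpha> * norm x"
    using assms unfolding Dom_eq by auto
  have "0 \<le> 1 / real_of_int m" using m by simp
  then show n: "0 < norm x" using x by linarith
  then show "x \<noteq> 0" by auto
  show s: "\<bar>x $ 3 / norm x\<bar> < sin \<alpha>"
    using x n by (simp add: abs_divide divide_less_eq)
  then show "\<bar>x $ 3 / norm x\<bar> \<le> 1 / 2"
    using sin_alpha_bounds by linarith
  have "\<bar>x $ 3\<bar> < norm x"
    using x(3) n sin_alpha_bounds mult_right_mono[of "sin \<alpha>" 1 "norm x"] by linarith
  then have "\<bar>x $ 3\<bar>\<^sup>2 < (norm x)\<^sup>2" by (intro power_strict_mono) auto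
  then show "0 < (norm x)\<^sup>2 - (x $ 3)\<^sup>2" by simp
qed (use assms in \<open>auto simp: Dom_eq\<close>)

text \<open>The supports of the two factors confine the product to a closed shell cut out by two
  cones, a compact subset of the domain. Hence V has to be smooth on the domain only and may be
  singular at the origin or along the axis.\<close>

lemma test_function_Dom:
  assumes \<eta>: "test1 (1 / m) 1 \<eta>" and \<chi>: "test1 (- sin \<alpha>) (sin \<alpha>) h"
    and V: "\<And>n. Ck_on n Dm V"
  shows "(\<lambda>x. \<eta> (norm x) * h (x $ 3 / norm x) * V x) \<in> test_functions Dm"
proof -
  let ?u = "\<lambda>x. \<eta> (norm x) * h (x $ 3 / norm x) * V x"
  note oD = open_Dom
  have D0: "0 \<notin> Dm" using Dom_facts(1) by blast
  obtain a b where a: "1 / m < a" "a \<le> b" "b < 1" "\<forall>x. x \<notin> {a..b} \<longrightarrow> \<eta> x = 0"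
    using \<eta> by (auto simp: test1_def)
  obtain c d where c: "- sin \<alpha> < c" "c \<le> d" "d < sin \<alpha>" "\<forall>x. x \<notin> {c..d} \<longrightarrow> h x = 0"
    using \<chi> by (auto simp: test1_def)
  have "0 \<le> 1 / real_of_int m" using m by simp
  then have a0: "a > 0" using a by linarith
  define K where "K = {x :: real ^ 3. a \<le> norm x \<and> norm x \<le> b \<and> c * norm x \<le> x $ 3 \<and> x $ 3 \<le> d * norm x}"
  have "closed K"
    unfolding K_def by (intro closed_Collect_conj closed_Collect_le continuous_intros)
  moreover have "bounded K"
    by (rule bounded_subset[of "cball 0 b"]) (auto simp: K_def)
  ultimately have K: "compact K" by (simp add: compact_eq_bounded_closed)
  have KD: "K \<subseteq> Dm"
  proof
    fix x assume x: "x \<in> K"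
    then have n: "norm x > 0" using a0 by (auto simp: K_def)
    then have "d * norm x < sin \<alpha> * norm x" "- sin \<alpha> * norm x < c * norm x"
      using mult_strict_right_mono[OF c(1) n] mult_strict_right_mono[OF c(3) n] by blast+
    then show "x \<in> Dm" using x a by (auto simp: K_def Dom_eq abs_less_iff)
  qed
  have zero: "?u x = 0" if "x \<notin> K" for x
  proof (cases "norm x \<in> {a..b}")
    case True
    then have n: "norm x > 0" using a0 by auto
    have "x $ 3 / norm x \<notin> {c..d}"
      using that True n by (auto simp: K_def field_simps)
    then show ?thesis using c(4) by simp
  qed (use a(4) in simp)
  have "Ck n ?u" for n
  proof (rule Ck_zero_outside[OF oD compact_imp_closed[OF K] KD _ zero])
    have lin: "Ck_on n Dm (\<lambda>x. x $ 3)"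
      by (rule Ck_on_linear[OF bounded_linear_vec_nth oD])
    have "Ck_on n Dm (\<lambda>x. norm x powr 1)" by (rule Ck_on_norm_powr[OF oD D0])
    then have nrm: "Ck_on n Dm (\<lambda>x. norm x)" by simp
    have c': "Ck_on n Dm (\<lambda>x. x $ 3 / norm x)"
      using Ck_on_divide_norm[OF oD D0 lin] by (simp add: divide_inverse)
    have "Ck_on n Dm (\<lambda>x. \<eta> (norm x))" "Ck_on n Dm (\<lambda>x. h (x $ 3 / norm x))"
      using \<eta> \<chi>
      by (auto intro!: Ck_on_compose[OF oD _ nrm, of UNIV] Ck_on_compose[OF oD _ c', of UNIV]
          simp: test1_def Ck_on_UNIV)
    then show "Ck_on n Dm ?u" by (intro Ck_on_mult oD V)
  qed
  then show ?thesis by (rule test_functionsI[OF K KD _ zero])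
qed

lemma has_derivative_norm_vec:
  "x \<noteq> 0 \<Longrightarrow> ((norm :: real ^ 3 \<Rightarrow> real) has_derivative (\<lambda>v. (x \<bullet> v) / norm x)) (at x)"
  using has_derivative_norm[of x] by (simp add: sgn_div_norm inner_commute divide_inverse mult.commute)

lemma has_derivative_nth: "((\<lambda>x. x $ i) has_derivative (\<lambda>v. v $ i)) (at (x :: real ^ 3))"
  by (rule bounded_linear_imp_has_derivative[OF bounded_linear_vec_nth])

lemma inner_axis_real3: "(x :: real ^ 3) \<bullet> axis i 1 = x $ i"
  by (simp add: inner_axis)

lemma norm_sq3: "(norm (x :: real ^ 3))\<^sup>2 = x $ 1 * x $ 1 + x $ 2 * x $ 2 + x $ 3 * x $ 3"
  using norm_vec3[of x] by (simp add: power2_eq_square)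

text \<open>The divergence of \<open>\<eta>(\<rho>) h(cos \<phi>) V\<close> for a divergence-free field \<open>V\<close>: it only involves
  \<open>V \<bullet> \<nabla>\<rho>\<close> and \<open>V \<bullet> \<nabla>(cos \<phi>)\<close>.\<close>

definition field_div :: "(real \<Rightarrow> real) \<Rightarrow> (real \<Rightarrow> real) \<Rightarrow> (3 \<Rightarrow> real ^ 3 \<Rightarrow> real) \<Rightarrow> real ^ 3 \<Rightarrow> real" where
  "field_div \<eta> h V x =
    deriv \<eta> (norm x) * h (x $ 3 / norm x) * ((x $ 1 * V 1 x + x $ 2 * V 2 x + x $ 3 * V 3 x) / norm x)
    + \<eta> (norm x) * deriv h (x $ 3 / norm x)
      * (V 3 x / norm x - x $ 3 * (x $ 1 * V 1 x + x $ 2 * V 2 x + x $ 3 * V 3 x) / norm x ^ 3)"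

text \<open>The definition of the weak gradient handles one scalar test function and one direction
  at a time. It is applied to each component of the field in its own axis direction; the sum pairs f
  with the divergence and G with the field.\<close>

lemma weak_gradient_field:
  fixes V :: "3 \<Rightarrow> real ^ 3 \<Rightarrow> real"
  assumes f: "f \<in> L2 Dm" and G: "G \<in> L2 Dm" and weak: "is_weak_gradient Dm f G"
    and \<eta>: "test1 (1 / m) 1 \<eta>" and h: "test1 (- sin \<alpha>) (sin \<alpha>) h"
    and V: "\<And>b n. Ck_on n Dm (V b)"
    and V': "\<And>b x. x \<in> Dm \<Longrightarrow> (V b has_derivative V' b x) (at x)"
    and div: "\<And>x. x \<in> Dm \<Longrightarrow>
      V' 1 x (axis 1 1) + V' 2 x (axis 2 1) + V' 3 x (axis 3 1) = 0"
  shows "(\<integral>x. f x * field_div \<eta> h V x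
        \<partial>lebesgue_on Dm)
    = - (\<integral>x. (G x $ 1 * V 1 x + G x $ 2 * V 2 x + G x $ 3 * V 3 x) * (\<eta> (norm x) * h (x $ 3 / norm x))
        \<partial>lebesgue_on Dm)"
proof -
  let ?M = "lebesgue_on Dm"
  note oD = open_Dom
  define u where "u = (\<lambda>b x. \<eta> (norm x) * h (x $ 3 / norm x) * V b x)"
  define du where "du = (\<lambda>b x. frechet_derivative (u b) (at x) (axis b 1))"
  have tu: "u b \<in> test_functions Dm" for b
    unfolding u_def by (rule test_function_Dom[OF \<eta> h V])
  have Dfin: "emeasure lebesgue Dm < \<infinity>"
  proof -
    have "bounded Dm" by (rule bounded_subset[of "ball 0 1"]) (auto simp: Dom_eq)
    from emeasure_bounded_finite[OF this] show ?thesis using oD by simp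
  qed
  have sD: "Dm \<in> sets lebesgue" using oD by simp
  interpret M: finite_measure ?M
    by (rule finite_measureI) (use Dfin sD in \<open>simp add: emeasure_restrict_space space_restrict_space\<close>)
  \<comment> \<open>Components of the field and their derivatives are continuous with compact
    support, hence bounded, so their products with f and G are integrable and the three identities
    may be added.\<close>
  have bounded_cont: "\<exists>C. \<forall>x. \<bar>w x\<bar> \<le> C" if w: "continuous_on UNIV w" and supp: "compact (closure {x. u b x \<noteq> 0})"
    "\<And>x. x \<notin> closure {x. u b x \<noteq> 0} \<Longrightarrow> w x = 0" for w :: "real ^ 3 \<Rightarrow> real" and b
  proof -
    have "bounded (w ` closure {x. u b x \<noteq> 0})"
      by (intro compact_imp_bounded compact_continuous_image continuous_on_subset[OF w] supp(1)) simp
    then obtain C where C: "\<forall>x\<in>closure {x. u b x \<noteq> 0}. \<bar>w x\<bar> \<le> C"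
      unfolding bounded_iff by auto
    have "\<bar>w x\<bar> \<le> max C 0" for x
      using C supp(2)[of x] by (cases "x \<in> closure {x. u b x \<noteq> 0}") (auto simp: le_max_iff_disj)
    then show ?thesis by blast
  qed
  have meas: "w \<in> borel_measurable ?M" if "continuous_on UNIV w" for w :: "real ^ 3 \<Rightarrow> real"
  proof (rule measurable_restrict_space1)
    show "w \<in> borel_measurable lebesgue"
      using borel_measurable_continuous_onI[OF that] by (simp add: measurable_completion)
  qed
  have cu: "continuous_on UNIV (u b)" "continuous_on UNIV (du b)" for b
  proof -
    have C: "Ck n (u b)" for n using tu[of b] by (simp add: test_functions_def)
    show "continuous_on UNIV (u b)" using C[of 0] by simp
    show "continuous_on UNIV (du b)" using C[of 1] by (simp add: du_def)
  qed
  have cs: "compact (closure {x. u b x \<noteq> 0})" for b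
    using tu[of b] by (simp add: test_functions_def)
  have du0: "du b x = 0" if x: "x \<notin> closure {x. u b x \<noteq> 0}" for b x
  proof -
    have "(u b has_derivative (\<lambda>_. 0)) (at x)"
      by (rule has_derivative_transform_within_open[where s="- closure {x. u b x \<noteq> 0}" and f="\<lambda>_. 0"])
         (use x closure_subset[of "{x. u b x \<noteq> 0}"] in \<open>auto intro!: derivative_eq_intros\<close>)
    then show ?thesis
      unfolding du_def by (metis frechet_derivative_at)
  qed
  have u0: "u b x = 0" if "x \<notin> closure {x. u b x \<noteq> 0}" for b x
    using that closure_subset[of "{x. u b x \<noteq> 0}"] by auto
  have fM: "f \<in> borel_measurable ?M" "integrable ?M (\<lambda>x. (f x)\<^sup>2)"
    and GM: "G \<in> borel_measurable ?M" "integrable ?M (\<lambda>x. (norm (G x))\<^sup>2)"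
    using f G by (simp_all add: L2_def)
  have fi: "integrable ?M f" by (rule M.integrable_of_square[OF fM])
  have Gb: "integrable ?M (\<lambda>x. G x $ b)" for b
  proof (rule M.integrable_of_square)
    show m: "(\<lambda>x. G x $ b) \<in> borel_measurable ?M"
      using GM(1) by (simp flip: inner_axis_real3)
    show "integrable ?M (\<lambda>x. (G x $ b)\<^sup>2)"
    proof (rule Bochner_Integration.integrable_bound[OF GM(2)])
      show "(\<lambda>x. (G x $ b)\<^sup>2) \<in> borel_measurable ?M" using m by measurable
      have "(G x $ b)\<^sup>2 \<le> (norm (G x))\<^sup>2" for x
        using component_le_norm_cart[of "G x" b] by (simp add: abs_le_square_iff[symmetric])
      then show "AE x in ?M. norm ((G x $ b)\<^sup>2) \<le> norm ((norm (G x))\<^sup>2)" by simp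
    qed
  qed
  have i1: "integrable ?M (\<lambda>x. f x * du b x)" for b
  proof -
    obtain C where "\<forall>x. \<bar>du b x\<bar> \<le> C" using bounded_cont[OF cu(2) cs du0] by blast
    then show ?thesis by (intro integrable_bounded_mult[OF fi meas[OF cu(2)]]) auto
  qed
  have i2: "integrable ?M (\<lambda>x. G x $ b * u b x)" for b
  proof -
    obtain C where "\<forall>x. \<bar>u b x\<bar> \<le> C" using bounded_cont[OF cu(1) cs u0] by blast
    then show ?thesis by (intro integrable_bounded_mult[OF Gb meas[OF cu(1)]]) auto
  qed
  have wk: "(\<integral>x. f x * du b x \<partial>?M) = - (\<integral>x. G x $ b * u b x \<partial>?M)" for b
  proof -
    have "axis b 1 \<in> (Basis :: (real ^ 3) set)" by (simp add: axis_in_Basis_iff)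
    with weak tu[of b] have "(\<integral>x. f x * frechet_derivative (u b) (at x) (axis b 1) \<partial>?M)
        = - (\<integral>x. (G x \<bullet> axis b 1) * u b x \<partial>?M)"
      unfolding is_weak_gradient_def by blast
    then show ?thesis by (simp add: du_def inner_axis_real3)
  qed
  have "(\<integral>x. f x * (du 1 x + du 2 x + du 3 x) \<partial>?M) = (\<integral>x. f x * du 1 x + f x * du 2 x + f x * du 3 x \<partial>?M)"
    by (simp add: distrib_left)
  also have "\<dots> = - ((\<integral>x. G x $ 1 * u 1 x \<partial>?M) + (\<integral>x. G x $ 2 * u 2 x \<partial>?M) + (\<integral>x. G x $ 3 * u 3 x \<partial>?M))"
    using i1 wk by simp
  also have "\<dots> = - (\<integral>x. G x $ 1 * u 1 x + G x $ 2 * u 2 x + G x $ 3 * u 3 x \<partial>?M)"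
    using i2 by simp
  also have "(\<lambda>x. G x $ 1 * u 1 x + G x $ 2 * u 2 x + G x $ 3 * u 3 x)
      = (\<lambda>x. (G x $ 1 * V 1 x + G x $ 2 * V 2 x + G x $ 3 * V 3 x) * (\<eta> (norm x) * h (x $ 3 / norm x)))"
    by (simp add: u_def fun_eq_iff algebra_simps)
  finally have main: "(\<integral>x. f x * (du 1 x + du 2 x + du 3 x) \<partial>?M)
    = - (\<integral>x. (G x $ 1 * V 1 x + G x $ 2 * V 2 x + G x $ 3 * V 3 x) * (\<eta> (norm x) * h (x $ 3 / norm x)) \<partial>?M)" .
  have "du 1 x + du 2 x + du 3 x = field_div \<eta> h V x"
    if x: "x \<in> Dm" for x
  proof -
    note n = Dom_facts(2)[OF x]
    define p where "p = deriv \<eta> (norm x)"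
    define q where "q = deriv h (x $ 3 / norm x)"
    define e0 where "e0 = \<eta> (norm x)"
    define h0 where "h0 = h (x $ 3 / norm x)"
    have d1: "((\<lambda>x. \<eta> (norm x)) has_derivative (\<lambda>v. p * ((x \<bullet> v) / norm x))) (at x)"
      using has_derivative_compose[OF has_derivative_norm_vec[OF Dom_facts(1)[OF x]]
          test1_deriv(1)[OF \<eta>, unfolded has_field_derivative_def]] by (simp add: p_def)
    have "((\<lambda>x. x $ 3 / norm x) has_derivative
        (\<lambda>v. - (x $ 3) * (inverse (norm x) * ((x \<bullet> v) / norm x) * inverse (norm x)) + v $ 3 / norm x)) (at x)"
      by (rule has_derivative_divide[OF has_derivative_nth has_derivative_norm_vec[OF Dom_facts(1)[OF x]]])
         (use n in simp)
    from has_derivative_compose[OF this test1_deriv(1)[OF h, unfolded has_field_derivative_def]]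
    have d2: "((\<lambda>x. h (x $ 3 / norm x)) has_derivative
        (\<lambda>v. q * (- (x $ 3) * (inverse (norm x) * ((x \<bullet> v) / norm x) * inverse (norm x)) + v $ 3 / norm x))) (at x)"
      by (simp add: q_def)
    have du: "du b x = e0 * h0 * V' b x (axis b 1)
        + (e0 * (q * (- (x $ 3) * (inverse (norm x) * (x $ b / norm x) * inverse (norm x)) + axis b 1 $ 3 / norm x))
          + p * (x $ b / norm x) * h0) * V b x" for b
    proof -
      have "du b x = (\<lambda>v. \<eta> (norm x) * h (x $ 3 / norm x) * V' b x v
        + (\<eta> (norm x) * (q * (- (x $ 3) * (inverse (norm x) * ((x \<bullet> v) / norm x) * inverse (norm x)) + v $ 3 / norm x))
          + p * ((x \<bullet> v) / norm x) * h (x $ 3 / norm x)) * V b x) (axis b 1)"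
        unfolding du_def u_def
        by (rule fun_cong[OF frechet_derivative_at[symmetric, OF has_derivative_mult[OF has_derivative_mult[OF d1 d2] V'[OF x]]]])
      then show ?thesis by (simp add: inner_axis_real3 e0_def h0_def)
    qed
    have ax: "axis (1::3) (1::real) $ 3 = 0" "axis (2::3) (1::real) $ 3 = 0" "axis (3::3) (1::real) $ 3 = 1"
      by (simp_all add: axis_def)
    \<comment> \<open>The product rule splits off the divergence of V, which is 0; the other two
      terms are the derivatives of \<eta> and h along V.\<close>
    have "du 1 x + du 2 x + du 3 x = e0 * h0 * (V' 1 x (axis 1 1) + V' 2 x (axis 2 1) + V' 3 x (axis 3 1))
      + p * h0 * ((x $ 1 * V 1 x + x $ 2 * V 2 x + x $ 3 * V 3 x) / norm x)
        + e0 * q * (V 3 x / norm x - x $ 3 * (x $ 1 * V 1 x + x $ 2 * V 2 x + x $ 3 * V 3 x) / norm x ^ 3)"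
      unfolding du ax using n by (simp add: field_simps power3_eq_cube)
    then show ?thesis unfolding div[OF x] p_def q_def e0_def h0_def field_div_def by simp
  qed
  then have "(\<integral>x. f x * (du 1 x + du 2 x + du 3 x) \<partial>?M)
    = (\<integral>x. f x * field_div \<eta> h V x \<partial>?M)"
    by (intro Bochner_Integration.integral_cong refl) (simp add: space_restrict_space)
  then show ?thesis using main by simp
qed

text \<open>The field is x / |x|^3, the inverse-square field: divergence-free off the origin and
  tangent to the cones of constant \<phi>, so h is not differentiated. Its length \<rho>^(-2)
  cancels the Jacobian, which turns the identity into a plain weak \<rho>-derivative on the
  rectangle.\<close>

lemma weak_gradient_radial:
  assumes "f \<in> L2 Dm" "G \<in> L2 Dm" "is_weak_gradient Dm f G"
    and "test1 (1 / m) 1 \<eta>" "test1 (- sin \<alpha>) (sin \<alpha>) h"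
  shows "(\<integral>x. f x * (deriv \<eta> (norm x) * h (x $ 3 / norm x)) / (norm x)\<^sup>2 \<partial>lebesgue_on Dm)
    = - (\<integral>x. (G x \<bullet> (x /\<^sub>R norm x)) * (\<eta> (norm x) * h (x $ 3 / norm x)) / (norm x)\<^sup>2
        \<partial>lebesgue_on Dm)"
proof -
  note oD = open_Dom
  have D0: "0 \<notin> Dm" using Dom_facts(1) by blast
  define V :: "3 \<Rightarrow> real ^ 3 \<Rightarrow> real" where "V = (\<lambda>b x. x $ b * inverse (norm x ^ 3))"
  define V' :: "3 \<Rightarrow> real ^ 3 \<Rightarrow> real ^ 3 \<Rightarrow> real" where
    "V' = (\<lambda>b x v. v $ b * inverse (norm x ^ 3) - 3 * x $ b * (x \<bullet> v) * inverse (norm x ^ 5))"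
  have V: "Ck_on n Dm (V b)" for b n
  proof -
    have "Ck_on n Dm (\<lambda>x. x $ b * norm x powr (-3))"
      by (intro Ck_on_mult oD Ck_on_norm_powr D0 Ck_on_linear bounded_linear_vec_nth)
    then show ?thesis
    proof (rule iffD1[OF Ck_on_cong[OF oD], rotated])
      fix x assume "x \<in> Dm"
      then have "norm x > 0" by (rule Dom_facts)
      then show "x $ b * norm x powr - 3 = V b x"
        by (simp add: V_def powr_minus powr_numeral)
    qed
  qed
  have V'b: "(V b has_derivative V' b x) (at x)" if x: "x \<in> Dm" for b x
  proof -
    note n = Dom_facts(1,2)[OF x]
    have "((\<lambda>x. inverse (norm x ^ 3)) has_derivative
        (\<lambda>v. - (inverse (norm x ^ 3) * (of_nat 3 * ((x \<bullet> v) / norm x) * norm x ^ (3 - 1)) * inverse (norm x ^ 3)))) (at x)"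
      using n by (intro Deriv.has_derivative_inverse has_derivative_power has_derivative_norm_vec) auto
    from has_derivative_mult[OF has_derivative_nth[of b x] this]
    have "(V b has_derivative (\<lambda>v. x $ b * - (inverse (norm x ^ 3) * (of_nat 3 * ((x \<bullet> v) / norm x) * norm x ^ (3 - 1)) * inverse (norm x ^ 3))
        + v $ b * inverse (norm x ^ 3))) (at x)"
      unfolding V_def .
    then show ?thesis
    proof (rule has_derivative_eq_rhs)
      show "(\<lambda>v. x $ b * - (inverse (norm x ^ 3) * (of_nat 3 * ((x \<bullet> v) / norm x) * norm x ^ (3 - 1)) * inverse (norm x ^ 3))
        + v $ b * inverse (norm x ^ 3)) = V' b x"
        using n by (simp add: V'_def fun_eq_iff field_simps eval_nat_numeral)
    qed
  qed
  have rad: "x $ 1 * V 1 x + x $ 2 * V 2 x + x $ 3 * V 3 x = 1 / norm x" if x: "x \<in> Dm" for x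
  proof -
    have "x $ 1 * V 1 x + x $ 2 * V 2 x + x $ 3 * V 3 x
        = (x $ 1 * x $ 1 + x $ 2 * x $ 2 + x $ 3 * x $ 3) * inverse (norm x ^ 3)"
      by (simp add: V_def algebra_simps)
    also have "\<dots> = 1 / norm x"
      unfolding norm_sq3[symmetric] using Dom_facts(2)[OF x] by (simp add: field_simps eval_nat_numeral)
    finally show ?thesis .
  qed
  have div: "V' 1 x (axis 1 1) + V' 2 x (axis 2 1) + V' 3 x (axis 3 1) = 0" if x: "x \<in> Dm" for x
  proof -
    have "V' 1 x (axis 1 1) + V' 2 x (axis 2 1) + V' 3 x (axis 3 1)
        = 3 * inverse (norm x ^ 3)
          - 3 * (x $ 1 * x $ 1 + x $ 2 * x $ 2 + x $ 3 * x $ 3) * inverse (norm x ^ 5)"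
      by (simp add: V'_def inner_axis_real3 algebra_simps)
    also have "\<dots> = 0"
      unfolding norm_sq3[symmetric] using Dom_facts(2)[OF x] by (simp add: field_simps eval_nat_numeral)
    finally show ?thesis .
  qed
  have "(\<integral>x. f x * (deriv \<eta> (norm x) * h (x $ 3 / norm x)) / (norm x)\<^sup>2 \<partial>lebesgue_on Dm)
    = (\<integral>x. f x * field_div \<eta> h V x
        \<partial>lebesgue_on Dm)"
  proof (rule Bochner_Integration.integral_cong[OF refl])
    fix x assume "x \<in> space (lebesgue_on Dm)"
    then have x: "x \<in> Dm" by (simp add: space_restrict_space)
    \<comment> \<open>The derivative of cos \<phi> along the radial field is 0.\<close>
    have "V 3 x / norm x - x $ 3 * (1 / norm x) / norm x ^ 3 = 0"
      using Dom_facts(2)[OF x] by (simp add: V_def field_simps eval_nat_numeral)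
    then show "f x * (deriv \<eta> (norm x) * h (x $ 3 / norm x)) / (norm x)\<^sup>2
      = f x * field_div \<eta> h V x"
      unfolding field_div_def rad[OF x] by (simp add: power2_eq_square)
  qed
  also have "\<dots> = - (\<integral>x. (G x $ 1 * V 1 x + G x $ 2 * V 2 x + G x $ 3 * V 3 x) * (\<eta> (norm x) * h (x $ 3 / norm x))
        \<partial>lebesgue_on Dm)"
    by (rule weak_gradient_field[OF assms V V'b div])
  also have "(\<integral>x. (G x $ 1 * V 1 x + G x $ 2 * V 2 x + G x $ 3 * V 3 x) * (\<eta> (norm x) * h (x $ 3 / norm x))
        \<partial>lebesgue_on Dm)
    = (\<integral>x. (G x \<bullet> (x /\<^sub>R norm x)) * (\<eta> (norm x) * h (x $ 3 / norm x)) / (norm x)\<^sup>2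
        \<partial>lebesgue_on Dm)"
    by (rule Bochner_Integration.integral_cong[OF refl])
       (simp add: V_def inner_vec_def sum_3 power2_eq_square power3_eq_cube divide_inverse algebra_simps)
  finally show ?thesis .
qed

text \<open>The field runs along the meridians, so \<eta> is not differentiated. The length 1 /
  (\<rho> sin \<phi>) makes it divergence-free, and its derivative of cos \<phi> is \<rho>^(-2),
  again the reciprocal of the Jacobian.\<close>

lemma weak_gradient_polar:
  assumes "f \<in> L2 Dm" "G \<in> L2 Dm" "is_weak_gradient Dm f G"
    and "test1 (1 / m) 1 \<eta>" "test1 (- sin \<alpha>) (sin \<alpha>) h"
  shows "(\<integral>x. f x * (\<eta> (norm x) * deriv h (x $ 3 / norm x)) / (norm x)\<^sup>2 \<partial>lebesgue_on Dm)
    = - (\<integral>x. (G x \<bullet> (((norm x)\<^sup>2 *\<^sub>R axis 3 1 - x $ 3 *\<^sub>R x) /\<^sub>R (norm x * ((norm x)\<^sup>2 - (x $ 3)\<^sup>2))))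
        * (\<eta> (norm x) * h (x $ 3 / norm x)) \<partial>lebesgue_on Dm)"
proof -
  note oD = open_Dom
  have D0: "0 \<notin> Dm" using Dom_facts(1) by blast
  \<comment> \<open>The squared distance to the x_3-axis, positive on the domain because |cos
    \<phi>| is at most 1/2 there.\<close>
  define R :: "real ^ 3 \<Rightarrow> real" where "R = (\<lambda>x. x \<bullet> x - x $ 3 * x $ 3)"
  have R: "R x = (norm x)\<^sup>2 - (x $ 3)\<^sup>2" for x
    by (simp only: R_def power2_norm_eq_inner) (simp add: power2_eq_square)
  have Rpos: "R x > 0" if "x \<in> Dm" for x unfolding R by (rule Dom_facts(7)[OF that])
  define d :: "3 \<Rightarrow> real" where "d = (\<lambda>b. axis 3 1 $ b)"
  have d: "d 1 = 0" "d 2 = 0" "d 3 = 1" by (simp_all add: d_def axis_def)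
  \<comment> \<open>Component b of |x|^2 e_3 - x_3 x, which is |x|^2 times the projection of e_3
    onto the tangent plane of the sphere; \<open>d\<close> lists the components of e_3.\<close>
  define A :: "3 \<Rightarrow> real ^ 3 \<Rightarrow> real" where "A = (\<lambda>b x. d b * (x \<bullet> x) - x $ 3 * x $ b)"
  define V :: "3 \<Rightarrow> real ^ 3 \<Rightarrow> real" where "V = (\<lambda>b x. A b x * inverse (norm x) * inverse (R x))"
  define V' :: "3 \<Rightarrow> real ^ 3 \<Rightarrow> real ^ 3 \<Rightarrow> real" where
    "V' = (\<lambda>b x v. (2 * d b * (x \<bullet> v) - v $ 3 * x $ b - x $ 3 * v $ b) * inverse (norm x) * inverse (R x)
       - A b x * (x \<bullet> v) * inverse (norm x ^ 3) * inverse (R x)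
       - A b x * inverse (norm x) * (2 * (x \<bullet> v) - 2 * x $ 3 * v $ 3) * inverse (R x ^ 2))"
  have lin: "Ck_on n Dm (\<lambda>x. x $ b)" for n b
    by (rule Ck_on_linear[OF bounded_linear_vec_nth oD])
  have V: "Ck_on n Dm (V b)" for b n
  proof -
    have "Ck_on n Dm (\<lambda>x. x \<bullet> x + (- 1) * (x $ 3 * x $ 3))"
      by (intro Ck_on_add Ck_on_mult oD Ck_on_inner_self Ck_on_const lin)
    then have "Ck_on n Dm R" by (simp add: R_def)
    from Ck_on_compose[OF oD Ck_on_powr[of n 1 "-1"] this] Rpos
    have Rm: "Ck_on n Dm (\<lambda>x. 1 * R x powr (-1))" by auto
    have "Ck_on n Dm (\<lambda>x. ((d b * (x \<bullet> x) + (- 1) * (x $ 3 * x $ b)) * norm x powr (-1)) * (1 * R x powr (-1)))"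
      by (intro Ck_on_add Ck_on_mult oD Ck_on_inner_self Ck_on_const lin Rm Ck_on_norm_powr D0)
    then show ?thesis
    proof (rule iffD1[OF Ck_on_cong[OF oD], rotated])
      fix x assume x: "x \<in> Dm"
      show "((d b * (x \<bullet> x) + (- 1) * (x $ 3 * x $ b)) * norm x powr (-1)) * (1 * R x powr (-1)) = V b x"
        using Dom_facts(2)[OF x] Rpos[OF x] by (simp add: V_def A_def powr_minus)
    qed
  qed
  have V'b: "(V b has_derivative V' b x) (at x)" if x: "x \<in> Dm" for b x
  proof -
    note n = Dom_facts(1,2)[OF x]
    have ii: "((\<lambda>x::real ^ 3. x \<bullet> x) has_derivative (\<lambda>v. 2 * (x \<bullet> v))) (at x)"
      by (auto intro!: derivative_eq_intros simp: inner_commute)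
    have RR: "(R has_derivative (\<lambda>v. 2 * (x \<bullet> v) - (x $ 3 * v $ 3 + v $ 3 * x $ 3))) (at x)"
      unfolding R_def by (intro has_derivative_diff ii has_derivative_mult has_derivative_nth)
    have Rm: "((\<lambda>x. inverse (R x)) has_derivative
        (\<lambda>v. - (inverse (R x) * (2 * (x \<bullet> v) - (x $ 3 * v $ 3 + v $ 3 * x $ 3)) * inverse (R x)))) (at x)"
      using Rpos[OF x] by (intro Deriv.has_derivative_inverse RR) auto
    have Nm: "((\<lambda>x::real ^ 3. inverse (norm x)) has_derivative
        (\<lambda>v. - (inverse (norm x) * ((x \<bullet> v) / norm x) * inverse (norm x)))) (at x)"
      using n by (intro Deriv.has_derivative_inverse has_derivative_norm_vec) auto
    have AA: "(A b has_derivative (\<lambda>v. d b * (2 * (x \<bullet> v)) - (x $ 3 * v $ b + v $ 3 * x $ b))) (at x)"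
      unfolding A_def by (intro has_derivative_diff has_derivative_mult_right ii has_derivative_mult has_derivative_nth)
    from has_derivative_mult[OF has_derivative_mult[OF AA Nm] Rm]
    have "(V b has_derivative (\<lambda>v. A b x * inverse (norm x) *
          - (inverse (R x) * (2 * (x \<bullet> v) - (x $ 3 * v $ 3 + v $ 3 * x $ 3)) * inverse (R x))
        + (A b x * - (inverse (norm x) * ((x \<bullet> v) / norm x) * inverse (norm x))
          + (d b * (2 * (x \<bullet> v)) - (x $ 3 * v $ b + v $ 3 * x $ b)) * inverse (norm x)) * inverse (R x))) (at x)"
      unfolding V_def .
    then show ?thesis
    proof (rule has_derivative_eq_rhs)
      define r i where "r = inverse (norm x)" and "i = inverse (R x)"
      have e: "inverse (norm x ^ 3) = r * r * r" "inverse (R x ^ 2) = i * i" "y / norm x = y * r" for y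
        by (simp_all add: r_def i_def power3_eq_cube power2_eq_square divide_inverse)
      show "(\<lambda>v. A b x * inverse (norm x) *
          - (inverse (R x) * (2 * (x \<bullet> v) - (x $ 3 * v $ 3 + v $ 3 * x $ 3)) * inverse (R x))
        + (A b x * - (inverse (norm x) * ((x \<bullet> v) / norm x) * inverse (norm x))
          + (d b * (2 * (x \<bullet> v)) - (x $ 3 * v $ b + v $ 3 * x $ b)) * inverse (norm x)) * inverse (R x)) = V' b x"
        unfolding V'_def e r_def[symmetric] i_def[symmetric] by (simp add: fun_eq_iff algebra_simps)
    qed
  qed
  have inn: "x \<bullet> x = x $ 1 * x $ 1 + x $ 2 * x $ 2 + x $ 3 * x $ 3" for x :: "real ^ 3"
    by (simp add: inner_vec_def sum_3)
  have A0: "x $ 1 * A 1 x + x $ 2 * A 2 x + x $ 3 * A 3 x = 0" for x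
    by (simp add: A_def d inn algebra_simps)
  have A3: "A 3 x = R x" for x by (simp add: A_def R_def d)
  have rad: "x $ 1 * V 1 x + x $ 2 * V 2 x + x $ 3 * V 3 x = 0" for x
  proof -
    have "x $ 1 * V 1 x + x $ 2 * V 2 x + x $ 3 * V 3 x
      = (x $ 1 * A 1 x + x $ 2 * A 2 x + x $ 3 * A 3 x) * inverse (norm x) * inverse (R x)"
      by (simp add: V_def algebra_simps)
    then show ?thesis by (simp only: A0 mult_zero_left)
  qed
  have div: "V' 1 x (axis 1 1) + V' 2 x (axis 2 1) + V' 3 x (axis 3 1) = 0" if x: "x \<in> Dm" for x
  proof -
    define r i where "r = inverse (norm x)" and "i = inverse (R x)"
    have ri: "R x * i = 1" using Rpos[OF x] by (simp add: i_def)
    have ax: "axis (1::3) (1::real) $ 3 = 0" "axis (2::3) (1::real) $ 3 = 0" "axis (3::3) (1::real) $ 3 = 1"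
      "axis b (1::real) $ b = 1" for b :: 3
      by (simp_all add: axis_def)
    \<comment> \<open>After x \<bullet> A = 0 there remains - 2 x_3 r i (1 - A_3 i), which is 0
      because A_3 = R = 1/i.\<close>
    have "V' 1 x (axis 1 1) + V' 2 x (axis 2 1) + V' 3 x (axis 3 1)
      = - 2 * x $ 3 * r * i - (x $ 1 * A 1 x + x $ 2 * A 2 x + x $ 3 * A 3 x) * (inverse (norm x ^ 3) * i + 2 * r * i * i)
        + 2 * x $ 3 * r * i * (A 3 x * i)"
      unfolding V'_def inner_axis_real3 ax d r_def[symmetric] i_def[symmetric]
      by (simp add: i_def[symmetric] power2_eq_square algebra_simps)
    then show ?thesis unfolding A0 unfolding A3 ri by simp
  qed
  have "(\<integral>x. f x * (\<eta> (norm x) * deriv h (x $ 3 / norm x)) / (norm x)\<^sup>2 \<partial>lebesgue_on Dm)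
    = (\<integral>x. f x * field_div \<eta> h V x
        \<partial>lebesgue_on Dm)"
  proof (rule Bochner_Integration.integral_cong[OF refl])
    fix x assume "x \<in> space (lebesgue_on Dm)"
    then have x: "x \<in> Dm" by (simp add: space_restrict_space)
    have V3: "V 3 x = inverse (norm x)" using Rpos[OF x] by (simp add: V_def A3)
    show "f x * (\<eta> (norm x) * deriv h (x $ 3 / norm x)) / (norm x)\<^sup>2
      = f x * field_div \<eta> h V x"
      unfolding field_div_def rad unfolding V3 by (simp add: power2_eq_square divide_inverse)
  qed
  also have "\<dots> = - (\<integral>x. (G x $ 1 * V 1 x + G x $ 2 * V 2 x + G x $ 3 * V 3 x) * (\<eta> (norm x) * h (x $ 3 / norm x))
        \<partial>lebesgue_on Dm)"
    by (rule weak_gradient_field[OF assms V V'b div])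
  also have "(\<lambda>x. G x $ 1 * V 1 x + G x $ 2 * V 2 x + G x $ 3 * V 3 x)
    = (\<lambda>x. G x \<bullet> (((norm x)\<^sup>2 *\<^sub>R axis 3 1 - x $ 3 *\<^sub>R x) /\<^sub>R (norm x * ((norm x)\<^sup>2 - (x $ 3)\<^sup>2))))"
  proof (rule ext)
    fix x
    show "G x $ 1 * V 1 x + G x $ 2 * V 2 x + G x $ 3 * V 3 x
      = G x \<bullet> (((norm x)\<^sup>2 *\<^sub>R axis 3 1 - x $ 3 *\<^sub>R x) /\<^sub>R (norm x * ((norm x)\<^sup>2 - (x $ 3)\<^sup>2)))"
      unfolding R[symmetric] unfolding power2_norm_eq_inner
      by (simp add: V_def A_def d_def inner_vec_def[of "G x"] sum_3 algebra_simps)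
  qed
  finally show ?thesis .
qed

section \<open>The two fields in terms of the coordinate vectors\<close>

lemma sph_rho_Dom: "x \<in> Dm \<Longrightarrow> sph_rho x = x /\<^sub>R norm x"
proof -
  assume x: "x \<in> Dm"
  have "norm x *\<^sub>R sph_rho x = sph (rho x) (phi x) (theta x)"
    unfolding sph_rho_eq sph_def rho_def by (simp add: vec_eq_iff forall_3)
  also have "\<dots> = x" by (rule sph_coords[OF Dom_facts(1)[OF x]])
  finally have "norm x *\<^sub>R sph_rho x = x" .
  then have "x /\<^sub>R norm x = (norm x *\<^sub>R sph_rho x) /\<^sub>R norm x" by simp
  also have "\<dots> = sph_rho x" using Dom_facts(2)[OF x] by simp
  finally show ?thesis by simp
qed

lemma phi_Dom:
  assumes "x \<in> Dm"
  shows "cos (phi x) = x $ 3 / norm x" "sin (phi x) = sqrt (1 - (x $ 3 / norm x)\<^sup>2)" "sin (phi x) > 0"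
proof -
  have c: "\<bar>x $ 3 / norm x\<bar> \<le> 1 / 2" by (rule Dom_facts[OF assms])
  then have c1: "\<bar>x $ 3 / norm x\<bar> \<le> 1" by linarith
  show "cos (phi x) = x $ 3 / norm x" unfolding phi_def by (rule cos_arccos_abs[OF c1])
  show "sin (phi x) = sqrt (1 - (x $ 3 / norm x)\<^sup>2)" unfolding phi_def by (rule sin_arccos_abs[OF c1])
  then show "sin (phi x) > 0" using one_minus_square_pos[OF c order_refl] by simp
qed

text \<open>By dc = - sin \<phi> d\<phi>, the derivative of x in c is - \<open>sph_phi x\<close> /
  sin \<phi>; the polar field is \<rho>^(-2) times this vector.\<close>

lemma sph_phi_Dom:
  assumes x: "x \<in> Dm"
  shows "((norm x)\<^sup>2 *\<^sub>R axis 3 1 - x $ 3 *\<^sub>R x) /\<^sub>R (norm x * ((norm x)\<^sup>2 - (x $ 3)\<^sup>2))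
      = - (inverse ((norm x)\<^sup>2 * sin (phi x))) *\<^sub>R sph_phi x"
proof -
  note n = Dom_facts(2)[OF x] and s = phi_Dom(3)[OF x]
  have co: "x $ 1 = norm x * sin (phi x) * cos (theta x)" "x $ 2 = norm x * sin (phi x) * sin (theta x)"
    "x $ 3 = norm x * cos (phi x)"
    using arg_cong[OF sph_coords[OF Dom_facts(1)[OF x]], of "\<lambda>v. v $ 1"]
      arg_cong[OF sph_coords[OF Dom_facts(1)[OF x]], of "\<lambda>v. v $ 2"]
      arg_cong[OF sph_coords[OF Dom_facts(1)[OF x]], of "\<lambda>v. v $ 3"]
    by (simp_all add: sph_def rho_def)
  have R: "(norm x)\<^sup>2 - (x $ 3)\<^sup>2 = (norm x)\<^sup>2 * (sin (phi x))\<^sup>2"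
    unfolding co(3) power_mult_distrib sin_squared_eq by (simp add: algebra_simps)
  have cs: "(cos (phi x))\<^sup>2 = 1 - (sin (phi x))\<^sup>2" by (simp add: cos_squared_eq)
  define N S C c1 s1 where "N = norm x" and "S = sin (phi x)" and "C = cos (phi x)"
    and "c1 = cos (theta x)" and "s1 = sin (theta x)"
  have N: "N > 0" "S > 0" using n s by (simp_all add: N_def S_def)
  have 1: "inverse (N * (N\<^sup>2 * S\<^sup>2)) * - (N * C * (N * S * y)) = - (inverse (N\<^sup>2 * S) * (N * (C * y)))" for y
    using N by (simp add: field_simps power2_eq_square)
  have E: "N\<^sup>2 - N * C * (N * C) = N\<^sup>2 * S\<^sup>2"
    using cs unfolding C_def[symmetric] S_def[symmetric] by algebra
  have 2: "inverse (N * (N\<^sup>2 * S\<^sup>2)) * (N\<^sup>2 - N * C * (N * C)) = - (inverse (N\<^sup>2 * S) * (N * - S))"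
    unfolding E using N by (simp add: field_simps power2_eq_square)
  show ?thesis
    unfolding vec_eq_iff forall_3 R
    unfolding sph_phi_eq rho_def vector_minus_component vector_scaleR_component
      vector_3 co N_def[symmetric] S_def[symmetric] C_def[symmetric] c1_def[symmetric] s1_def[symmetric]
    using 1[of c1] 1[of s1] 2 by (simp add: axis_def)
qed

end

section \<open>Averages over the azimuthal angle\<close>

lemma finite_measure_lebI3: "finite_measure (lebI2 a b c d \<Otimes>\<^sub>M lebI a' b')"
  by (intro finite_measure_pair_measure finite_measure_lebI2 finite_measure_lebI)

interpretation lebI3: finite_measure "lebI2 a b c d \<Otimes>\<^sub>M lebI a' b'" for a b c d a' b'
  by (rule finite_measure_lebI3)

interpretation lebI2_pair: pair_sigma_finite "lebI2 a b c d" "lebI a' b'" for a b c d a' b'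
  using finite_measure.axioms(1)[OF finite_measure_lebI2] lebI.sigma_finite_measure_axioms
  by (simp add: pair_sigma_finite_def)

abbreviation lebT :: "real measure" where "lebT \<equiv> lebI 0 (2 * pi)"

lemma integral_lebT_const: "(\<integral>t. k \<partial>lebT) = 2 * pi * (k :: real)"
proof -
  have "(\<integral>t. 1 \<partial>lebT) = 2 * pi"
    using AC_integral[OF AC_C1[of 0 "2 * pi" "\<lambda>x. x" "\<lambda>_. 1"]] by simp
  moreover have "(\<integral>t. k \<partial>lebT) = k * (\<integral>t. 1 \<partial>lebT)"
    by (subst integral_mult_right_zero[symmetric]) simp
  ultimately show ?thesis by simp
qed

lemma measure_lebT: "measure lebT {0<..<2 * pi} = 2 * pi"
  using integral_lebT_const[of 1] by simp

definition avg :: "((real \<times> real) \<times> real \<Rightarrow> real) \<Rightarrow> real \<times> real \<Rightarrow> real" where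
  "avg u y = (\<integral>t. u (y, t) \<partial>lebT) / (2 * pi)"

context
  fixes a b c d :: real and u :: "(real \<times> real) \<times> real \<Rightarrow> real"
  assumes meas: "u \<in> borel_measurable (lebI2 a b c d \<Otimes>\<^sub>M lebT)"
    and sq: "integrable (lebI2 a b c d \<Otimes>\<^sub>M lebT) (\<lambda>p. (u p)\<^sup>2)"
begin

lemma avg_int: "integrable (lebI2 a b c d \<Otimes>\<^sub>M lebT) u"
  by (rule lebI3.integrable_of_square[OF meas sq])

lemma avg_measurable: "avg u \<in> borel_measurable (lebI2 a b c d)"
  using lebI2_pair.integrable_fst'[OF avg_int] unfolding avg_def[abs_def] by auto

lemma avg_jensen: "AE y in lebI2 a b c d. 2 * pi * (avg u y)\<^sup>2 \<le> (\<integral>t. (u (y, t))\<^sup>2 \<partial>lebT)"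
  using lebI2_pair.AE_integrable_fst'[OF avg_int] lebI2_pair.AE_integrable_fst'[OF sq]
proof eventually_elim
  case (elim y)
  have "0 \<le> (\<integral>t. (u (y, t) - avg u y)\<^sup>2 \<partial>lebT)"
    by (rule Bochner_Integration.integral_nonneg) simp
  also have "\<dots> = (\<integral>t. (u (y, t))\<^sup>2 - 2 * avg u y * u (y, t) + (avg u y)\<^sup>2 \<partial>lebT)"
    by (rule Bochner_Integration.integral_cong) (simp_all add: power2_eq_square algebra_simps)
  also have "\<dots> = (\<integral>t. (u (y, t))\<^sup>2 \<partial>lebT) - 2 * avg u y * (\<integral>t. u (y, t) \<partial>lebT) + 2 * pi * (avg u y)\<^sup>2"
    using elim by (simp add: measure_lebT)
  also have "(\<integral>t. u (y, t) \<partial>lebT) = 2 * pi * avg u y" by (simp add: avg_def)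
  finally show ?case by (simp add: power2_eq_square algebra_simps)
qed

lemma avg_square_integrable: "integrable (lebI2 a b c d) (\<lambda>y. (avg u y)\<^sup>2)"
proof (rule Bochner_Integration.integrable_bound)
  show "integrable (lebI2 a b c d) (\<lambda>y. (\<integral>t. (u (y, t))\<^sup>2 \<partial>lebT) / (2 * pi))"
    using lebI2_pair.integrable_fst'[OF sq] by simp
  show "(\<lambda>y. (avg u y)\<^sup>2) \<in> borel_measurable (lebI2 a b c d)"
    using avg_measurable by measurable
  show "AE y in lebI2 a b c d. norm ((avg u y)\<^sup>2) \<le> norm ((\<integral>t. (u (y, t))\<^sup>2 \<partial>lebT) / (2 * pi))"
    using avg_jensen
  proof eventually_elim
    case (elim y)
    then have "(avg u y)\<^sup>2 \<le> (\<integral>t. (u (y, t))\<^sup>2 \<partial>lebT) / (2 * pi)"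
      by (simp add: field_simps)
    also have "\<dots> \<le> norm \<dots>" unfolding real_norm_def by (rule abs_ge_self)
    finally show ?case by simp
  qed
qed

context
  fixes \<phi> :: "real \<times> real \<Rightarrow> real" and C :: real
  assumes \<phi>: "\<phi> \<in> borel_measurable (lebI2 a b c d)" "\<And>y. y \<in> space (lebI2 a b c d) \<Longrightarrow> \<bar>\<phi> y\<bar> \<le> C"
begin

lemma integrable_mult_fst:
  assumes "integrable (lebI2 a b c d \<Otimes>\<^sub>M lebT) v"
  shows "integrable (lebI2 a b c d \<Otimes>\<^sub>M lebT) (\<lambda>p. v p * \<phi> (fst p))"
  by (rule integrable_bounded_mult[OF assms, where C=C])
     (use \<phi> in \<open>auto simp: space_pair_measure\<close>)

lemma avg_linear:
  "(\<integral>p. u p * \<phi> (fst p) \<partial>(lebI2 a b c d \<Otimes>\<^sub>M lebT)) = 2 * pi * (\<integral>y. avg u y * \<phi> y \<partial>lebI2 a b c d)"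
proof -
  have "(\<integral>p. u p * \<phi> (fst p) \<partial>(lebI2 a b c d \<Otimes>\<^sub>M lebT))
      = (\<integral>y. (\<integral>t. u (y, t) * \<phi> y \<partial>lebT) \<partial>lebI2 a b c d)"
    using lebI2_pair.integral_fst'[OF integrable_mult_fst[OF avg_int]] by simp
  also have "\<dots> = (\<integral>y. 2 * pi * (avg u y * \<phi> y) \<partial>lebI2 a b c d)"
    by (rule Bochner_Integration.integral_cong) (simp_all add: avg_def)
  finally show ?thesis by simp
qed

text \<open>Jensen on each circle. This serves the two derivatives, whose dependence on \<theta> is
  unknown and which stand on the larger side of the final inequality.\<close>

lemma avg_square_le:
  assumes "\<And>y. y \<in> space (lebI2 a b c d) \<Longrightarrow> 0 \<le> \<phi> y"
  shows "2 * pi * (\<integral>y. (avg u y)\<^sup>2 * \<phi> y \<partial>lebI2 a b c d)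
    \<le> (\<integral>p. (u p)\<^sup>2 * \<phi> (fst p) \<partial>(lebI2 a b c d \<Otimes>\<^sub>M lebT))"
proof -
  have i: "integrable (lebI2 a b c d \<Otimes>\<^sub>M lebT) (\<lambda>p. (u p)\<^sup>2 * \<phi> (fst p))"
    by (rule integrable_mult_fst[OF sq])
  have "2 * pi * (\<integral>y. (avg u y)\<^sup>2 * \<phi> y \<partial>lebI2 a b c d)
      = (\<integral>y. 2 * pi * ((avg u y)\<^sup>2 * \<phi> y) \<partial>lebI2 a b c d)" by simp
  also have "\<dots> \<le> (\<integral>y. (\<integral>t. (u (y, t))\<^sup>2 * \<phi> y \<partial>lebT) \<partial>lebI2 a b c d)"
  proof (rule integral_mono_AE)
    show "AE y in lebI2 a b c d. 2 * pi * ((avg u y)\<^sup>2 * \<phi> y) \<le> (\<integral>t. (u (y, t))\<^sup>2 * \<phi> y \<partial>lebT)"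
      using avg_jensen AE_space
    proof eventually_elim
      case (elim y)
      from mult_right_mono[OF elim(1) assms[OF elim(2)]] show ?case by simp
    qed
    show "integrable (lebI2 a b c d) (\<lambda>y. 2 * pi * ((avg u y)\<^sup>2 * \<phi> y))"
      using integrable_bounded_mult[OF avg_square_integrable \<phi>] by simp
    show "integrable (lebI2 a b c d) (\<lambda>y. \<integral>t. (u (y, t))\<^sup>2 * \<phi> y \<partial>lebT)"
      using lebI2_pair.integrable_fst'[OF i] by simp
  qed
  also have "\<dots> = (\<integral>p. (u p)\<^sup>2 * \<phi> (fst p) \<partial>(lebI2 a b c d \<Otimes>\<^sub>M lebT))"
    using lebI2_pair.integral_fst'[OF i] by simp
  finally show ?thesis .
qed

text \<open>Serves f itself, which stands on the smaller side, where the Jensen inequality would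
  point the wrong way.\<close>

lemma avg_square_eq:
  assumes "AE p in lebI2 a b c d \<Otimes>\<^sub>M lebT. u p = avg u (fst p)"
  shows "(\<integral>p. (u p)\<^sup>2 * \<phi> (fst p) \<partial>(lebI2 a b c d \<Otimes>\<^sub>M lebT))
    = 2 * pi * (\<integral>y. (avg u y)\<^sup>2 * \<phi> y \<partial>lebI2 a b c d)"
proof -
  have i: "integrable (lebI2 a b c d \<Otimes>\<^sub>M lebT) (\<lambda>p. (u p)\<^sup>2 * \<phi> (fst p))"
    by (rule integrable_mult_fst[OF sq])
  note [measurable] = avg_measurable meas \<phi>(1)
  have eq: "AE p in lebI2 a b c d \<Otimes>\<^sub>M lebT. (u p)\<^sup>2 * \<phi> (fst p) = (avg u (fst p))\<^sup>2 * \<phi> (fst p)"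
    using assms by eventually_elim simp
  have j: "integrable (lebI2 a b c d \<Otimes>\<^sub>M lebT) (\<lambda>p. (avg u (fst p))\<^sup>2 * \<phi> (fst p))"
    by (rule integrable_cong_AE_imp[OF i]) (use eq in \<open>auto elim: eventually_mono\<close>)
  have "(\<integral>p. (u p)\<^sup>2 * \<phi> (fst p) \<partial>(lebI2 a b c d \<Otimes>\<^sub>M lebT))
      = (\<integral>p. (avg u (fst p))\<^sup>2 * \<phi> (fst p) \<partial>(lebI2 a b c d \<Otimes>\<^sub>M lebT))"
    by (rule integral_cong_AE[OF _ _ eq]) measurable
  also have "\<dots> = (\<integral>y. (\<integral>t. (avg u y)\<^sup>2 * \<phi> y \<partial>lebT) \<partial>lebI2 a b c d)"
    using lebI2_pair.integral_fst'[OF j] by simp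
  also have "\<dots> = (\<integral>y. 2 * pi * ((avg u y)\<^sup>2 * \<phi> y) \<partial>lebI2 a b c d)"
    by (simp only: integral_lebT_const)
  finally show ?thesis by simp
qed

end

text \<open>Axial symmetry provides some function \<gamma> with no measurability known. On almost
  every circle u is constant almost everywhere, hence equal to its average, which is a measurable
  substitute for \<gamma>.\<close>

lemma avg_eq_AE:
  assumes "AE p in lebI2 a b c d \<Otimes>\<^sub>M lebT. u p = \<gamma> (fst p)"
  shows "AE p in lebI2 a b c d \<Otimes>\<^sub>M lebT. u p = avg u (fst p)"
proof (rule lebI2_pair.AE_pair_measure)
  note [measurable] = avg_measurable meas
  show "{p \<in> space (lebI2 a b c d \<Otimes>\<^sub>M lebT). u p = avg u (fst p)} \<in> sets (lebI2 a b c d \<Otimes>\<^sub>M lebT)"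
    by measurable
  show "AE y in lebI2 a b c d. AE t in lebT. u (y, t) = avg u (fst (y, t))"
    using lebI2_pair.AE_pair[OF assms] lebI2_pair.AE_integrable_fst'[OF avg_int]
  proof eventually_elim
    case (elim y)
    have "(\<integral>t. u (y, t) \<partial>lebT) = (\<integral>t. \<gamma> y \<partial>lebT)"
      by (rule integral_cong_AE) (use elim in auto)
    then have "avg u y = \<gamma> y" unfolding avg_def integral_lebT_const by simp
    with elim(1) show ?case by simp
  qed
qed

end

context spherical_domain
begin

section \<open>Change of variables for Lebesgue measurable functions\<close>

abbreviation Sp :: "(real \<times> real) \<times> real \<Rightarrow> real ^ 3" where
  "Sp p \<equiv> sphc (fst (fst p)) (snd (fst p)) (snd p)"

abbreviation rect :: "(real \<times> real) measure" where
  "rect \<equiv> lebI2 (1 / m) 1 (- sin \<alpha>) (sin \<alpha>)"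

abbreviation sphM :: "((real \<times> real) \<times> real) measure" where
  "sphM \<equiv> rect \<Otimes>\<^sub>M lebT"

lemma rect_D: "y \<in> space rect \<Longrightarrow> 1 / m < fst y \<and> fst y < 1 \<and> 0 < fst y \<and> \<bar>snd y\<bar> < sin \<alpha> \<and> \<bar>snd y\<bar> \<le> 1 / 2"
proof -
  assume y: "y \<in> space rect"
  have "0 \<le> 1 / real_of_int m" using m by simp
  moreover have "1 / m < fst y" "fst y < 1" "\<bar>snd y\<bar> < sin \<alpha>"
    using y by (auto simp: space_lebI2 abs_less_iff)
  ultimately show ?thesis using sin_alpha_bounds by linarith
qed

lemma Sp_D:
  assumes "p \<in> space sphM"
  shows "Sp p \<in> Dm" "norm (Sp p) = fst (fst p)" "Sp p $ 3 / norm (Sp p) = snd (fst p)"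
    "rho (Sp p) = fst (fst p)" "phi (Sp p) = arccos (snd (fst p))"
proof -
  have f: "fst p \<in> space rect" and t: "0 < snd p" "snd p < 2 * pi"
    using assms by (auto simp: space_pair_measure)
  note r = rect_D[OF f]
  show "Sp p \<in> Dm" using r by (intro sphc_Dom) auto
  have "\<bar>snd (fst p)\<bar> < 1" using r by linarith
  note sc = sphc_coordinates[OF _ this, of "fst (fst p)" "snd p"]
  show rh: "rho (Sp p) = fst (fst p)" and "phi (Sp p) = arccos (snd (fst p))"
    using sc r t by auto
  then show n: "norm (Sp p) = fst (fst p)" by (simp add: rho_def)
  show "Sp p $ 3 / norm (Sp p) = snd (fst p)"
    unfolding n using r by (simp add: sphc_def)
qed

lemma Sp_measurable: "Sp \<in> borel_measurable sphM"
proof -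
  have [measurable]: "(\<lambda>p. fst (fst p)) \<in> borel_measurable sphM" "(\<lambda>p. snd (fst p)) \<in> borel_measurable sphM"
    using measurable_compose[OF measurable_fst measurable_lebI_fst]
      measurable_compose[OF measurable_fst measurable_lebI_snd] by blast+
  show ?thesis by measurable
qed

lemma r_measurable: "(\<lambda>p. (fst (fst p))\<^sup>2) \<in> borel_measurable sphM"
proof -
  have [measurable]: "(\<lambda>p. fst (fst p)) \<in> borel_measurable sphM"
    using measurable_compose[OF measurable_fst measurable_lebI_fst] by blast
  show ?thesis by measurable
qed

text \<open>Null sets pull back along the parametrization because the density \<rho>^2 is positive
  on the rectangle.\<close>

lemma AE_sph:
  assumes "AE x in lebesgue_on Dm. Q x"
  shows "AE p in sphM. Q (Sp p)"
proof -
  have dm: "Dm \<in> sets borel" using open_Dom by auto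
  have "AE x in lebesgue. x \<in> Dm \<longrightarrow> Q x"
    using assms dm by (subst (asm) AE_restrict_space_iff) auto
  then have "AE x in lborel. x \<in> Dm \<longrightarrow> Q x"
    by (simp only: AE_completion_iff)
  then have "AE x in density lborel (indicator Dm). Q x"
    using dm by (subst AE_density) (auto elim!: eventually_mono simp: indicator_def split: if_splits)
  then have "AE x in distr (density sphM (\<lambda>p. ennreal ((fst (fst p))\<^sup>2))) borel Sp. Q x"
    by (simp only: spherical_measure)
  then have "AE p in density sphM (\<lambda>p. ennreal ((fst (fst p))\<^sup>2)). Q (Sp p)"
    by (rule AE_distrD[rotated]) (use Sp_measurable in simp)
  then have "AE p in sphM. 0 < ennreal ((fst (fst p))\<^sup>2) \<longrightarrow> Q (Sp p)"
    using r_measurable by (subst (asm) AE_density) auto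
  then show ?thesis
    using AE_space
  proof eventually_elim
    case (elim p)
    then have "fst p \<in> space rect" by (auto simp: space_pair_measure)
    then have "0 < fst (fst p)" using rect_D by blast
    then show ?case using elim(1) by simp
  qed
qed

text \<open>Elements of \<open>L2\<close> are measurable for the completed measure, whereas the
  pushforward formula concerns Borel sets; a Borel version is therefore chosen first.\<close>

lemma borel_representative:
  fixes w :: "real ^ 3 \<Rightarrow> real"
  assumes "w \<in> borel_measurable (lebesgue_on Dm)"
  obtains w' where "w' \<in> borel_measurable borel" "AE x in lebesgue_on Dm. w x = w' x"
proof -
  have dm: "Dm \<in> sets borel" using open_Dom by auto
  have "(\<lambda>x. indicator Dm x *\<^sub>R w x) \<in> borel_measurable lebesgue"
    using assms dm by (subst (asm) borel_measurable_restrict_space_iff) auto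
  then obtain w' where w': "w' \<in> borel_measurable lborel" "AE x in lborel. indicator Dm x *\<^sub>R w x = w' x"
    using completion_ex_borel_measurable_real by blast
  have "AE x in lebesgue. indicator Dm x *\<^sub>R w x = w' x"
    using w'(2) by (simp only: AE_completion_iff)
  then have "AE x in lebesgue. x \<in> Dm \<longrightarrow> w x = w' x"
    by eventually_elim auto
  then have "AE x in lebesgue_on Dm. w x = w' x"
    using dm by (subst AE_restrict_space_iff) auto
  then show ?thesis using that w'(1) by simp
qed

lemma measurable_lebesgue_Dm: "w \<in> borel_measurable borel \<Longrightarrow> w \<in> borel_measurable (lebesgue_on Dm)"
  by (intro measurable_restrict_space1 measurable_completion) simp

text \<open>The composition of a Lebesgue measurable w with \<open>Sp\<close> need not be measurable
  for \<open>sphM\<close>; it is replaced by a measurable \<open>w3\<close> that agrees with it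
  almost everywhere.\<close>

lemma sph_representative:
  fixes w :: "real ^ 3 \<Rightarrow> real"
  assumes "w \<in> borel_measurable (lebesgue_on Dm)"
  obtains w3 where "w3 \<in> borel_measurable sphM" "AE p in sphM. w (Sp p) = w3 p"
proof -
  obtain w' where w': "w' \<in> borel_measurable borel" "AE x in lebesgue_on Dm. w x = w' x"
    using borel_representative[OF assms] .
  have "(\<lambda>p. w' (Sp p)) \<in> borel_measurable sphM"
    by (rule measurable_compose[OF Sp_measurable w'(1)])
  then show ?thesis using that AE_sph[OF w'(2)] by blast
qed

lemma sph_transfer:
  fixes w :: "real ^ 3 \<Rightarrow> real"
  assumes w: "w \<in> borel_measurable (lebesgue_on Dm)" and w3: "w3 \<in> borel_measurable sphM"
    and eq: "AE p in sphM. w (Sp p) = w3 p"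
  shows "integrable (lebesgue_on Dm) w \<longleftrightarrow> integrable sphM (\<lambda>p. (fst (fst p))\<^sup>2 * w3 p)" (is ?A)
    and "(\<integral>x. w x \<partial>lebesgue_on Dm) = (\<integral>p. (fst (fst p))\<^sup>2 * w3 p \<partial>sphM)" (is ?B)
proof -
  have dm[measurable]: "Dm \<in> sets borel" using open_Dom by auto
  obtain w' where w'[measurable]: "w' \<in> borel_measurable borel" and ae: "AE x in lebesgue_on Dm. w x = w' x"
    using borel_representative[OF w] .
  have w'D: "w' \<in> borel_measurable (lebesgue_on Dm)" by (rule measurable_lebesgue_Dm[OF w'])
  have w'S: "(\<lambda>p. w' (Sp p)) \<in> borel_measurable sphM"
    by (rule measurable_compose[OF Sp_measurable w'])
  have ind: "(indicator Dm :: _ \<Rightarrow> ennreal) = (\<lambda>x. ennreal (indicator Dm x))"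
    by (auto simp: fun_eq_iff indicator_def)
  have ae3: "AE p in sphM. (fst (fst p))\<^sup>2 *\<^sub>R w' (Sp p) = (fst (fst p))\<^sup>2 * w3 p"
    using AE_sph[OF ae] eq by eventually_elim simp
  have m1: "(\<lambda>p. (fst (fst p))\<^sup>2 *\<^sub>R w' (Sp p)) \<in> borel_measurable sphM"
    "(\<lambda>p. (fst (fst p))\<^sup>2 * w3 p) \<in> borel_measurable sphM"
    using r_measurable w'S w3 by measurable
  have Sd: "Sp \<in> measurable (density sphM (\<lambda>p. ennreal ((fst (fst p))\<^sup>2))) borel"
    using Sp_measurable by simp
  have iw: "(\<lambda>x. indicator Dm x *\<^sub>R w' x) \<in> borel_measurable lborel" by measurable
  have "integrable (lebesgue_on Dm) w \<longleftrightarrow> integrable (lebesgue_on Dm) w'"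
    by (rule integrable_cong_AE[OF w w'D ae])
  also have "\<dots> \<longleftrightarrow> integrable lebesgue (\<lambda>x. indicator Dm x *\<^sub>R w' x)"
    by (subst integrable_restrict_space) auto
  also have "\<dots> \<longleftrightarrow> integrable lborel (\<lambda>x. indicator Dm x *\<^sub>R w' x)"
    by (rule integrable_completion[OF iw])
  also have "\<dots> \<longleftrightarrow> integrable (density lborel (indicator Dm)) w'"
    unfolding ind by (subst integrable_density) auto
  also have "\<dots> \<longleftrightarrow> integrable (density sphM (\<lambda>p. ennreal ((fst (fst p))\<^sup>2))) (\<lambda>p. w' (Sp p))"
    unfolding spherical_measure by (rule integrable_distr_eq[OF Sd w'])
  also have "\<dots> \<longleftrightarrow> integrable sphM (\<lambda>p. (fst (fst p))\<^sup>2 *\<^sub>R w' (Sp p))"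
    by (rule integrable_density[OF w'S r_measurable]) simp
  also have "\<dots> \<longleftrightarrow> integrable sphM (\<lambda>p. (fst (fst p))\<^sup>2 * w3 p)"
    by (rule integrable_cong_AE[OF m1 ae3])
  finally show ?A .
  have "(\<integral>x. w x \<partial>lebesgue_on Dm) = (\<integral>x. w' x \<partial>lebesgue_on Dm)"
    by (rule integral_cong_AE[OF w w'D ae])
  also have "\<dots> = (\<integral>x. indicator Dm x *\<^sub>R w' x \<partial>lebesgue)"
    by (subst integral_restrict_space) auto
  also have "\<dots> = (\<integral>x. indicator Dm x *\<^sub>R w' x \<partial>lborel)"
    by (rule integral_completion[OF iw])
  also have "\<dots> = (\<integral>x. w' x \<partial>density lborel (indicator Dm))"
    unfolding ind by (subst integral_density) auto
  also have "\<dots> = (\<integral>p. w' (Sp p) \<partial>density sphM (\<lambda>p. ennreal ((fst (fst p))\<^sup>2)))"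
    unfolding spherical_measure by (rule integral_distr[OF Sd w'])
  also have "\<dots> = (\<integral>p. (fst (fst p))\<^sup>2 *\<^sub>R w' (Sp p) \<partial>sphM)"
    by (rule integral_density[OF w'S r_measurable]) simp
  also have "\<dots> = (\<integral>p. (fst (fst p))\<^sup>2 * w3 p \<partial>sphM)"
    by (rule integral_cong_AE[OF m1 ae3])
  finally show ?B .
qed

text \<open>Here k is the weight in coordinates with the Jacobian already absorbed, so no factor
  \<rho>^2 remains on the right.\<close>

lemma sph_transfer_weight:
  fixes w \<kappa> :: "real ^ 3 \<Rightarrow> real"
  assumes w: "w \<in> borel_measurable (lebesgue_on Dm)" and w3: "w3 \<in> borel_measurable sphM"
    and eq: "AE p in sphM. w (Sp p) = w3 p" and \<kappa>: "\<kappa> \<in> borel_measurable borel"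
    and k: "\<And>p. p \<in> space sphM \<Longrightarrow> (fst (fst p))\<^sup>2 * \<kappa> (Sp p) = k (fst p)"
  shows "(\<integral>x. w x * \<kappa> x \<partial>lebesgue_on Dm) = (\<integral>p. w3 p * k (fst p) \<partial>sphM)"
proof -
  have \<kappa>S: "(\<lambda>p. \<kappa> (Sp p)) \<in> borel_measurable sphM"
    by (rule measurable_compose[OF Sp_measurable \<kappa>])
  have "(\<integral>x. w x * \<kappa> x \<partial>lebesgue_on Dm) = (\<integral>p. (fst (fst p))\<^sup>2 * (w3 p * \<kappa> (Sp p)) \<partial>sphM)"
  proof (rule sph_transfer(2))
    show "(\<lambda>x. w x * \<kappa> x) \<in> borel_measurable (lebesgue_on Dm)"
      using w measurable_lebesgue_Dm[OF \<kappa>] by measurable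
    show "(\<lambda>p. w3 p * \<kappa> (Sp p)) \<in> borel_measurable sphM" using w3 \<kappa>S by measurable
    show "AE p in sphM. w (Sp p) * \<kappa> (Sp p) = w3 p * \<kappa> (Sp p)" using eq by eventually_elim simp
  qed
  also have "\<dots> = (\<integral>p. w3 p * k (fst p) \<partial>sphM)"
    by (rule Bochner_Integration.integral_cong[OF refl]) (simp add: k[symmetric])
  finally show ?thesis .
qed

text \<open>The Jacobian can be divided out because 1 / \<rho>^2 is bounded by m^2 on the
  domain.\<close>

lemma sph_square_integrable:
  fixes w :: "real ^ 3 \<Rightarrow> real"
  assumes w: "w \<in> borel_measurable (lebesgue_on Dm)" and w3: "w3 \<in> borel_measurable sphM"
    and eq: "AE p in sphM. w (Sp p) = w3 p" and sq: "integrable (lebesgue_on Dm) (\<lambda>x. (w x)\<^sup>2)"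
  shows "integrable sphM (\<lambda>p. (w3 p)\<^sup>2)"
proof -
  have "integrable sphM (\<lambda>p. (fst (fst p))\<^sup>2 * (w3 p)\<^sup>2)"
  proof (rule sph_transfer(1)[THEN iffD1, OF _ _ _ sq])
    show "(\<lambda>x. (w x)\<^sup>2) \<in> borel_measurable (lebesgue_on Dm)" "(\<lambda>p. (w3 p)\<^sup>2) \<in> borel_measurable sphM"
      using w w3 by measurable
    show "AE p in sphM. (w (Sp p))\<^sup>2 = (w3 p)\<^sup>2" using eq by eventually_elim simp
  qed
  then have "integrable sphM (\<lambda>p. (fst (fst p))\<^sup>2 * (w3 p)\<^sup>2 * inverse ((fst (fst p))\<^sup>2))"
  proof (rule integrable_bounded_mult)
    show "(\<lambda>p. inverse ((fst (fst p))\<^sup>2)) \<in> borel_measurable sphM"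
      using r_measurable by measurable
    fix p assume "p \<in> space sphM"
    then have r: "1 / m < fst (fst p)" "0 < fst (fst p)" using rect_D[of "fst p"] by (auto simp: space_pair_measure)
    have "1 / real_of_int m > 0" using m by simp
    then have "(1 / m)\<^sup>2 \<le> (fst (fst p))\<^sup>2" using r by (intro power_mono) auto
    then have "inverse ((fst (fst p))\<^sup>2) \<le> inverse ((1 / m)\<^sup>2)"
      using \<open>1 / real_of_int m > 0\<close> by (intro le_imp_inverse_le) auto
    then show "\<bar>inverse ((fst (fst p))\<^sup>2)\<bar> \<le> inverse ((1 / m)\<^sup>2)" by simp
  qed
  then show ?thesis
  proof (rule Bochner_Integration.integrable_cong[THEN iffD1, rotated -1])
    fix p assume "p \<in> space sphM"
    then have "0 < fst (fst p)" using rect_D[of "fst p"] by (auto simp: space_pair_measure)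
    then show "(fst (fst p))\<^sup>2 * (w3 p)\<^sup>2 * inverse ((fst (fst p))\<^sup>2) = (w3 p)\<^sup>2" by simp
  qed simp
qed

end

section \<open>The weighted inequality on the spherical domain\<close>

lemma sqrt_power_int_wt:
  assumes "0 < 1 - c\<^sup>2"
  shows "sqrt (1 - c\<^sup>2) powi k = wt (real_of_int k / 2) c"
proof -
  have "sqrt (1 - c\<^sup>2) powi k = sqrt (1 - c\<^sup>2) powr real_of_int k"
    using assms by (simp add: powr_real_of_int')
  also have "\<dots> = wt (real_of_int k / 2) c"
    using assms by (simp add: wt_def powr_half_sqrt[symmetric] powr_powr)
  finally show ?thesis .
qed

lemma wt_measurable: "wt r \<in> borel_measurable borel"
  unfolding wt_def[abs_def] by measurable

context spherical_domain
begin

lemma sph_phi_norm: "norm (sph_phi x) = rho x"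
proof -
  have "(norm (sph_phi x))\<^sup>2 = (rho x)\<^sup>2 * ((cos (phi x))\<^sup>2 * ((cos (theta x))\<^sup>2 + (sin (theta x))\<^sup>2) + (sin (phi x))\<^sup>2)"
    unfolding norm_vec3 sph_phi_eq vector_scaleR_component vector_3 real_scaleR_def by algebra
  also have "\<dots> = (rho x)\<^sup>2" by simp
  finally show ?thesis by (simp add: rho_def)
qed

section \<open>Radial and polar components of a square integrable field\<close>

context
  fixes G :: "real ^ 3 \<Rightarrow> real ^ 3"
  assumes G: "G \<in> L2 Dm"
begin

lemma G_measurable: "G \<in> borel_measurable (lebesgue_on Dm)"
  and G_square: "integrable (lebesgue_on Dm) (\<lambda>x. (norm (G x))\<^sup>2)"
  using G by (simp_all add: L2_def)

text \<open>\<open>sph_rho\<close> is expressed through \<open>phi\<close> and \<open>theta\<close>;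
  on the domain it is x / |x|, whose measurability is evident.\<close>

lemma radial_measurable: "(\<lambda>x. G x \<bullet> sph_rho x) \<in> borel_measurable (lebesgue_on Dm)"
proof (rule measurable_cong[THEN iffD1])
  fix x assume "x \<in> space (lebesgue_on Dm)"
  then have "x \<in> Dm" by (simp add: space_restrict_space)
  then show "G x \<bullet> (x /\<^sub>R norm x) = G x \<bullet> sph_rho x" by (simp add: sph_rho_Dom)
next
  have "(\<lambda>x::real ^ 3. x /\<^sub>R norm x) \<in> borel_measurable (lebesgue_on Dm)"
    by (intro measurable_restrict_space1 measurable_completion) measurable
  then show "(\<lambda>x. G x \<bullet> (x /\<^sub>R norm x)) \<in> borel_measurable (lebesgue_on Dm)"
    using G_measurable by measurable
qed

lemma radial_square: "integrable (lebesgue_on Dm) (\<lambda>x. (G x \<bullet> sph_rho x)\<^sup>2)"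
proof (rule Bochner_Integration.integrable_bound[OF G_square])
  show "(\<lambda>x. (G x \<bullet> sph_rho x)\<^sup>2) \<in> borel_measurable (lebesgue_on Dm)"
    using radial_measurable by measurable
  show "AE x in lebesgue_on Dm. norm ((G x \<bullet> sph_rho x)\<^sup>2) \<le> norm ((norm (G x))\<^sup>2)"
  proof (rule AE_I2)
    fix x assume "x \<in> space (lebesgue_on Dm)"
    then have x: "x \<in> Dm" by (simp add: space_restrict_space)
    have "norm (sph_rho x) = 1" using Dom_facts(2)[OF x] by (simp add: sph_rho_Dom[OF x])
    then have "\<bar>G x \<bullet> sph_rho x\<bar> \<le> norm (G x)" using Cauchy_Schwarz_ineq2[of "G x" "sph_rho x"] by simp
    then have "\<bar>G x \<bullet> sph_rho x\<bar>\<^sup>2 \<le> (norm (G x))\<^sup>2" by (intro power_mono) auto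
    then show "norm ((G x \<bullet> sph_rho x)\<^sup>2) \<le> norm ((norm (G x))\<^sup>2)" by simp
  qed
qed

lemma polar_eq:
  assumes x: "x \<in> Dm"
  shows "- ((G x \<bullet> sph_phi x) / sin (phi x)) = (norm x)\<^sup>2 *
    (G x \<bullet> (((norm x)\<^sup>2 *\<^sub>R axis 3 1 - x $ 3 *\<^sub>R x) /\<^sub>R (norm x * ((norm x)\<^sup>2 - (x $ 3)\<^sup>2))))"
  unfolding sph_phi_Dom[OF x] using Dom_facts(2)[OF x] phi_Dom(3)[OF x]
  by (simp add: divide_inverse)

lemma polar_measurable: "(\<lambda>x. - ((G x \<bullet> sph_phi x) / sin (phi x))) \<in> borel_measurable (lebesgue_on Dm)"
proof (rule measurable_cong[THEN iffD1])
  fix x assume "x \<in> space (lebesgue_on Dm)"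
  then have "x \<in> Dm" by (simp add: space_restrict_space)
  from polar_eq[OF this, symmetric]
  show "(norm x)\<^sup>2 * (G x \<bullet> (((norm x)\<^sup>2 *\<^sub>R axis 3 1 - x $ 3 *\<^sub>R x) /\<^sub>R (norm x * ((norm x)\<^sup>2 - (x $ 3)\<^sup>2))))
    = - ((G x \<bullet> sph_phi x) / sin (phi x))" .
next
  have [measurable]: "(\<lambda>x::real ^ 3. x $ 3) \<in> borel_measurable borel"
    by (intro borel_measurable_continuous_onI continuous_intros)
  have "(\<lambda>x::real ^ 3. ((norm x)\<^sup>2 *\<^sub>R axis 3 1 - x $ 3 *\<^sub>R x) /\<^sub>R (norm x * ((norm x)\<^sup>2 - (x $ 3)\<^sup>2)))
      \<in> borel_measurable (lebesgue_on Dm)"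
    by (intro measurable_restrict_space1 measurable_completion) measurable
  moreover have "(\<lambda>x::real ^ 3. (norm x)\<^sup>2) \<in> borel_measurable (lebesgue_on Dm)"
    by (intro measurable_restrict_space1 measurable_completion) measurable
  ultimately show "(\<lambda>x. (norm x)\<^sup>2 * (G x \<bullet> (((norm x)\<^sup>2 *\<^sub>R axis 3 1 - x $ 3 *\<^sub>R x) /\<^sub>R (norm x * ((norm x)\<^sup>2 - (x $ 3)\<^sup>2)))))
      \<in> borel_measurable (lebesgue_on Dm)"
    using G_measurable by measurable
qed

lemma polar_square: "integrable (lebesgue_on Dm) (\<lambda>x. (- ((G x \<bullet> sph_phi x) / sin (phi x)))\<^sup>2)"
proof (rule Bochner_Integration.integrable_bound)
  \<comment> \<open>The factor 2 bounds 1 / sin^2 \<phi>, as |cos \<phi>| \<le> 1/2; the vector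
    \<open>sph_phi x\<close> has length \<rho> < 1.\<close>
  show "integrable (lebesgue_on Dm) (\<lambda>x. 2 * (norm (G x))\<^sup>2)" using G_square by simp
  show "(\<lambda>x. (- ((G x \<bullet> sph_phi x) / sin (phi x)))\<^sup>2) \<in> borel_measurable (lebesgue_on Dm)"
    using polar_measurable by measurable
  show "AE x in lebesgue_on Dm. norm ((- ((G x \<bullet> sph_phi x) / sin (phi x)))\<^sup>2) \<le> norm (2 * (norm (G x))\<^sup>2)"
  proof (rule AE_I2)
    fix x assume "x \<in> space (lebesgue_on Dm)"
    then have x: "x \<in> Dm" by (simp add: space_restrict_space)
    have "norm (sph_phi x) \<le> 1" using Dom_facts(4)[OF x] by (simp add: sph_phi_norm rho_def)
    then have "norm (G x) * norm (sph_phi x) \<le> norm (G x) * 1" by (intro mult_left_mono) auto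
    then have "\<bar>G x \<bullet> sph_phi x\<bar> \<le> norm (G x)" using Cauchy_Schwarz_ineq2[of "G x" "sph_phi x"] by linarith
    then have 1: "\<bar>G x \<bullet> sph_phi x\<bar>\<^sup>2 \<le> (norm (G x))\<^sup>2" by (intro power_mono) auto
    have "\<bar>x $ 3 / norm x\<bar>\<^sup>2 \<le> (1 / 2)\<^sup>2"
      using Dom_facts(6)[OF x] by (intro power_mono) auto
    then have c: "(x $ 3 / norm x)\<^sup>2 \<le> 1 / 4" unfolding power2_abs by (simp add: power2_eq_square)
    then have "(sin (phi x))\<^sup>2 = 1 - (x $ 3 / norm x)\<^sup>2"
      unfolding phi_Dom(2)[OF x] by (intro real_sqrt_pow2) linarith
    then have s: "(sin (phi x))\<^sup>2 \<ge> 1 / 2" using c by linarith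
    have "(- ((G x \<bullet> sph_phi x) / sin (phi x)))\<^sup>2 = (G x \<bullet> sph_phi x)\<^sup>2 / (sin (phi x))\<^sup>2"
      by (simp add: power_divide)
    also have "\<dots> \<le> (norm (G x))\<^sup>2 / (1 / 2)"
      using 1 s by (intro frac_le) auto
    finally show "norm ((- ((G x \<bullet> sph_phi x) / sin (phi x)))\<^sup>2) \<le> norm (2 * (norm (G x))\<^sup>2)" by simp
  qed
qed

end

end

theorem lemma4p4:
  fixes m i j k :: int and \<alpha> :: real and f :: "real ^ 3 \<Rightarrow> real"
  assumes "m \<ge> 10 ^ 3"
    and "0 < \<alpha>" and "\<alpha> \<le> pi / 6"
    and "i \<ge> -2" and "k \<ge> -1" and "0 \<le> j" and "j \<le> i + 2"
    and "f \<in> H1 (Dom m \<alpha>)"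
    and "axially_symmetric_on (Dom m \<alpha>) f"
    and "(\<integral>x. f x * rho x powi i * sin (phi x) powi k \<partial>lebesgue_on (Dom m \<alpha>)) = 0"
  shows "(\<integral>x. (f x / rho x)\<^sup>2 * rho x powi j * sin (phi x) powi k \<partial>lebesgue_on (Dom m \<alpha>))
    \<le> 4 / (real_of_int j + 1)\<^sup>2 *
        (\<integral>x. \<bar>d_rho (Dom m \<alpha>) f x\<bar>\<^sup>2 * rho x powi j * sin (phi x) powi k
           \<partial>lebesgue_on (Dom m \<alpha>))
    + 2 / (19 + real_of_int k) *
        (\<integral>x. \<bar>d_phi (Dom m \<alpha>) f x / rho x\<bar>\<^sup>2 * rho x powi j * sin (phi x) powi k
           \<partial>lebesgue_on (Dom m \<alpha>))"
proof -
  let ?D = "Dom m \<alpha>"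
  have m: "1 \<le> m" using assms(1) by simp
  interpret spherical_domain m \<alpha> using m assms(2,3) by unfold_locales
  let ?M2 = "lebI2 (1 / m) 1 (- sin \<alpha>) (sin \<alpha>)"
  let ?M3 = "?M2 \<Otimes>\<^sub>M lebT"
  let ?S = "\<lambda>p. sphc (fst (fst p)) (snd (fst p)) (snd p)"
  define G where "G = weak_grad ?D f"
  have f: "f \<in> L2 ?D" using assms(8) by (simp add: H1_def)
  have "\<exists>G. G \<in> L2 ?D \<and> is_weak_gradient ?D f G" using assms(8) by (auto simp: H1_def)
  then have "G \<in> L2 ?D \<and> is_weak_gradient ?D f G"
    unfolding G_def weak_grad_def by (rule someI_ex)
  then have G: "G \<in> L2 ?D" and weak: "is_weak_gradient ?D f G" by auto
  define P where "P = (\<lambda>x. G x \<bullet> sph_rho x)"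
  \<comment> \<open>The derivative of f in c = cos \<phi>, by the chain rule with d\<phi>/dc = - 1 /
    sin \<phi>.\<close>
  define Q where "Q = (\<lambda>x. - ((G x \<bullet> sph_phi x) / sin (phi x)))"
  have fm: "f \<in> borel_measurable (lebesgue_on ?D)" and f2: "integrable (lebesgue_on ?D) (\<lambda>x. (f x)\<^sup>2)"
    using f by (simp_all add: L2_def)
  have Pm: "P \<in> borel_measurable (lebesgue_on ?D)" and P2: "integrable (lebesgue_on ?D) (\<lambda>x. (P x)\<^sup>2)"
    unfolding P_def by (rule radial_measurable[OF G] radial_square[OF G])+
  have Qm: "Q \<in> borel_measurable (lebesgue_on ?D)" and Q2: "integrable (lebesgue_on ?D) (\<lambda>x. (Q x)\<^sup>2)"
    unfolding Q_def by (rule polar_measurable[OF G] polar_square[OF G])+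

  \<comment> \<open>Transfer to the coordinates (\<rho>, c, \<theta>)\<close>
  obtain f3 where f3: "f3 \<in> borel_measurable ?M3" "AE p in ?M3. f (?S p) = f3 p"
    using sph_representative[OF fm] .
  obtain p3 where p3: "p3 \<in> borel_measurable ?M3" "AE p in ?M3. P (?S p) = p3 p"
    using sph_representative[OF Pm] .
  obtain q3 where q3: "q3 \<in> borel_measurable ?M3" "AE p in ?M3. Q (?S p) = q3 p"
    using sph_representative[OF Qm] .
  have f32: "integrable ?M3 (\<lambda>p. (f3 p)\<^sup>2)" by (rule sph_square_integrable[OF fm f3 f2])
  have p32: "integrable ?M3 (\<lambda>p. (p3 p)\<^sup>2)" by (rule sph_square_integrable[OF Pm p3 P2])
  have q32: "integrable ?M3 (\<lambda>p. (q3 p)\<^sup>2)" by (rule sph_square_integrable[OF Qm q3 Q2])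
  \<comment> \<open>Axial symmetry enters here, and only for f.\<close>
  have f3avg: "AE p in ?M3. f3 p = avg f3 (fst p)"
  proof -
    obtain g where g: "AE x in lebesgue_on ?D. f x = g (rho x) (phi x)"
      using assms(9) by (auto simp: axially_symmetric_on_def)
    have "AE p in ?M3. f3 p = (\<lambda>y. g (fst y) (arccos (snd y))) (fst p)"
      using AE_sph[OF g] f3(2) AE_space
    proof eventually_elim
      case (elim p)
      then show ?case using Sp_D(4,5)[OF elim(3)] by simp
    qed
    then show ?thesis by (rule avg_eq_AE[OF f3(1) f32])
  qed
  \<comment> \<open>The Jacobian raises the exponent i of the mean condition to i + 2, a natural
    number by i \<ge> -2; then j \<le> i + 2 is the condition n \<le> a of Hardy's
    inequality.\<close>
  define n a where "n = nat j" and "a = nat (i + 2)"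
  have na: "n \<le> a" "int n = j" "int a = i + 2" using assms(4,6,7) by (auto simp: n_def a_def)
  \<comment> \<open>The weight sin^k \<phi> becomes \<open>wt ((l - 1) / 2)\<close>. From k \<ge> -1
    follows l \<ge> 0, and 18 + l = 19 + k gives the stated constant.\<close>
  define l where "l = real_of_int k + 1"
  have l: "0 \<le> l" using assms(5) by (simp add: l_def)
  let ?w = "wt ((l - 1) / 2)" and ?w' = "wt ((l + 1) / 2)"
  have s: "0 < sin \<alpha>" "sin \<alpha> \<le> 1 / 2" by (rule sin_alpha_bounds)+
  \<comment> \<open>The inner radius is at most 1/2, as the absorption at that end in
    \<open>hardy_mean_zero\<close> requires.\<close>
  have e: "0 < 1 / real_of_int m" "1 / real_of_int m \<le> 1 / 2"
    using assms(1) m by (auto simp: field_simps)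
  have weight: "(\<lambda>y. fst y ^ q * wt r (snd y)) \<in> borel_measurable ?M2"
    "\<exists>C. \<forall>y\<in>space ?M2. \<bar>fst y ^ q * wt r (snd y)\<bar> \<le> C"
    "\<And>y. y \<in> space ?M2 \<Longrightarrow> 0 \<le> fst y ^ q * wt r (snd y)" for q r
  proof -
    have [measurable]: "(\<lambda>y. wt r (snd y)) \<in> borel_measurable ?M2"
      by (rule measurable_compose[OF measurable_lebI_snd wt_measurable])
    show "(\<lambda>y. fst y ^ q * wt r (snd y)) \<in> borel_measurable ?M2" by measurable
    obtain C where C: "\<forall>x\<in>{- sin \<alpha>..sin \<alpha>}. \<bar>wt r x\<bar> \<le> C"
      using continuous_bounded_Icc[OF continuous_wt[OF s(2)]] .
    have "\<bar>fst y ^ q * wt r (snd y)\<bar> \<le> 1 * C" if y: "y \<in> space ?M2" for y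
      unfolding abs_mult
    proof (rule mult_mono)
      show "\<bar>fst y ^ q\<bar> \<le> 1" using rect_D[OF y] by (simp add: power_le_one)
      have "snd y \<in> {- sin \<alpha>..sin \<alpha>}" using y by (auto simp: space_lebI2)
      then show "\<bar>wt r (snd y)\<bar> \<le> C" using C by blast
    qed auto
    then show "\<exists>C. \<forall>y\<in>space ?M2. \<bar>fst y ^ q * wt r (snd y)\<bar> \<le> C" by blast
    show "0 \<le> fst y ^ q * wt r (snd y)" if "y \<in> space ?M2" for y
      using rect_D[OF that] by (simp add: wt_def)
  qed
  have nth[measurable]: "(\<lambda>x::real ^ 3. x $ 3) \<in> borel_measurable borel"
    by (intro borel_measurable_continuous_onI continuous_intros)
  \<comment> \<open>The weights carry a factor \<rho>^(-2), so that after multiplication by the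
    Jacobian exactly \<open>fst y ^ q * wt r (snd y)\<close> is left.\<close>
  have \<kappa>m: "(\<lambda>x::real ^ 3. norm x ^ q * wt r (x $ 3 / norm x) / (norm x)\<^sup>2) \<in> borel_measurable borel" for q r
    using measurable_compose[OF _ wt_measurable, of "\<lambda>x. x $ 3 / norm x" borel] by measurable
  have \<kappa>k: "(fst (fst p))\<^sup>2 * (norm (?S p) ^ q * wt r (?S p $ 3 / norm (?S p)) / (norm (?S p))\<^sup>2)
      = (\<lambda>y. fst y ^ q * wt r (snd y)) (fst p)" if p: "p \<in> space ?M3" for p q r
  proof -
    have "0 < fst (fst p)" using rect_D[of "fst p"] p by (auto simp: space_pair_measure)
    then show ?thesis unfolding Sp_D(3)[OF p] unfolding Sp_D(2)[OF p] by simp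
  qed
  note tw = sph_transfer_weight[OF _ _ _ \<kappa>m \<kappa>k]
  have f3sq: "AE p in ?M3. (f (?S p))\<^sup>2 = (f3 p)\<^sup>2" using f3(2) by eventually_elim simp
  have p3sq: "AE p in ?M3. (P (?S p))\<^sup>2 = (p3 p)\<^sup>2" using p3(2) by eventually_elim simp
  have q3sq: "AE p in ?M3. (Q (?S p))\<^sup>2 = (q3 p)\<^sup>2" using q3(2) by eventually_elim simp
  note [measurable] = fm Pm Qm f3(1) p3(1) q3(1)
  have sink: "sin (phi x) powi k = ?w (x $ 3 / norm x)" "sqrt (1 - (x $ 3 / norm x)\<^sup>2) > 0"
    "1 - (x $ 3 / norm x)\<^sup>2 > 0" if x: "x \<in> ?D" for x
  proof -
    show q: "1 - (x $ 3 / norm x)\<^sup>2 > 0"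
      by (rule one_minus_square_pos[OF Dom_facts(6)[OF x] order_refl])
    then show "sqrt (1 - (x $ 3 / norm x)\<^sup>2) > 0" by simp
    show "sin (phi x) powi k = ?w (x $ 3 / norm x)"
      unfolding phi_Dom(2)[OF x] sqrt_power_int_wt[OF q] by (simp add: l_def)
  qed
  have spD: "x \<in> ?D" if "x \<in> space (lebesgue_on ?D)" for x
    using that by (simp add: space_restrict_space)

  \<comment> \<open>The integrals of the theorem on the rectangle\<close>
  have L: "(\<integral>x. (f x / rho x)\<^sup>2 * rho x powi j * sin (phi x) powi k \<partial>lebesgue_on ?D)
      = 2 * pi * (\<integral>y. (avg f3 y)\<^sup>2 * (fst y ^ n * ?w (snd y)) \<partial>?M2)"
  proof -
    have "(\<integral>x. (f x / rho x)\<^sup>2 * rho x powi j * sin (phi x) powi k \<partial>lebesgue_on ?D)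
      = (\<integral>x. (f x)\<^sup>2 * (norm x ^ n * ?w (x $ 3 / norm x) / (norm x)\<^sup>2) \<partial>lebesgue_on ?D)"
      using spD by (intro Bochner_Integration.integral_cong refl)
        (simp add: sink(1) rho_def na(2)[symmetric] power_divide)
    also have "\<dots> = (\<integral>p. (f3 p)\<^sup>2 * (fst (fst p) ^ n * ?w (snd (fst p))) \<partial>?M3)"
      by (rule tw[OF _ _ f3sq]) measurable
    also have "\<dots> = 2 * pi * (\<integral>y. (avg f3 y)\<^sup>2 * (fst y ^ n * ?w (snd y)) \<partial>?M2)"
    proof -
      obtain C where C: "\<forall>y\<in>space ?M2. \<bar>fst y ^ n * ?w (snd y)\<bar> \<le> C" using weight(2) by blast
      show ?thesis by (rule avg_square_eq[OF f3(1) f32 weight(1) _ f3avg]) (use C in blast)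
    qed
    finally show ?thesis .
  qed
  \<comment> \<open>The exponent is n + 2 because no \<rho>^(-2) in the integrand offsets the
    Jacobian, in contrast to the integrals of f / \<rho> and of the polar derivative.\<close>
  have R1: "2 * pi * (\<integral>y. (avg p3 y)\<^sup>2 * (fst y ^ (n + 2) * ?w (snd y)) \<partial>?M2)
      \<le> (\<integral>x. \<bar>d_rho ?D f x\<bar>\<^sup>2 * rho x powi j * sin (phi x) powi k \<partial>lebesgue_on ?D)"
  proof -
    have "(\<integral>x. \<bar>d_rho ?D f x\<bar>\<^sup>2 * rho x powi j * sin (phi x) powi k \<partial>lebesgue_on ?D)
      = (\<integral>x. (P x)\<^sup>2 * (norm x ^ (n + 2) * ?w (x $ 3 / norm x) / (norm x)\<^sup>2) \<partial>lebesgue_on ?D)"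
    proof (intro Bochner_Integration.integral_cong refl)
      fix x assume "x \<in> space (lebesgue_on ?D)"
      then have x: "x \<in> ?D" by (rule spD)
      show "\<bar>d_rho ?D f x\<bar>\<^sup>2 * rho x powi j * sin (phi x) powi k
        = (P x)\<^sup>2 * (norm x ^ (n + 2) * ?w (x $ 3 / norm x) / (norm x)\<^sup>2)"
        unfolding sink(1)[OF x] na(2)[symmetric] using Dom_facts(1)[OF x]
        by (simp add: d_rho_def P_def G_def rho_def power_add power2_eq_square)
    qed
    also have "\<dots> = (\<integral>p. (p3 p)\<^sup>2 * (fst (fst p) ^ (n + 2) * ?w (snd (fst p))) \<partial>?M3)"
      by (rule tw[OF _ _ p3sq]) measurable
    also have "\<dots> \<ge> 2 * pi * (\<integral>y. (avg p3 y)\<^sup>2 * (fst y ^ (n + 2) * ?w (snd y)) \<partial>?M2)"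
    proof -
      obtain C where C: "\<forall>y\<in>space ?M2. \<bar>fst y ^ (n + 2) * ?w (snd y)\<bar> \<le> C" using weight(2) by blast
      show ?thesis by (rule avg_square_le[OF p3(1) p32 weight(1) _ weight(3)]) (use C in blast)
    qed
    finally show ?thesis .
  qed
  have R2: "2 * pi * (\<integral>y. (avg q3 y)\<^sup>2 * (fst y ^ n * ?w' (snd y)) \<partial>?M2)
      \<le> (\<integral>x. \<bar>d_phi ?D f x / rho x\<bar>\<^sup>2 * rho x powi j * sin (phi x) powi k \<partial>lebesgue_on ?D)"
  proof -
    have "(\<integral>x. \<bar>d_phi ?D f x / rho x\<bar>\<^sup>2 * rho x powi j * sin (phi x) powi k \<partial>lebesgue_on ?D)
      = (\<integral>x. (Q x)\<^sup>2 * (norm x ^ n * ?w' (x $ 3 / norm x) / (norm x)\<^sup>2) \<partial>lebesgue_on ?D)"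
    proof (intro Bochner_Integration.integral_cong refl)
      fix x assume "x \<in> space (lebesgue_on ?D)"
      then have x: "x \<in> ?D" by (rule spD)
      let ?c = "x $ 3 / norm x"
      \<comment> \<open>The squared \<phi>-derivative is sin^2 \<phi> times the squared
        c-derivative, which raises the exponent of the weight by 1.\<close>
      have "1 + (l - 1) / 2 = (l + 1) / 2" by (simp add: field_simps)
      then have "?w' ?c = wt 1 ?c * ?w ?c" by (simp only: wt_mult)
      also have "wt 1 ?c = (sin (phi x))\<^sup>2"
        using sink(3)[OF x] unfolding phi_Dom(2)[OF x] wt_def by simp
      finally have w': "?w' ?c = (sin (phi x))\<^sup>2 * ?w ?c" .
      show "\<bar>d_phi ?D f x / rho x\<bar>\<^sup>2 * rho x powi j * sin (phi x) powi k
        = (Q x)\<^sup>2 * (norm x ^ n * ?w' ?c / (norm x)\<^sup>2)"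
        unfolding sink(1)[OF x] w' na(2)[symmetric] using phi_Dom(3)[OF x]
        by (simp add: d_phi_def Q_def G_def rho_def power_divide)
    qed
    also have "\<dots> = (\<integral>p. (q3 p)\<^sup>2 * (fst (fst p) ^ n * ?w' (snd (fst p))) \<partial>?M3)"
      by (rule tw[OF _ _ q3sq]) measurable
    also have "\<dots> \<ge> 2 * pi * (\<integral>y. (avg q3 y)\<^sup>2 * (fst y ^ n * ?w' (snd y)) \<partial>?M2)"
    proof -
      obtain C where C: "\<forall>y\<in>space ?M2. \<bar>fst y ^ n * ?w' (snd y)\<bar> \<le> C" using weight(2) by blast
      show ?thesis by (rule avg_square_le[OF q3(1) q32 weight(1) _ weight(3)]) (use C in blast)
    qed
    finally show ?thesis .
  qed
  have mean: "(\<integral>y. avg f3 y * (fst y ^ a * ?w (snd y)) \<partial>?M2) = 0"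
  proof -
    have "0 = (\<integral>x. f x * (norm x ^ a * ?w (x $ 3 / norm x) / (norm x)\<^sup>2) \<partial>lebesgue_on ?D)"
      unfolding assms(10)[symmetric]
    proof (intro Bochner_Integration.integral_cong refl)
      fix x assume "x \<in> space (lebesgue_on ?D)"
      then have x: "x \<in> ?D" by (rule spD)
      have "norm x powi i = norm x powi (int a - 2)" using na(3) by simp
      also have "\<dots> = norm x ^ a / (norm x)\<^sup>2"
        using Dom_facts(1)[OF x] by (simp add: power_int_diff)
      finally show "f x * rho x powi i * sin (phi x) powi k
        = f x * (norm x ^ a * ?w (x $ 3 / norm x) / (norm x)\<^sup>2)"
        unfolding sink(1)[OF x] rho_def by simp
    qed
    also have "\<dots> = (\<integral>p. f3 p * (fst (fst p) ^ a * ?w (snd (fst p))) \<partial>?M3)"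
      by (rule tw[OF fm f3])
    also have "\<dots> = 2 * pi * (\<integral>y. avg f3 y * (fst y ^ a * ?w (snd y)) \<partial>?M2)"
    proof -
      obtain C where C: "\<forall>y\<in>space ?M2. \<bar>fst y ^ a * ?w (snd y)\<bar> \<le> C" using weight(2) by blast
      show ?thesis by (rule avg_linear[OF f3(1) f32 weight(1)]) (use C in blast)
    qed
    finally show ?thesis by simp
  qed

  \<comment> \<open>Weak derivatives of the averages on the rectangle\<close>
  have pair: "(\<integral>x. w x * (u (norm x) * v (x $ 3 / norm x)) / (norm x)\<^sup>2 \<partial>lebesgue_on ?D)
      = 2 * pi * (\<integral>y. avg w3 y * (u (fst y) * v (snd y)) \<partial>?M2)"
    if w: "w \<in> borel_measurable (lebesgue_on ?D)" and w3: "w3 \<in> borel_measurable ?M3"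
      "AE p in ?M3. w (?S p) = w3 p" "integrable ?M3 (\<lambda>p. (w3 p)\<^sup>2)"
      and u: "\<And>A. continuous_on A u" and v: "\<And>A. continuous_on A v" for w w3 u v
  proof -
    have [measurable]: "u \<in> borel_measurable borel" "v \<in> borel_measurable borel"
      using u v by (auto intro: borel_measurable_continuous_onI)
    obtain C where C: "\<forall>x\<in>{1 / real_of_int m..1}. \<bar>u x\<bar> \<le> C" using continuous_bounded_Icc[OF u] .
    obtain E where E: "\<forall>x\<in>{- sin \<alpha>..sin \<alpha>}. \<bar>v x\<bar> \<le> E" using continuous_bounded_Icc[OF v] .
    have "(\<integral>x. w x * (u (norm x) * v (x $ 3 / norm x)) / (norm x)\<^sup>2 \<partial>lebesgue_on ?D)
      = (\<integral>x. w x * (u (norm x) * v (x $ 3 / norm x) / (norm x)\<^sup>2) \<partial>lebesgue_on ?D)" by simp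
    also have "\<dots> = (\<integral>p. w3 p * (\<lambda>y. u (fst y) * v (snd y)) (fst p) \<partial>?M3)"
    proof (rule sph_transfer_weight[OF w w3(1,2)])
      show "(\<lambda>x::real ^ 3. u (norm x) * v (x $ 3 / norm x) / (norm x)\<^sup>2) \<in> borel_measurable borel"
        by measurable
      fix p assume p: "p \<in> space ?M3"
      have "0 < fst (fst p)" using rect_D[of "fst p"] p by (auto simp: space_pair_measure)
      then show "(fst (fst p))\<^sup>2 * (u (norm (?S p)) * v (?S p $ 3 / norm (?S p)) / (norm (?S p))\<^sup>2)
          = (\<lambda>y. u (fst y) * v (snd y)) (fst p)"
        unfolding Sp_D(3)[OF p] unfolding Sp_D(2)[OF p] by simp
    qed
    also have "\<dots> = 2 * pi * (\<integral>y. avg w3 y * (u (fst y) * v (snd y)) \<partial>?M2)"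
    proof (rule avg_linear[OF w3(1,3), where C="C * E"])
      show "(\<lambda>y. u (fst y) * v (snd y)) \<in> borel_measurable ?M2"
        using measurable_compose[OF measurable_lebI_fst, of u] measurable_compose[OF measurable_lebI_snd, of v]
        by measurable
      fix y assume "y \<in> space ?M2"
      then have "\<bar>u (fst y)\<bar> \<le> C" "\<bar>v (snd y)\<bar> \<le> E" using C E by (auto simp: space_lebI2)
      then show "\<bar>u (fst y) * v (snd y)\<bar> \<le> C * E" unfolding abs_mult by (intro mult_mono) auto
    qed
    finally show ?thesis .
  qed
  have cancel: "x = - y" if "2 * pi * x = - (2 * pi * y)" for x y :: real
  proof -
    have "2 * pi * (x + y) = 0" using that by (simp only: distrib_left)
    then show ?thesis by (simp add: eq_neg_iff_add_eq_0)
  qed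
  have main: "(\<integral>y. (avg f3 y)\<^sup>2 * (fst y ^ n * ?w (snd y)) \<partial>?M2)
    \<le> 4 / (real n + 1)\<^sup>2 * (\<integral>y. (avg p3 y)\<^sup>2 * (fst y ^ (n + 2) * ?w (snd y)) \<partial>?M2)
      + 2 / (18 + l) * (\<integral>y. (avg q3 y)\<^sup>2 * (fst y ^ n * ?w' (snd y)) \<partial>?M2)"
  proof (rule weighted_poincare_rectangle[OF e s l na(1)])
    fix \<eta> h assume \<eta>: "test1 (1 / m) 1 \<eta>" and h: "test1 (- sin \<alpha>) (sin \<alpha>) h"
    note d\<eta> = test1_deriv(2,3)[OF \<eta>] and dh = test1_deriv(2,3)[OF h]
    have "2 * pi * (\<integral>y. avg f3 y * (deriv \<eta> (fst y) * h (snd y)) \<partial>?M2)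
      = - (\<integral>x. (G x \<bullet> (x /\<^sub>R norm x)) * (\<eta> (norm x) * h (x $ 3 / norm x)) / (norm x)\<^sup>2 \<partial>lebesgue_on ?D)"
      using weak_gradient_radial[OF f G weak \<eta> h]
      unfolding pair[OF fm f3 f32 d\<eta>(2) dh(1)] .
    also have "(\<integral>x. (G x \<bullet> (x /\<^sub>R norm x)) * (\<eta> (norm x) * h (x $ 3 / norm x)) / (norm x)\<^sup>2 \<partial>lebesgue_on ?D)
      = (\<integral>x. P x * (\<eta> (norm x) * h (x $ 3 / norm x)) / (norm x)\<^sup>2 \<partial>lebesgue_on ?D)"
      using spD by (intro Bochner_Integration.integral_cong refl) (simp add: P_def sph_rho_Dom)
    also have "\<dots> = 2 * pi * (\<integral>y. avg p3 y * (\<eta> (fst y) * h (snd y)) \<partial>?M2)"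
      by (rule pair[OF Pm p3 p32 d\<eta>(1) dh(1)])
    finally show "(\<integral>y. avg f3 y * (deriv \<eta> (fst y) * h (snd y)) \<partial>?M2)
        = - (\<integral>y. avg p3 y * (\<eta> (fst y) * h (snd y)) \<partial>?M2)" by (rule cancel)
    have "2 * pi * (\<integral>y. avg f3 y * (\<eta> (fst y) * deriv h (snd y)) \<partial>?M2)
      = - (\<integral>x. (G x \<bullet> (((norm x)\<^sup>2 *\<^sub>R axis 3 1 - x $ 3 *\<^sub>R x) /\<^sub>R (norm x * ((norm x)\<^sup>2 - (x $ 3)\<^sup>2))))
        * (\<eta> (norm x) * h (x $ 3 / norm x)) \<partial>lebesgue_on ?D)"
      using weak_gradient_polar[OF f G weak \<eta> h]
      unfolding pair[OF fm f3 f32 d\<eta>(1) dh(2)] .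
    also have "(\<integral>x. (G x \<bullet> (((norm x)\<^sup>2 *\<^sub>R axis 3 1 - x $ 3 *\<^sub>R x) /\<^sub>R (norm x * ((norm x)\<^sup>2 - (x $ 3)\<^sup>2))))
        * (\<eta> (norm x) * h (x $ 3 / norm x)) \<partial>lebesgue_on ?D)
      = (\<integral>x. Q x * (\<eta> (norm x) * h (x $ 3 / norm x)) / (norm x)\<^sup>2 \<partial>lebesgue_on ?D)"
    proof (intro Bochner_Integration.integral_cong refl)
      fix x assume "x \<in> space (lebesgue_on ?D)"
      then have x: "x \<in> ?D" by (rule spD)
      show "(G x \<bullet> (((norm x)\<^sup>2 *\<^sub>R axis 3 1 - x $ 3 *\<^sub>R x) /\<^sub>R (norm x * ((norm x)\<^sup>2 - (x $ 3)\<^sup>2))))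
        * (\<eta> (norm x) * h (x $ 3 / norm x)) = Q x * (\<eta> (norm x) * h (x $ 3 / norm x)) / (norm x)\<^sup>2"
        unfolding Q_def polar_eq[OF G x] using Dom_facts(1)[OF x] by simp
    qed
    also have "\<dots> = 2 * pi * (\<integral>y. avg q3 y * (\<eta> (fst y) * h (snd y)) \<partial>?M2)"
      by (rule pair[OF Qm q3 q32 d\<eta>(1) dh(1)])
    finally show "(\<integral>y. avg f3 y * (\<eta> (fst y) * deriv h (snd y)) \<partial>?M2)
        = - (\<integral>y. avg q3 y * (\<eta> (fst y) * h (snd y)) \<partial>?M2)" by (rule cancel)
  qed (rule avg_measurable avg_square_integrable mean f3 f32 p3 p32 q3 q32)+

  \<comment> \<open>Return from the rectangle to the spherical domain\<close>
  have jn: "real n = real_of_int j" using na(2) by (metis of_int_of_nat_eq)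
  have kl: "18 + l = 19 + real_of_int k" by (simp add: l_def)
  have c1: "0 \<le> 4 / (real_of_int j + 1)\<^sup>2" and c2: "0 \<le> 2 / (19 + real_of_int k)"
    using assms(5) by auto
  have "2 * pi * (\<integral>y. (avg f3 y)\<^sup>2 * (fst y ^ n * ?w (snd y)) \<partial>?M2)
    \<le> 2 * pi * (4 / (real_of_int j + 1)\<^sup>2 * (\<integral>y. (avg p3 y)\<^sup>2 * (fst y ^ (n + 2) * ?w (snd y)) \<partial>?M2)
      + 2 / (19 + real_of_int k) * (\<integral>y. (avg q3 y)\<^sup>2 * (fst y ^ n * ?w' (snd y)) \<partial>?M2))"
    using main unfolding jn kl by (intro mult_left_mono) auto
  also have "\<dots> = 4 / (real_of_int j + 1)\<^sup>2 * (2 * pi * (\<integral>y. (avg p3 y)\<^sup>2 * (fst y ^ (n + 2) * ?w (snd y)) \<partial>?M2))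
      + 2 / (19 + real_of_int k) * (2 * pi * (\<integral>y. (avg q3 y)\<^sup>2 * (fst y ^ n * ?w' (snd y)) \<partial>?M2))"
    by (simp add: algebra_simps)
  also have "\<dots> \<le> 4 / (real_of_int j + 1)\<^sup>2 *
        (\<integral>x. \<bar>d_rho ?D f x\<bar>\<^sup>2 * rho x powi j * sin (phi x) powi k \<partial>lebesgue_on ?D)
    + 2 / (19 + real_of_int k) *
        (\<integral>x. \<bar>d_phi ?D f x / rho x\<bar>\<^sup>2 * rho x powi j * sin (phi x) powi k \<partial>lebesgue_on ?D)"
    by (intro add_mono mult_left_mono R1 R2 c1 c2)
  finally show ?thesis unfolding L .
qed

end
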